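(* The class of special co-ET0L groups is closed under taking free products with finitely many free factors: if $G_1,\dots,G_m$ ($m\ge 1$) are special co-ET0L groups, then the free product $G_1*\cdots*G_m$ is a special co-ET0L group.
   Context: **Check stack pushdown automata (cspda).** A cspda $M$ over a finite input alphabet $A$ is a non-deterministic finite-state automaton (with a finite set of states, a single initial state, and a subset of accepting states) with a one-way input tape, a check stack with finite alphabet $\Delta$ and a pushdown stack with finite alphabet $\Gamma$. A computation has two stages. - First stage (initialisation): starting from the initial state, $M$ non-deterministically pushes symbols onto the check stack under the control of its finite-state control. It does not read input and does not use the pushdown stack. (So the possible check stack contents form a regular language.) - Second stage: the check stack is never altered. $M$ may read letters from the input tape and push symbols onto, or pop symbols from, the pushdown stack. The read-write head is always at the top of the pushdown stack and at the corresponding height on the check stack (it moves up by one on both when a symbol is pushed and down by one when a symbol is popped). Each transition depends on the current state, the top pushdown symbol, the check stack symbol at the same height, and, if it is a reading transition, the next input letter, which is consumed. It changes the state and may push or pop. $M$ accepts $w\in A^*$ if some computation enters an accepting state at some stage after reading all of $w$; $L(M)$ is the set of accepted words. A configuration consists of the state and the contents of the two stacks. **Special cspda.** $M$ is special if (P1)–(P7) hold. - (P1) Each state is either reading (all its out-transitions read an input letter) or non-reading (none of its out-transitions reads an input letter). - (P2) The operation of $M$ throughout the second stage is deterministic. - (P3) $\Delta$ and $\Gamma$ both contain a bottom-of-stack symbol $\mathfrak b$ and a padding symbol $\mathsf p$, and $\Delta$ contains a top-of-stack symbol $\mathfrak t$. After initialisation the check stack has $\mathfrak b$ at the bottom and $\mathfrak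 t$ at the top. The first transition of the second stage writes $\mathfrak b$ at the bottom of the pushdown stack, after which $M$ moves into a reading state. The symbol $\mathfrak b$ occurs only at the bottoms of the two stacks, $\mathfrak t$ occurs only at the top of the check stack, $\mathfrak b$ is never popped, and when $\mathfrak t$ is seen on the check stack no symbol can be pushed (so the head never moves above the top of the check stack). - (P4) No computation contains an infinitely long sequence of non-reading transitions in the second stage. - (P5) All accepting states are reading states. - (P6) For every entry configuration $C$ and all $u,v\in A^*$ with $v\notin L(M)$, either $C^{uv}=C^u$ or $C^{uv}$ fails. - (P7) The accepting states are exactly the reading states that are not entry states. Terminology used here: a configuration is reading (accepting) if its state is reading (accepting). An entry configuration is one arising immediately after the first transition of the second stage (the one writing $\mathfrak b$ on the pushdown stack), and its state is an entry state. A failing configuration is a non-accepting reading configuration from which no accepting configuration can be reached. For a reading configuration $C$ and $w\in A^*$, $C^w$ is the configuration of $M$, run in the second stage from $C$ on input $w$, as it enters its first reading state after reading all of $w$ (so $C^{\epsilon}=C$ for the empty word $\epsilon$). $C^w$ fails if a failing configuration is entered in this process, or if the machine gets stuck before reaching such a reading state. **Special co-ET0L groups.** A language accepted by a special cspda is a special ET0L language. For a group $G$ with finite inverse-closed generating set $A$, $\mathsf{coWP}(G,A)=\{w\in A^*: w\neq_G 1\}$. A finitely generated group $G$ is a special co-ET0L group if, for some finite inverse-closed generating set $A$ of $G$, some special cspda with input alphabet $A$ (and, by convention, $A\subseteq\Delta$, $A\subseteq\Gamma$) accepts $\mathsf{coWP}(G,A)$. *)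

theory Defs
  imports "HOL-Algebra.Generated_Groups"
begin

section \<open>Check stack pushdown automata\<close>

datatype 'd pd_move = Push 'd | Pop | Stay

text \<open>
  \<^item> \<open>init_trans\<close>: \<open>(q, d, q')\<close> pushes \<open>d\<close> onto the check stack (first stage).
  \<^item> \<open>trans\<close>: \<open>(q, s, l, q', move)\<close> is a second-stage transition. The component \<open>s\<close> is
    \<open>Some (x, d)\<close> if the head sees \<open>x\<close> on top of the pushdown stack and \<open>d\<close> at the same height
    of the check stack, and \<open>None\<close> if the pushdown stack is empty; \<open>l\<close> is \<open>Some a\<close> if the
    transition reads \<open>a\<close> and \<open>None\<close> if it is non-reading.
\<close>

record ('q, 'a, 'd) cspda =
  states :: "'q set"
  start :: 'q
  accepting :: "'q set"
  in_alph :: "'a set"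
  check_alph :: "'d set"
  push_alph :: "'d set"
  init_trans :: "('q \<times> 'd \<times> 'q) set"
  trans :: "('q \<times> ('d \<times> 'd) option \<times> 'a option \<times> 'q \<times> 'd pd_move) set"

definition is_cspda :: "('q, 'a, 'd) cspda \<Rightarrow> bool" where
  "is_cspda M \<longleftrightarrow>
     finite (states M) \<and> start M \<in> states M \<and> accepting M \<subseteq> states M \<and>
     finite (in_alph M) \<and> finite (check_alph M) \<and> finite (push_alph M) \<and>
     (\<forall>(q, d, q') \<in> init_trans M. q \<in> states M \<and> d \<in> check_alph M \<and> q' \<in> states M) \<and>
     (\<forall>(q, s, l, q', mv) \<in> trans M.
        q \<in> states M \<and> q' \<in> states M \<and>
        (\<forall>x d. s = Some (x, d) \<longrightarrow> x \<in> push_alph M \<and> d \<in> check_alph M) \<and>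
        (\<forall>a. l = Some a \<longrightarrow> a \<in> in_alph M) \<and>
        (\<forall>x. mv = Push x \<longrightarrow> x \<in> push_alph M))"

text \<open>
  A configuration is \<open>(q, u, p)\<close> with check stack \<open>u\<close> and pushdown stack \<open>p\<close>. The list \<open>u\<close> is
  written from bottom to top, whereas \<open>p\<close> is written from top to bottom.
\<close>

type_synonym ('q, 'd) config = "'q \<times> 'd list \<times> 'd list"

inductive initialises :: "('q, 'a, 'd) cspda \<Rightarrow> 'q \<Rightarrow> 'd list \<Rightarrow> bool" for M where
  start: "initialises M (start M) []"
| push: "initialises M q u \<Longrightarrow> (q, d, q') \<in> init_trans M \<Longrightarrow> initialises M q' (u @ [d])"

definition seen :: "'d list \<Rightarrow> 'd list \<Rightarrow> ('d \<times> 'd) option" where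
  "seen u p = (if p = [] then None else Some (hd p, u ! (length p - 1)))"

text \<open>The head is always at a height of the check stack, so a push beyond its top is impossible.\<close>

inductive step :: "('q, 'a, 'd) cspda \<Rightarrow> ('q, 'd) config \<Rightarrow> 'a option \<Rightarrow> ('q, 'd) config \<Rightarrow> bool"
  for M where
  push: "(q, seen u p, l, q', Push x) \<in> trans M \<Longrightarrow> length p < length u \<Longrightarrow>
           step M (q, u, p) l (q', u, x # p)"
| pop: "(q, seen u (x # p), l, q', Pop) \<in> trans M \<Longrightarrow> step M (q, u, x # p) l (q', u, p)"
| stay: "(q, seen u p, l, q', Stay) \<in> trans M \<Longrightarrow> step M (q, u, p) l (q', u, p)"

inductive run :: "('q, 'a, 'd) cspda \<Rightarrow> ('q, 'd) config \<Rightarrow> 'a list \<Rightarrow> ('q, 'd) config \<Rightarrow> bool"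
  for M where
  refl: "run M C [] C"
| silent: "step M C None D \<Longrightarrow> run M D w E \<Longrightarrow> run M C w E"
| read: "step M C (Some a) D \<Longrightarrow> run M D w E \<Longrightarrow> run M C (a # w) E"

text \<open>
  The second stage starts with the first application of a member of \<open>trans\<close>; the runs of length
  zero below are the computations that have not left the first stage.
\<close>

definition lang :: "('q, 'a, 'd) cspda \<Rightarrow> 'a list set" where
  "lang M = {w \<in> lists (in_alph M).
     \<exists>q u C. initialises M q u \<and> run M (q, u, []) w C \<and> fst C \<in> accepting M}"

section \<open>Special cspda\<close>

text \<open>A state without any out-transition is both reading and non-reading.\<close>

definition reading_state :: "('q, 'a, 'd) cspda \<Rightarrow> 'q \<Rightarrow> bool" where
  "reading_state M q \<longleftrightarrow> q \<in> states M \<and> (\<forall>d q'. (q, d, q') \<notin> init_trans M) \<and>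
     (\<forall>s l q' mv. (q, s, l, q', mv) \<in> trans M \<longrightarrow> l \<noteq> None)"

definition nonreading_state :: "('q, 'a, 'd) cspda \<Rightarrow> 'q \<Rightarrow> bool" where
  "nonreading_state M q \<longleftrightarrow> q \<in> states M \<and>
     (\<forall>s l q' mv. (q, s, l, q', mv) \<in> trans M \<longrightarrow> l = None)"

definition entry_config :: "('q, 'a, 'd) cspda \<Rightarrow> ('q, 'd) config \<Rightarrow> bool" where
  "entry_config M C \<longleftrightarrow> (\<exists>q u l. initialises M q u \<and> step M (q, u, []) l C)"

definition entry_state :: "('q, 'a, 'd) cspda \<Rightarrow> 'q \<Rightarrow> bool" where
  "entry_state M q \<longleftrightarrow> (\<exists>u p. entry_config M (q, u, p))"

definition second_stage_config :: "('q, 'a, 'd) cspda \<Rightarrow> ('q, 'd) config \<Rightarrow> bool" where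
  "second_stage_config M C \<longleftrightarrow> (\<exists>E w. entry_config M E \<and> run M E w C)"

definition reading_config :: "('q, 'a, 'd) cspda \<Rightarrow> ('q, 'd) config \<Rightarrow> bool" where
  "reading_config M C \<longleftrightarrow> reading_state M (fst C)"

definition failing_config :: "('q, 'a, 'd) cspda \<Rightarrow> ('q, 'd) config \<Rightarrow> bool" where
  "failing_config M C \<longleftrightarrow> reading_config M C \<and> fst C \<notin> accepting M \<and>
     \<not> (\<exists>w D. run M C w D \<and> fst D \<in> accepting M)"

text \<open>
  \<open>after M C w D\<close> means \<open>D = C\<^sup>w\<close>. A reading configuration can only be left by reading a letter, so
  \<open>D\<close> is automatically the first reading configuration entered once all of \<open>w\<close> has been read.
\<close>

definition after :: "('q, 'a, 'd) cspda \<Rightarrow> ('q, 'd) config \<Rightarrow> 'a list \<Rightarrow> ('q, 'd) config \<Rightarrow> bool" where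
  "after M C w D \<longleftrightarrow> run M C w D \<and> reading_config M D"

definition stuck :: "('q, 'a, 'd) cspda \<Rightarrow> ('q, 'd) config \<Rightarrow> 'a list \<Rightarrow> bool" where
  "stuck M C w \<longleftrightarrow> \<not> (\<exists>D. step M C None D) \<and>
     (\<forall>a v. w = a # v \<longrightarrow> \<not> (\<exists>D. step M C (Some a) D))"

definition fails :: "('q, 'a, 'd) cspda \<Rightarrow> ('q, 'd) config \<Rightarrow> 'a list \<Rightarrow> bool" where
  "fails M C w \<longleftrightarrow> (\<exists>x y D. w = x @ y \<and> run M C x D \<and>
     (failing_config M D \<or> (stuck M D y \<and> \<not> (y = [] \<and> reading_config M D))))"

text \<open>
  Stack symbols: bottom-of-stack, padding, top-of-stack, input letters (which by convention belong
  to both stack alphabets), and further symbols.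
\<close>

datatype ('a, 's) stack_symbol = Bot | Pad | Top | Letter 'a | Aux 's

definition P1 :: "('q, 'a, 'd) cspda \<Rightarrow> bool" where
  "P1 M \<longleftrightarrow> (\<forall>q \<in> states M. reading_state M q \<or> nonreading_state M q)"

definition P2 :: "('q, 'a, 'd) cspda \<Rightarrow> bool" where
  "P2 M \<longleftrightarrow> (\<forall>q s l l' r r'.
     (q, s, l, r) \<in> trans M \<and> (q, s, l', r') \<in> trans M \<and> (l = l' \<or> l = None \<or> l' = None) \<longrightarrow>
     l = l' \<and> r = r')"

definition P3 :: "('q, 'a, ('a, 's) stack_symbol) cspda \<Rightarrow> bool" where
  "P3 M \<longleftrightarrow>
     {Bot, Pad, Top} \<subseteq> check_alph M \<and> {Bot, Pad} \<subseteq> push_alph M \<and>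
     (\<forall>q u l q' u' p. initialises M q u \<and> step M (q, u, []) l (q', u', p) \<longrightarrow>
        u \<noteq> [] \<and> hd u = Bot \<and> last u = Top \<and> l = None \<and> p = [Bot] \<and> reading_state M q') \<and>
     (\<forall>q u p. second_stage_config M (q, u, p) \<longrightarrow>
        Bot \<notin> set (tl u) \<and> Top \<notin> set (butlast u) \<and>
        Bot \<notin> set (butlast p) \<and> Top \<notin> set p) \<and>
     (\<forall>q d l q'. (q, Some (Bot, d), l, q', Pop) \<notin> trans M) \<and>
     (\<forall>q x l q' y. (q, Some (x, Top), l, q', Push y) \<notin> trans M)"

definition P4 :: "('q, 'a, 'd) cspda \<Rightarrow> bool" where
  "P4 M \<longleftrightarrow> \<not> (\<exists>c. second_stage_config M (c 0) \<and> (\<forall>n::nat. step M (c n) None (c (Suc n))))"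

definition P5 :: "('q, 'a, 'd) cspda \<Rightarrow> bool" where
  "P5 M \<longleftrightarrow> (\<forall>q \<in> accepting M. reading_state M q)"

definition P6 :: "('q, 'a, 'd) cspda \<Rightarrow> bool" where
  "P6 M \<longleftrightarrow> (\<forall>C u v. entry_config M C \<and> u \<in> lists (in_alph M) \<and> v \<in> lists (in_alph M) \<and>
     v \<notin> lang M \<longrightarrow> (\<exists>D. after M C (u @ v) D \<and> after M C u D) \<or> fails M C (u @ v))"

definition P7 :: "('q, 'a, 'd) cspda \<Rightarrow> bool" where
  "P7 M \<longleftrightarrow> accepting M = {q. reading_state M q \<and> \<not> entry_state M q}"

definition special_cspda :: "('q, 'a, ('a, 's) stack_symbol) cspda \<Rightarrow> bool" where
  "special_cspda M \<longleftrightarrow> is_cspda M \<and> P1 M \<and> P2 M \<and> P3 M \<and> P4 M \<and> P5 M \<and> P6 M \<and> P7 M"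

section \<open>Special co-ET0L groups\<close>

definition coWP :: "('a, 'b) monoid_scheme \<Rightarrow> 'a set \<Rightarrow> 'a list set" where
  "coWP G A = {w \<in> lists A. foldr (\<otimes>\<^bsub>G\<^esub>) w \<one>\<^bsub>G\<^esub> \<noteq> \<one>\<^bsub>G\<^esub>}"

definition inverse_closed_gen_set :: "('a, 'b) monoid_scheme \<Rightarrow> 'a set \<Rightarrow> bool" where
  "inverse_closed_gen_set G A \<longleftrightarrow> finite A \<and> A \<subseteq> carrier G \<and>
     (\<forall>a \<in> A. inv\<^bsub>G\<^esub> a \<in> A) \<and> generate G A = carrier G"

text \<open>
  States and auxiliary stack symbols are drawn from the natural numbers. Only finitely many of them
  occur in a given machine, so this is no restriction.
\<close>

definition special_coET0L_group :: "('a, 'b) monoid_scheme \<Rightarrow> bool" where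
  "special_coET0L_group G \<longleftrightarrow> group G \<and>
     (\<exists>A (M :: (nat, 'a, ('a, nat) stack_symbol) cspda).
        inverse_closed_gen_set G A \<and> special_cspda M \<and> in_alph M = A \<and>
        Letter ` A \<subseteq> check_alph M \<and> Letter ` A \<subseteq> push_alph M \<and>
        lang M = coWP G A)"

section \<open>Free products\<close>

text \<open>
  The free product of the groups \<open>G i\<close> (\<open>i \<in> I\<close>) consists of the words over the disjoint union of
  their carriers, modulo the congruence that deletes identities and multiplies adjacent letters
  from the same factor.
\<close>

inductive fp_eq :: "'i set \<Rightarrow> ('i \<Rightarrow> ('a, 'b) monoid_scheme) \<Rightarrow>
    ('i \<times> 'a) list \<Rightarrow> ('i \<times> 'a) list \<Rightarrow> bool" for I G where
  one: "i \<in> I \<Longrightarrow> fp_eq I G [(i, \<one>\<^bsub>G i\<^esub>)] []"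
| mult: "i \<in> I \<Longrightarrow> g \<in> carrier (G i) \<Longrightarrow> h \<in> carrier (G i) \<Longrightarrow>
    fp_eq I G [(i, g), (i, h)] [(i, g \<otimes>\<^bsub>G i\<^esub> h)]"
| refl: "x \<in> lists (SIGMA i:I. carrier (G i)) \<Longrightarrow> fp_eq I G x x"
| sym: "fp_eq I G x y \<Longrightarrow> fp_eq I G y x"
| trans: "fp_eq I G x y \<Longrightarrow> fp_eq I G y z \<Longrightarrow> fp_eq I G x z"
| append: "fp_eq I G x y \<Longrightarrow> fp_eq I G x' y' \<Longrightarrow> fp_eq I G (x @ x') (y @ y')"

definition fp_class :: "'i set \<Rightarrow> ('i \<Rightarrow> ('a, 'b) monoid_scheme) \<Rightarrow>
    ('i \<times> 'a) list \<Rightarrow> ('i \<times> 'a) list set" where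
  "fp_class I G x = {y. fp_eq I G x y}"

definition free_product :: "'i set \<Rightarrow> ('i \<Rightarrow> ('a, 'b) monoid_scheme) \<Rightarrow>
    ('i \<times> 'a) list set monoid" where
  "free_product I G =
     \<lparr>carrier = fp_class I G ` lists (SIGMA i:I. carrier (G i)),
      monoid.mult = (\<lambda>S T. \<Union>x\<in>S. \<Union>y\<in>T. fp_class I G (x @ y)),
      one = fp_class I G []\<rparr>"

end

theory Submission
  imports Defs "HOL-Library.Countable"
begin

text \<open>
  A configuration of the machine for the free product is a list of frames: each frame is an active
  factor machine together with the segment of the check stack on which it runs, and it carries the
  element contributed by one syllable of the word read so far. A letter of the factor \<open>j\<close> acts on
  the topmost frame if that belongs to \<open>j\<close>, and otherwise starts the machine of \<open>j\<close> on the next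
  segment for \<open>j\<close> further up the check stack; a frame that returns to its entry configuration is
  dropped. The word is accepted if all frames are accepting and at least one is present.

  Soundness: a trivial word reduces to the empty word by deleting trivial words over one factor,
  and by (P6) each deletion either does not affect the configuration or concerns a failing run.
  Only segments whose entry configuration is not failing are offered on the check stack (a regular
  condition), so a failing frame never returns to its entry configuration and blocks acceptance.

  Completeness: the entry configuration that accepts \<open>x\<^sub>1 x\<^sub>1\<inverse> \<dots> x\<^sub>N x\<^sub>N\<inverse> z\<close> is left
  unchanged by each \<open>x\<^sub>i x\<^sub>i\<inverse>\<close>. So there are segments that accept a prescribed \<open>z \<noteq> 1\<close> and do
  not fail on any short word, which makes the machine behave on short words like a group action.
\<close>

section \<open>Runs of deterministic machines\<close>

text \<open>All freedom of a deterministic second stage lies in the check stack: enough segments for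
  every syllable must be guessed before any input is read, and a poor guess may only cost
  acceptance, never grant it wrongly. Taking always the first suitable segment makes the segment of
  a frame a function of its factor and the frames below it. A frame that is dropped and started
  again thus comes back on the same segment, and this lets (P6) pass from the factors to frame
  lists. Acceptance looks at all frames, not just the top one, because a failing frame anywhere may
  stem from a trivial subword whose deletion (P6) does not justify. The finite control sees only the
  top frame and therefore carries one bit about those below. Whether a segment admits acceptance
  depends on symbols that are still to be written. The initialisation guesses a finite class of the
  rest of the segment and verifies the guess as it goes on.\<close>

lemma step_deterministic:
  assumes "P2 M" "step M C l D" "step M C l' D'" "l = l' \<or> l = None \<or> l' = None"
  shows "l = l' \<and> D = D'"
proof -
  have *: "\<exists>r. (fst C, seen (fst (snd C)) (snd (snd C)), l, r) \<in> trans M \<and>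
      D = (fst r, fst (snd C), case snd r of Push x \<Rightarrow> x # snd (snd C) | Pop \<Rightarrow> tl (snd (snd C)) | Stay \<Rightarrow> snd (snd C))"
    if "step M C l D" for l D
    using that by cases force+
  show ?thesis
    using *[OF assms(2)] *[OF assms(3)] assms(1,4) unfolding P2_def by metis
qed

lemma run_append: "run M C v D \<Longrightarrow> run M D w E \<Longrightarrow> run M C (v @ w) E"
  by (induction rule: run.induct) (auto intro: run.intros)

text \<open>The configurations reached from \<open>C\<close> form a chain. The second disjunct
  covers \<open>E\<close> lying before \<open>D\<close>: this is possible only if nothing is left to
  read, and then only silent moves separate the two.\<close>

lemma run_linear:
  assumes "P2 M" "run M C x D" "run M C (x @ y) E"
  shows "run M D y E \<or> (y = [] \<and> run M E [] D)"
  using assms(2,3)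
proof (induction arbitrary: E rule: run.induct)
  case (refl C)
  then show ?case by simp
next
  case (silent C D' w F)
  note IH = silent.IH
  from silent.prems show ?case
  proof (cases rule: run.cases)
    case refl
    then show ?thesis using run.silent[OF silent.hyps] by simp
  next
    case (silent D'')
    then have "D'' = D'" using step_deterministic[OF assms(1)] \<open>step M C None D'\<close> by blast
    then show ?thesis using \<open>run M D'' (w @ y) E\<close> IH by simp
  next
    case (read a D'' w')
    then show ?thesis using step_deterministic[OF assms(1)] \<open>step M C None D'\<close> by blast
  qed
next
  case (read C a D' w F)
  note IH = read.IH
  from read.prems show ?case
  proof (cases rule: run.cases)
    case (silent D'')
    then show ?thesis using step_deterministic[OF assms(1)] \<open>step M C (Some a) D'\<close> by blast
  next
    case (read b D'' w')
    then have "D'' = D'" using step_deterministic[OF assms(1)] \<open>step M C (Some a) D'\<close> by auto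
    then show ?thesis using read IH by simp
  qed simp
qed

lemma step_reading_state:
  assumes "P1 M" "is_cspda M" "step M C (Some a) D"
  shows "reading_config M C"
proof -
  obtain s q' mv where "(fst C, s, Some a, q', mv) \<in> trans M"
    using assms(3) by cases auto
  moreover from this have "fst C \<in> states M" using assms(2) unfolding is_cspda_def by auto
  ultimately show ?thesis using assms(1)
    unfolding P1_def reading_config_def nonreading_state_def by fastforce
qed

lemma reading_no_silent: "reading_config M C \<Longrightarrow> \<not> step M C None D"
  by (fastforce simp: reading_config_def reading_state_def elim!: step.cases)

lemma run_from_reading:
  assumes "reading_config M C" "run M C [] D"
  shows "D = C"
  using assms(2,1) by cases (auto dest: reading_no_silent)

lemma run_Cons_split:
  assumes "run M C (a # w) D"
  shows "\<exists>X Y. run M C [] X \<and> step M X (Some a) Y \<and> run M Y w D"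
  using assms
proof (induction C "a # w" D rule: run.induct)
  case (silent C D E)
  then show ?case using run.silent by blast
next
  case (read C D E)
  then show ?case using run.refl by blast
qed

text \<open>The cut is placed just before the first letter of \<open>v\<close> is read: the
  transition taken there reads, so by (P1) its source is a reading configuration. For empty
  \<open>v\<close> the end point itself is one.\<close>

lemma run_append_split:
  assumes "P1 M" "is_cspda M" "run M C (u @ v) D" "reading_config M D"
  shows "\<exists>E. after M C u E \<and> run M E v D"
proof (cases v)
  case Nil
  then have "after M C u D" using assms unfolding after_def by simp
  then show ?thesis using Nil run.refl by metis
next
  case (Cons a v')
  have "\<exists>E. after M C u E \<and> run M E v D" if "run M C x D" "x = u @ v" for x
    using that
  proof (induction arbitrary: u rule: run.induct)
    case (refl C)
    then show ?case using Cons by auto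
  next
    case (silent C D w E)
    then show ?case unfolding after_def using run.silent by blast
  next
    case (read C b D w E)
    show ?case
    proof (cases u)
      case Nil
      then have "after M C u C" using step_reading_state[OF assms(1,2) read.hyps(1)]
        unfolding after_def by (simp add: run.refl)
      moreover have "run M C v E" using run.read[OF read.hyps(1,2)] read.prems Nil by simp
      ultimately show ?thesis by blast
    next
      case (Cons c u')
      then obtain F where "after M D u' F" "run M F v E" using read.IH read.prems by auto
      then have "after M C u F" using run.read[OF read.hyps(1)] read.prems Cons
        unfolding after_def by simp
      then show ?thesis using \<open>run M F v E\<close> by blast
    qed
  qed
  then show ?thesis using assms(3) by blast
qed

lemma after_append:
  assumes "P1 M" "is_cspda M"
  shows "after M C (u @ v) D \<longleftrightarrow> (\<exists>E. after M C u E \<and> after M E v D)"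
  using run_append_split[OF assms] run_append unfolding after_def by metis

lemma after_unique:
  assumes "P2 M" "after M C w D" "after M C w E"
  shows "D = E"
  using run_linear[OF assms(1), of C w D "[]" E] run_from_reading assms(2,3)
  unfolding after_def by fastforce

text \<open>Turns the relation \<open>after\<close> for one letter into a partial function, so that
  the same \<open>iter\<close> serves the factor machines, the frame lists and the product
  machine.\<close>

definition del :: "('q, 'a, 'd) cspda \<Rightarrow> ('q, 'd) config \<Rightarrow> 'a \<Rightarrow> ('q, 'd) config option" where
  "del M C a = (if \<exists>D. after M C [a] D then Some (THE D. after M C [a] D) else None)"

fun iter :: "('c \<Rightarrow> 'a \<Rightarrow> 'c option) \<Rightarrow> 'c \<Rightarrow> 'a list \<Rightarrow> 'c option" where
  "iter f c [] = Some c"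
| "iter f c (a # w) = Option.bind (f c a) (\<lambda>d. iter f d w)"

lemma iter_append: "iter f c (v @ w) = Option.bind (iter f c v) (\<lambda>d. iter f d w)"
  by (induction v arbitrary: c) (auto split: bind_split)

abbreviation dels :: "('q, 'a, 'd) cspda \<Rightarrow> ('q, 'd) config \<Rightarrow> 'a list \<Rightarrow> ('q, 'd) config option" where
  "dels M \<equiv> iter (del M)"

lemma del_eq_Some:
  assumes "P2 M"
  shows "del M C a = Some D \<longleftrightarrow> after M C [a] D"
proof -
  have "(THE D. after M C [a] D) = D" if "after M C [a] D" for D
    using that after_unique[OF assms] by blast
  then show ?thesis unfolding del_def by (metis option.distinct(1) option.inject)
qed

lemma dels_eq_Some:
  assumes "P1 M" "P2 M" "is_cspda M" "reading_config M C"
  shows "dels M C w = Some D \<longleftrightarrow> after M C w D"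
  using assms(4)
proof (induction w arbitrary: C)
  case Nil
  have "after M C [] D \<longleftrightarrow> D = C"
    unfolding after_def using run_from_reading[OF Nil] run.refl[of M C] Nil by metis
  then show ?case by auto
next
  case (Cons a w)
  have "after M C (a # w) D \<longleftrightarrow> (\<exists>E. after M C [a] E \<and> after M E w D)"
    using after_append[OF assms(1,3), of C "[a]" w D] by simp
  also have "\<dots> \<longleftrightarrow> (\<exists>E. del M C a = Some E \<and> dels M E w = Some D)"
    using Cons.IH del_eq_Some[OF assms(2)] unfolding after_def by metis
  finally show ?case by (auto split: bind_split)
qed

lemma dels_reading:
  assumes "P2 M" "reading_config M C" "dels M C w = Some D"
  shows "reading_config M D"
  using assms(2,3)
proof (induction w arbitrary: C)
  case (Cons a w)
  then show ?case using del_eq_Some[OF assms(1)] unfolding after_def by (auto split: bind_splits)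
qed simp

lemma second_stage_run:
  "second_stage_config M C \<Longrightarrow> run M C w D \<Longrightarrow> second_stage_config M D"
  unfolding second_stage_config_def using run_append by metis

lemma silent_normal:
  assumes "P4 M" "second_stage_config M C"
  shows "\<exists>D. run M C [] D \<and> \<not> (\<exists>E. step M D None E)"
proof (rule ccontr)
  assume no: "\<not> ?thesis"
  define nx where "nx D = (SOME E. step M D None E)" for D
  have nx: "step M D None (nx D)" if "run M C [] D" for D
    using no that unfolding nx_def by (metis someI_ex)
  have r: "run M C [] ((nx ^^ n) C)" for n
  proof (induction n)
    case (Suc n)
    show ?case using run_append[OF Suc run.silent[OF nx[OF Suc] run.refl]] by simp
  qed (simp add: run.refl)
  have "second_stage_config M ((nx ^^ 0) C)" "\<forall>n. step M ((nx ^^ n) C) None ((nx ^^ Suc n) C)"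
    using assms(2) nx[OF r] by simp_all
  then show False using assms(1) unfolding P4_def
    by (auto dest!: spec[of _ "\<lambda>n. (nx ^^ n) C"])
qed

text \<open>(P4) leaves getting stuck as the only reason: silent moves cannot go on for ever, so
  they end where no silent move exists, and that configuration, not being a reading one, cannot read
  a letter either.\<close>

lemma fails_if_dels_None:
  assumes "P1 M" "P2 M" "P4 M" "is_cspda M" "second_stage_config M C" "reading_config M C"
    "dels M C w = None"
  shows "fails M C w"
  using assms(5-7)
proof (induction w arbitrary: C)
  case (Cons a w)
  show ?case
  proof (cases "del M C a")
    case (Some D)
    then have D: "run M C [a] D" "reading_config M D"
      using del_eq_Some[OF assms(2)] unfolding after_def by auto
    then have "fails M D w"
      using Cons.IH[OF second_stage_run[OF Cons.prems(1) D(1)]] Cons.prems(3) Some by simp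
    then obtain x y E where "w = x @ y" "run M D x E"
      "failing_config M E \<or> stuck M E y \<and> \<not> (y = [] \<and> reading_config M E)"
      unfolding fails_def by blast
    then show ?thesis unfolding fails_def
      using run_append[OF D(1)] by (metis append_Cons append_Nil)
  next
    case None
    show ?thesis
    proof (cases "\<exists>D. step M C (Some a) D")
      case False
      then have "stuck M C (a # w)" unfolding stuck_def
        using reading_no_silent Cons.prems(2) by blast
      then show ?thesis unfolding fails_def
        by (intro exI[of _ "[]"] exI[of _ "a # w"] exI[of _ C]) (simp add: run.refl)
    next
      case True
      then obtain D where D: "step M C (Some a) D" by blast
      then have "second_stage_config M D"
        using Cons.prems(1) second_stage_run by (meson run.intros)
      then obtain E where E: "run M D [] E" "\<not> (\<exists>F. step M E None F)"
        using silent_normal[OF assms(3)] by blast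
      have r: "run M C [a] E" using D E(1) by (auto intro: run.intros)
      have nr: "\<not> reading_config M E"
        using None r unfolding del_def after_def by (metis option.distinct(1))
      then have "stuck M E w" unfolding stuck_def
        using E(2) step_reading_state[OF assms(1,4)] by blast
      moreover have "a # w = [a] @ w" by simp
      ultimately show ?thesis unfolding fails_def using r nr by blast
    qed
  qed
qed simp

text \<open>By (P5) accepting configurations are reading ones, so reachability of acceptance can be
  tested with \<open>dels\<close> alone.\<close>

lemma failing_config_iff:
  assumes "P1 M" "P2 M" "P5 M" "is_cspda M" "reading_config M C"
  shows "failing_config M C \<longleftrightarrow> (\<forall>w D. dels M C w = Some D \<longrightarrow> fst D \<notin> accepting M)"
proof
  assume f: "failing_config M C"
  then show "\<forall>w D. dels M C w = Some D \<longrightarrow> fst D \<notin> accepting M"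
    using dels_eq_Some[OF assms(1,2,4,5)]
    unfolding failing_config_def after_def by blast
next
  assume *: "\<forall>w D. dels M C w = Some D \<longrightarrow> fst D \<notin> accepting M"
  have "fst D \<notin> accepting M" if "run M C w D" for w D
    using * dels_eq_Some[OF assms(1,2,4,5)] that assms(3)
    unfolding after_def P5_def reading_config_def by blast
  then show "failing_config M C"
    unfolding failing_config_def using assms(5) run.refl by fast
qed

text \<open>A stuck configuration excludes any reading end point \<open>E\<close> for
  \<open>w\<close>: by determinism \<open>E\<close> would lie beyond it, or before it by silent
  moves, which a reading configuration does not have.\<close>

lemma fails_cases:
  assumes "P1 M" "P2 M" "P5 M" "is_cspda M" "reading_config M C" "fails M C w"
  shows "dels M C w = None \<or> (\<exists>x y D. w = x @ y \<and> dels M C x = Some D \<and> failing_config M D)"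
proof -
  obtain x y D where w: "w = x @ y" and r: "run M C x D" and
    d: "failing_config M D \<or> stuck M D y \<and> \<not> (y = [] \<and> reading_config M D)"
    using assms(6) unfolding fails_def by blast
  show ?thesis
  proof (cases "failing_config M D")
    case True
    then have "after M C x D" using r unfolding after_def failing_config_def by simp
    then show ?thesis using True w dels_eq_Some[OF assms(1,2,4,5)] by blast
  next
    case False
    then have s: "stuck M D y" "\<not> (y = [] \<and> reading_config M D)" using d by auto
    have "\<not> after M C w E" for E
    proof
      assume "after M C w E"
      then have E: "run M C (x @ y) E" "reading_config M E" unfolding after_def w by auto
      have "y = [] \<and> run M E [] D"
      proof (rule ccontr)
        assume n: "\<not> ?thesis"
        then have "run M D y E" using run_linear[OF assms(2) r E(1)] by blast
        then show False using s E n by cases (auto simp: stuck_def intro: run.refl)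
      qed
      then show False using run_from_reading E(2) s by metis
    qed
    then show ?thesis using dels_eq_Some[OF assms(1,2,4,5)] by (cases "dels M C w") auto
  qed
qed

section \<open>Check stacks that admit acceptance\<close>

text \<open>
  What can happen above a pushdown entry depends only on the part of the check stack from the
  height of that entry upwards, and these suffixes fall into finitely many classes. Hence the check
  stacks whose entry configuration can reach an accepting one form a regular language.
\<close>

inductive pops :: "('q, 'a, 'd) cspda \<Rightarrow> 'd list \<Rightarrow> 'q \<Rightarrow> 'd \<Rightarrow> 'q \<Rightarrow> bool" for M where
  pop: "(q, Some (x, d), l, r, Pop) \<in> trans M \<Longrightarrow> pops M (d # s) q x r"
| stay: "(q, Some (x, d), l, q', Stay) \<in> trans M \<Longrightarrow> pops M (d # s) q' x r \<Longrightarrow> pops M (d # s) q x r"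
| push: "(q, Some (x, d), l, q', Push y) \<in> trans M \<Longrightarrow> pops M s q' y q'' \<Longrightarrow>
    pops M (d # s) q'' x r \<Longrightarrow> pops M (d # s) q x r"

text \<open>The entry \<open>x\<close> itself is never popped: acceptance occurs at its level,
  inside a pushed part, or after a pushed part has been popped again. The premise
  \<open>x \<in> push_alph M\<close> in \<open>here\<close> keeps the relation finite for each
  suffix.\<close>

inductive accs :: "('q, 'a, 'd) cspda \<Rightarrow> 'd list \<Rightarrow> 'q \<Rightarrow> 'd \<Rightarrow> bool" for M where
  here: "q \<in> accepting M \<Longrightarrow> x \<in> push_alph M \<Longrightarrow> accs M (d # s) q x"
| stay: "(q, Some (x, d), l, q', Stay) \<in> trans M \<Longrightarrow> accs M (d # s) q' x \<Longrightarrow> accs M (d # s) q x"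
| push: "(q, Some (x, d), l, q', Push y) \<in> trans M \<Longrightarrow> accs M s q' y \<Longrightarrow> accs M (d # s) q x"
| push_pop: "(q, Some (x, d), l, q', Push y) \<in> trans M \<Longrightarrow> pops M s q' y q'' \<Longrightarrow>
    accs M (d # s) q'' x \<Longrightarrow> accs M (d # s) q x"

text \<open>The rules for \<open>d # s\<close> consult \<open>s\<close> only through
  \<open>pops M s\<close>. Hence the class of a suffix can be computed from its lowest symbol and
  the class of the rest.\<close>

lemma pops_mono:
  assumes "pops M s' q x r" "s' = d # s" "\<And>q x r. pops M s q x r \<Longrightarrow> pops M t q x r"
  shows "pops M (d # t) q x r"
  using assms(1,2)
  by (induction rule: pops.induct) (auto intro: pops.intros assms(3))

lemma accs_mono:
  assumes "accs M s' q x" "s' = d # s" "\<And>q x r. pops M s q x r \<Longrightarrow> pops M t q x r"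
    "\<And>q x. accs M s q x \<Longrightarrow> accs M t q x"
  shows "accs M (d # t) q x"
  using assms(1,2)
  by (induction rule: accs.induct) (auto intro: accs.intros assms(3,4))

lemma run_step: "step M C l D \<Longrightarrow> \<exists>w. run M C w D"
  by (cases l) (blast intro: run.intros)+

text \<open>The equal lengths of \<open>p\<close> and \<open>v\<close> put the entry
  \<open>x\<close> level with the first symbol of \<open>s\<close>.\<close>

lemma pops_run:
  assumes "pops M s q x r" "u = v @ s" "length p = length v"
  shows "\<exists>w. run M (q, u, x # p) w (r, u, p)"
  using assms
proof (induction arbitrary: v p rule: pops.induct)
  case (pop q x d l r s)
  then have "seen u (x # p) = Some (x, d)" by (simp add: seen_def)
  then show ?case using run_step[OF step.pop] pop.hyps by metis
next
  case (stay q x d l q' s r)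
  then have "seen u (x # p) = Some (x, d)" by (simp add: seen_def)
  then have "step M (q, u, x # p) l (q', u, x # p)" using step.stay[of q u "x # p"] stay.hyps by metis
  then show ?case using run_append run_step stay.IH[OF stay.prems] by meson
next
  case (push q x d l q' y s q'' r)
  then have "seen u (x # p) = Some (x, d)" by (simp add: seen_def)
  moreover have "length (x # p) < length u \<or> s = []" using push.prems by (cases s) auto
  moreover have "s \<noteq> []" using push.hyps(2) by cases auto
  ultimately have "step M (q, u, x # p) l (q', u, y # x # p)"
    using step.push[of q u "x # p"] push.hyps by metis
  moreover have "\<exists>w. run M (q', u, y # x # p) w (q'', u, x # p)"
    using push.IH(1)[of "v @ [d]" "x # p"] push.prems by simp
  ultimately show ?case using run_append run_step push.IH(2)[OF push.prems] by meson
qed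

lemma accs_run:
  assumes "accs M s q x" "u = v @ s" "length p = length v"
  shows "\<exists>w D. run M (q, u, x # p) w D \<and> fst D \<in> accepting M"
  using assms
proof (induction arbitrary: v p rule: accs.induct)
  case (here q x d s)
  then show ?case using run.refl by fastforce
next
  case (stay q x d l q' s)
  then have "seen u (x # p) = Some (x, d)" by (simp add: seen_def)
  then have "step M (q, u, x # p) l (q', u, x # p)" using step.stay[of q u "x # p"] stay.hyps by metis
  then show ?case using run_append run_step stay.IH[OF stay.prems] by meson
next
  case (push q x d l q' y s)
  then have "seen u (x # p) = Some (x, d)" by (simp add: seen_def)
  moreover have "length (x # p) < length u \<or> s = []" using push.prems by (cases s) auto
  moreover have "s \<noteq> []" using push.hyps(2) by cases auto
  ultimately have "step M (q, u, x # p) l (q', u, y # x # p)"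
    using step.push[of q u "x # p"] push.hyps by metis
  moreover have "\<exists>w D. run M (q', u, y # x # p) w D \<and> fst D \<in> accepting M"
    using push.IH[of "v @ [d]" "x # p"] push.prems by simp
  ultimately show ?case using run_append run_step by meson
next
  case (push_pop q x d l q' y s q'')
  then have "seen u (x # p) = Some (x, d)" by (simp add: seen_def)
  moreover have "length (x # p) < length u \<or> s = []" using push_pop.prems by (cases s) auto
  moreover have "s \<noteq> []" using push_pop.hyps(2) by cases auto
  ultimately have "step M (q, u, x # p) l (q', u, y # x # p)"
    using step.push[of q u "x # p"] push_pop.hyps by metis
  moreover have "\<exists>w. run M (q', u, y # x # p) w (q'', u, x # p)"
    using pops_run[OF push_pop.hyps(2), of u "v @ [d]" "x # p"] push_pop.prems by simp
  ultimately show ?case using run_append run_step push_pop.IH[OF push_pop.prems] by meson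
qed

text \<open>Acceptance from a whole pushdown, arranged so that it can be pulled back along a single
  step. The empty stack gives \<open>False\<close>, since in the second stage the bottom symbol is
  never popped.\<close>

fun acc_stack :: "('q, 'a, 'd) cspda \<Rightarrow> 'd list \<Rightarrow> 'q \<Rightarrow> 'd list \<Rightarrow> bool" where
  "acc_stack M u q [] \<longleftrightarrow> False"
| "acc_stack M u q (x # p) \<longleftrightarrow> accs M (drop (length p) u) q x \<or>
     (\<exists>r. pops M (drop (length p) u) q x r \<and> acc_stack M u r p)"

lemma acc_stack_step:
  assumes "step M (q, u, x # p) l (q', u', p')" "length p < length u" "acc_stack M u q' p'"
  shows "acc_stack M u q (x # p)"
proof -
  define d s where "d = u ! length p" "s = drop (Suc (length p)) u"
  have u: "drop (length p) u = d # s"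
    using assms(2) unfolding d_s_def by (simp add: Cons_nth_drop_Suc)
  from assms(1) show ?thesis
  proof cases
    case (push y)
    then have "(q, Some (x, d), l, q', Push y) \<in> trans M" by (simp add: seen_def d_s_def)
    moreover from push assms(3) have "acc_stack M u q' (y # x # p)" by simp
    ultimately show ?thesis
      using u by (auto simp: d_s_def(2)[symmetric] intro: accs.intros pops.intros)
  next
    case pop
    then have "(q, Some (x, d), l, q', Pop) \<in> trans M" by (simp add: seen_def d_s_def)
    then show ?thesis using u pop assms(3) by (auto intro: pops.intros)
  next
    case stay
    then have "(q, Some (x, d), l, q', Stay) \<in> trans M" by (simp add: seen_def d_s_def)
    then show ?thesis using u stay assms(3) by (auto intro: accs.intros pops.intros)
  qed
qed

text \<open>The class of a suffix is its pair of finite relations \<open>pops\<close> and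
  \<open>accs\<close>; both are needed because \<open>accs\<close> on \<open>d # s\<close> consults
  \<open>pops\<close> on \<open>s\<close>. Numbers stand for the classes since these become part of
  the states of the product machine.\<close>

lemma ex_suffix_code:
  fixes M :: "('q, 'a, 'd) cspda"
  assumes "is_cspda M"
  shows "\<exists>t :: 'd list \<Rightarrow> nat. finite (range t) \<and>
    (\<forall>d s s'. t s = t s' \<longrightarrow> t (d # s) = t (d # s')) \<and>
    (\<forall>s s' q x. t s = t s' \<longrightarrow> accs M s q x = accs M s' q x)"
proof -
  define T where "T s = ({(q, x, r). pops M s q x r}, {(q, x). accs M s q x})" for s :: "'d list"
  let ?S = "states M" and ?X = "push_alph M"
  have tr: "q \<in> ?S" "x \<in> ?X" "r \<in> ?S" if "(q, Some (x, d), l, r, mv) \<in> trans M" for q x d l r mv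
    using that assms unfolding is_cspda_def by fastforce+
  have p: "q \<in> ?S \<and> x \<in> ?X \<and> r \<in> ?S" if "pops M s q x r" for s q x r
    using that by (induction rule: pops.induct) (auto dest: tr)
  have a: "q \<in> ?S \<and> x \<in> ?X" if "accs M s q x" for s q x
    using that assms
    by (induction rule: accs.induct) (auto dest: tr simp: is_cspda_def)
  have "range T \<subseteq> Pow (?S \<times> ?X \<times> ?S) \<times> Pow (?S \<times> ?X)"
    unfolding T_def using p a by blast
  moreover have "finite (Pow (?S \<times> ?X \<times> ?S) \<times> Pow (?S \<times> ?X))"
    using assms unfolding is_cspda_def by simp
  ultimately have fin: "finite (range T)" by (rule finite_subset)
  obtain f :: "_ \<Rightarrow> nat" where f: "inj_on f (range T)"
    using finite_imp_inj_to_nat_seg[OF fin] by (elim exE conjE)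
  have eq: "f (T s) = f (T s') \<longleftrightarrow> (\<forall>q x r. pops M s q x r = pops M s' q x r) \<and>
      (\<forall>q x. accs M s q x = accs M s' q x)" for s s'
  proof -
    have "T s = T s' \<longleftrightarrow> (\<forall>q x r. pops M s q x r = pops M s' q x r) \<and>
        (\<forall>q x. accs M s q x = accs M s' q x)"
      unfolding T_def prod.inject set_eq_iff by simp
    then show ?thesis using inj_on_eq_iff[OF f, of "T s" "T s'"] by simp
  qed
  have "f (T s) = f (T s') \<Longrightarrow> f (T (d # s)) = f (T (d # s'))" for d s s'
    unfolding eq
    using pops_mono[of M "d # s" _ _ _ d s s'] pops_mono[of M "d # s'" _ _ _ d s' s]
      accs_mono[of M "d # s" _ _ d s s'] accs_mono[of M "d # s'" _ _ d s' s] by blast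
  then show ?thesis
    using finite_imageI[OF fin, of f] eq by (intro exI[of _ "f \<circ> T"]) (auto simp: image_image)
qed

section \<open>Second-stage configurations of a special machine\<close>

context
  fixes M :: "('q, 'a, ('a, 's) stack_symbol) cspda"
  assumes special: "special_cspda M"
begin

lemma special_D: "is_cspda M" "P1 M" "P2 M" "P3 M" "P4 M" "P5 M" "P6 M" "P7 M"
  using special unfolding special_cspda_def by auto

lemma entry_configD:
  assumes "entry_config M (q, u, p)"
  shows "p = [Bot]" "u \<noteq> []" "hd u = Bot" "last u = Top" "reading_state M q" "q \<notin> accepting M"
proof -
  obtain r v l where r: "initialises M r v" "step M (r, v, []) l (q, u, p)"
    using assms unfolding entry_config_def by blast
  moreover have "v = u" using r(2) by cases auto
  moreover note special_D(4)[unfolded P3_def, THEN conjunct2, THEN conjunct2, THEN conjunct1, rule_format]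
  ultimately show "p = [Bot]" "u \<noteq> []" "hd u = Bot" "last u = Top" "reading_state M q"
    by metis+
  have "entry_state M q" using assms unfolding entry_state_def by blast
  then show "q \<notin> accepting M" using special_D(8) unfolding P7_def by simp
qed

lemma initialises_check_alph: "initialises M q u \<Longrightarrow> set u \<subseteq> check_alph M"
proof (induction rule: initialises.induct)
  case (push q u d q')
  then show ?case using special_D(1) unfolding is_cspda_def by auto
qed simp

lemma entry_config_check_alph: "entry_config M (q, u, p) \<Longrightarrow> set u \<subseteq> check_alph M"
  unfolding entry_config_def by (auto elim!: step.cases dest: initialises_check_alph)

lemma entry_config_push_alph:
  assumes "entry_config M (q, u, [Bot])" shows "Bot \<in> push_alph M" "q \<in> states M"
  using assms special_D(1,4) entry_configD(5)[OF assms]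
  unfolding P3_def reading_state_def by auto

text \<open>Adds to (P3) what follows from it along runs: the pushdown keeps \<open>Bot\<close> at
  its bottom, so it never empties, and it never outgrows the check stack.\<close>

definition stack_inv :: "('q, ('a, 's) stack_symbol) config \<Rightarrow> bool" where
  "stack_inv C \<longleftrightarrow> (\<exists>q u p. C = (q, u, p) \<and> q \<in> states M \<and> p \<noteq> [] \<and> last p = Bot \<and>
     length p \<le> length u \<and> set p \<subseteq> push_alph M \<and> set u \<subseteq> check_alph M \<and> hd u = Bot)"

lemma stack_inv_step:
  assumes "stack_inv C" "step M C l D"
  shows "stack_inv D"
proof -
  obtain q u p where C: "C = (q, u, p)" "q \<in> states M" "p \<noteq> []" "last p = Bot" "length p \<le> length u"
     "set p \<subseteq> push_alph M" "set u \<subseteq> check_alph M" "hd u = Bot"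
    using assms(1) unfolding stack_inv_def by blast
  have tr: "q' \<in> states M \<and> (\<forall>x. mv = Push x \<longrightarrow> x \<in> push_alph M)"
    if "(q, s, l, q', mv) \<in> trans M" for s q' mv
    using that special_D(1) unfolding is_cspda_def by fast
  from assms(2) show ?thesis unfolding C(1)
  proof cases
    case (push q' x)
    then show ?thesis using C tr unfolding stack_inv_def by auto
  next
    case (pop x p' q')
    then have "(q, Some (x, u ! length p'), l, q', Pop) \<in> trans M" by (simp add: seen_def)
    then have "x \<noteq> Bot" using special_D(4) unfolding P3_def by blast
    then show ?thesis using C pop tr unfolding stack_inv_def by (auto split: if_splits)
  next
    case (stay q')
    then show ?thesis using C tr unfolding stack_inv_def by auto
  qed
qed

lemma stack_inv_run: "run M C w D \<Longrightarrow> stack_inv C \<Longrightarrow> stack_inv D"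
  by (induction rule: run.induct) (blast dest: stack_inv_step)+

lemma second_stage_stack_inv:
  assumes "second_stage_config M C"
  shows "stack_inv C"
proof -
  obtain E w where E: "entry_config M E" "run M E w C"
    using assms unfolding second_stage_config_def by blast
  obtain q u p where e: "E = (q, u, p)" by (cases E)
  have "p = [Bot]" using entry_configD E(1) e by blast
  then have "stack_inv E"
    using entry_configD[of q u p] entry_config_check_alph[of q u p] entry_config_push_alph[of q u] E(1) e
    unfolding stack_inv_def by (auto simp: Suc_le_eq)
  then show ?thesis using stack_inv_run E(2) by blast
qed

lemma second_stage_configD:
  assumes "second_stage_config M (q, u, p)"
  shows "q \<in> states M" "p \<noteq> []" "last p = Bot" "length p \<le> length u" "set p \<subseteq> push_alph M"
    "set u \<subseteq> check_alph M" "hd u = Bot" "Bot \<notin> set (tl u)" "Top \<notin> set (butlast u)"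
    "Bot \<notin> set (butlast p)"
proof -
  show "q \<in> states M" "p \<noteq> []" "last p = Bot" "length p \<le> length u" "set p \<subseteq> push_alph M"
    "set u \<subseteq> check_alph M" "hd u = Bot"
    using second_stage_stack_inv[OF assms] unfolding stack_inv_def by auto
  note special_D(4)[unfolded P3_def, THEN conjunct2, THEN conjunct2, THEN conjunct2, THEN conjunct1, rule_format]
  from this[OF assms] show "Bot \<notin> set (tl u)" "Top \<notin> set (butlast u)" "Bot \<notin> set (butlast p)"
    by blast+
qed

lemma entry_second_stage: "entry_config M C \<Longrightarrow> second_stage_config M C"
  unfolding second_stage_config_def using run.refl by blast

lemma entry_reading: "entry_config M C \<Longrightarrow> reading_config M C"
  using entry_configD unfolding reading_config_def by (cases C) auto

text \<open>Works backwards along the run: the accepting end has a non-empty pushdown, and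
  \<open>acc_stack_step\<close> pulls the property back.\<close>

lemma run_acc_stack:
  assumes "run M C w D" "C = (q, u, p)" "second_stage_config M C" "fst D \<in> accepting M"
  shows "acc_stack M u q p"
  using assms
proof (induction arbitrary: q p rule: run.induct)
  case (refl C)
  obtain x p' where p: "p = x # p'" using second_stage_configD(2) refl by (cases p) auto
  have "length p' < length u" "x \<in> push_alph M"
    using second_stage_configD(4,5)[of q u p] refl p by auto
  then show ?case using refl p by (cases "drop (length p') u") (auto intro: accs.here)
next
  case (silent C D w E)
  obtain q' p' where D: "D = (q', u, p')" using silent.hyps(1) silent.prems(1) by cases auto
  moreover have "second_stage_config M D"
    using second_stage_run silent.prems(2) silent.hyps(1) by (meson run.intros)
  moreover obtain x r where p: "p = x # r"
    using second_stage_configD(2) silent.prems by (cases p) auto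
  moreover have "length r < length u" using second_stage_configD(4)[of q u p] silent.prems p by auto
  ultimately show ?case using acc_stack_step[of M q u x r None q' u p'] silent by auto
next
  case (read C a D w E)
  obtain q' p' where D: "D = (q', u, p')" using read.hyps(1) read.prems(1) by cases auto
  moreover have "second_stage_config M D"
    using second_stage_run read.prems(2) read.hyps(1) by (meson run.intros)
  moreover obtain x r where p: "p = x # r"
    using second_stage_configD(2) read.prems by (cases p) auto
  moreover have "length r < length u" using second_stage_configD(4)[of q u p] read.prems p by auto
  ultimately show ?case using acc_stack_step[of M q u x r "Some a" q' u p'] read by auto
qed

text \<open>The pushdown of an entry configuration is a single \<open>Bot\<close>, so the relevant
  suffix is the whole check stack and \<open>acc_stack\<close> collapses to
  \<open>accs\<close>.\<close>

lemma accs_Bot_iff: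
  assumes "entry_config M (q, u, [Bot])"
  shows "accs M u q Bot \<longleftrightarrow> (\<exists>w D. run M (q, u, [Bot]) w D \<and> fst D \<in> accepting M)"
  using accs_run[of M u q Bot u "[]" "[]"] run_acc_stack[of "(q, u, [Bot])" _ _ q u "[Bot]"]
    entry_second_stage[OF assms] by auto

text \<open>For \<open>w \<noteq> []\<close> the runs of length zero, which \<open>lang\<close>
  admits in the first stage, are excluded; by (P3) the first step is then silent and leads to an
  entry configuration before anything is read.\<close>

lemma lang_entry:
  assumes "w \<in> lang M" "w \<noteq> []"
  shows "\<exists>q u D. entry_config M (q, u, [Bot]) \<and> dels M (q, u, [Bot]) w = Some D \<and> fst D \<in> accepting M"
proof -
  obtain q u D where i: "initialises M q u" and r: "run M (q, u, []) w D" and a: "fst D \<in> accepting M"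
    using assms(1) unfolding lang_def by blast
  have e: "E = (fst E, u, [Bot]) \<and> l = None" if "step M (q, u, []) l E" for E l
  proof -
    have "fst (snd E) = u" using that by cases auto
    moreover have "l = None \<and> snd (snd E) = [Bot]"
      using that i special_D(4) unfolding P3_def by (metis prod.collapse)
    ultimately show ?thesis by (metis prod.collapse)
  qed
  from r obtain E where E: "step M (q, u, []) None E" "run M E w D"
  proof cases
    case (read a E v)
    then show ?thesis using e[OF read(2)] by simp
  qed (use assms(2) that in auto)
  then have "entry_config M E" using i unfolding entry_config_def by blast
  moreover have "reading_config M D" using a special_D(6) unfolding P5_def reading_config_def by blast
  ultimately have "dels M E w = Some D"
    using dels_eq_Some[OF special_D(2,3,1) entry_reading] E(2) unfolding after_def by blast
  then show ?thesis using e[OF E(1)] \<open>entry_config M E\<close> a by metis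
qed

lemma failing_iff:
  assumes "reading_config M C"
  shows "failing_config M C \<longleftrightarrow> (\<forall>w D. dels M C w = Some D \<longrightarrow> fst D \<notin> accepting M)"
  by (rule failing_config_iff[OF special_D(2,3,6,1) assms])

lemma P6_dels:
  assumes "entry_config M E" "u \<in> lists (in_alph M)" "v \<in> lists (in_alph M)" "v \<notin> lang M"
  obtains D where "dels M E (u @ v) = Some D" "dels M E u = Some D"
  | "dels M E (u @ v) = None"
  | x y D where "u @ v = x @ y" "dels M E x = Some D" "failing_config M D"
proof -
  note dd = dels_eq_Some[OF special_D(2,3,1) entry_reading[OF assms(1)]]
  have "(\<exists>D. after M E (u @ v) D \<and> after M E u D) \<or> fails M E (u @ v)"
    using special_D(7) assms unfolding P6_def by blast
  then show thesis
    using that dd fails_cases[OF special_D(2,3,6,1) entry_reading[OF assms(1)]] by metis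
qed

end

section \<open>Lists of frames\<close>

type_synonym ('q, 'd) block = "nat \<times> 'q \<times> 'd list"
type_synonym ('q, 'd) frame = "nat \<times> ('q, 'd) config"

fun ent :: "('q, ('a, 's) stack_symbol) block \<Rightarrow> ('q, ('a, 's) stack_symbol) config" where
  "ent (j, q, u) = (q, u, [Bot])"

definition first :: "('q, 'd) block list \<Rightarrow> nat \<Rightarrow> nat \<Rightarrow> nat option" where
  "first Bs k j = (if \<exists>i. k \<le> i \<and> i < length Bs \<and> fst (Bs ! i) = j
     then Some (LEAST i. k \<le> i \<and> i < length Bs \<and> fst (Bs ! i) = j) else None)"

lemma first_SomeD:
  assumes "first Bs k j = Some i"
  shows "k \<le> i" "i < length Bs" "fst (Bs ! i) = j" "\<And>l. k \<le> l \<Longrightarrow> l < i \<Longrightarrow> fst (Bs ! l) \<noteq> j"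
proof -
  let ?P = "\<lambda>i. k \<le> i \<and> i < length Bs \<and> fst (Bs ! i) = j"
  have ex: "\<exists>i. ?P i" and i: "i = (LEAST i. ?P i)"
    using assms unfolding first_def by (auto split: if_splits)
  have "?P i" unfolding i using ex by (rule LeastI_ex)
  then show "k \<le> i" "i < length Bs" "fst (Bs ! i) = j" by auto
  show "fst (Bs ! l) \<noteq> j" if "k \<le> l" "l < i" for l
    using not_less_Least[of l ?P] that \<open>i < length Bs\<close> unfolding i by auto
qed

lemma first_eqI:
  assumes "k \<le> i" "i < length Bs" "fst (Bs ! i) = j" "\<And>l. k \<le> l \<Longrightarrow> l < i \<Longrightarrow> fst (Bs ! l) \<noteq> j"
  shows "first Bs k j = Some i"
proof -
  let ?P = "\<lambda>i. k \<le> i \<and> i < length Bs \<and> fst (Bs ! i) = j"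
  have "(LEAST i. ?P i) = i"
    using assms by (intro Least_equality) (auto simp: not_less[symmetric])
  then show ?thesis unfolding first_def using assms(1-3) by auto
qed

lemma first_ex:
  assumes "k \<le> i" "i < length Bs" "fst (Bs ! i) = j"
  obtains i' where "first Bs k j = Some i'" "i' \<le> i"
proof -
  have "(LEAST i. k \<le> i \<and> i < length Bs \<and> fst (Bs ! i) = j) \<le> i"
    using assms by (intro Least_le) auto
  moreover have "first Bs k j = Some (LEAST i. k \<le> i \<and> i < length Bs \<and> fst (Bs ! i) = j)"
    using assms unfolding first_def by auto
  ultimately show thesis using that by blast
qed

text \<open>The lowest block still free: a new frame must use a block strictly above that of the top
  frame.\<close>

definition lvl :: "('q, 'd) frame list \<Rightarrow> nat" where
  "lvl fs = (case fs of [] \<Rightarrow> 0 | f # _ \<Rightarrow> Suc (fst f))"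

lemma lvl_simps [simp]: "lvl [] = 0" "lvl (f # fs) = Suc (fst f)"
  by (simp_all add: lvl_def)

text \<open>The block on which a letter of the factor \<open>j\<close> acts, its configuration, and the frames below.\<close>

definition focus :: "('q, ('a, 's) stack_symbol) block list \<Rightarrow>
    ('q, ('a, 's) stack_symbol) frame list \<Rightarrow> nat \<Rightarrow>
    (nat \<times> ('q, ('a, 's) stack_symbol) config \<times> ('q, ('a, 's) stack_symbol) frame list) option" where
  "focus Bs fs j = (if fs \<noteq> [] \<and> fst (Bs ! fst (hd fs)) = j then Some (fst (hd fs), snd (hd fs), tl fs)
     else map_option (\<lambda>i. (i, ent (Bs ! i), fs)) (first Bs (lvl fs) j))"

definition unfocus where
  "unfocus Bs i C fs = (if C = ent (Bs ! i) then fs else (i, C) # fs)"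

locale factor_machines =
  fixes J :: "nat set" and M :: "nat \<Rightarrow> ('q, 'a, ('a, 's) stack_symbol) cspda"
  assumes special: "\<And>j. j \<in> J \<Longrightarrow> special_cspda (M j)"
begin

definition good :: "('q, ('a, 's) stack_symbol) block \<Rightarrow> bool" where
  "good b \<longleftrightarrow> fst b \<in> J \<and> entry_config (M (fst b)) (ent b) \<and>
     (\<exists>w D. dels (M (fst b)) (ent b) w = Some D \<and> fst D \<in> accepting (M (fst b)))"

text \<open>The bound \<open>n\<close> serves completeness, where blocks are known to behave well on
  short words only.\<close>

definition reach where
  "reach n b C \<longleftrightarrow> (\<exists>x \<in> lists (in_alph (M (fst b))). length x \<le> n \<and> dels (M (fst b)) (ent b) x = Some C)"

definition nstep where
  "nstep Bs fs l = (case focus Bs fs (fst l) of None \<Rightarrow> None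
     | Some (i, C, fs0) \<Rightarrow> map_option (\<lambda>C'. unfocus Bs i C' fs0) (del (M (fst l)) C (snd l)))"

definition letters :: "(nat \<times> 'a) set" where
  "letters = (SIGMA j:J. in_alph (M j))"

end

section \<open>Frame lists over a fixed list of blocks\<close>

locale block_list = factor_machines J M
  for J :: "nat set" and M :: "nat \<Rightarrow> ('q, 'a, ('a, 's) stack_symbol) cspda" +
  fixes Bs :: "('q, ('a, 's) stack_symbol) block list"
  assumes good: "\<And>b. b \<in> set Bs \<Longrightarrow> good b"
begin

text \<open>The frame \<open>(i, C)\<close> may lie directly above the frames \<open>fs\<close>, or be in its entry configuration.\<close>

definition seat :: "nat \<Rightarrow> nat \<Rightarrow> ('q, ('a, 's) stack_symbol) config \<Rightarrow> ('q, ('a, 's) stack_symbol) frame list \<Rightarrow> bool" where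
  "seat n i C fs \<longleftrightarrow> first Bs (lvl fs) (fst (Bs ! i)) = Some i \<and>
     (fs \<noteq> [] \<longrightarrow> fst (Bs ! fst (hd fs)) \<noteq> fst (Bs ! i)) \<and> reach n (Bs ! i) C"

fun valid :: "nat \<Rightarrow> ('q, ('a, 's) stack_symbol) frame list \<Rightarrow> bool" where
  "valid n [] \<longleftrightarrow> True"
| "valid n ((i, C) # fs) \<longleftrightarrow> valid n fs \<and> seat n i C fs \<and> C \<noteq> ent (Bs ! i)"

lemma reach_mono: "reach n b C \<Longrightarrow> n \<le> n' \<Longrightarrow> reach n' b C"
  unfolding reach_def by (meson order_trans)

lemma valid_mono: "valid n fs \<Longrightarrow> n \<le> n' \<Longrightarrow> valid n' fs"
  by (induction n fs rule: valid.induct) (auto simp: seat_def dest: reach_mono)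

lemma good_nth: "i < length Bs \<Longrightarrow> good (Bs ! i)"
  using good by simp

lemma reading_ent: "good b \<Longrightarrow> reading_config (M (fst b)) (ent b)"
  unfolding good_def using entry_reading special by blast

lemma reading_reach:
  assumes "good b" "reach n b C"
  shows "reading_config (M (fst b)) C"
  using dels_reading[OF special_D(3)[OF special] reading_ent[OF assms(1)]] assms
  unfolding good_def reach_def by blast

lemma focus_SomeD:
  assumes "valid n fs" "focus Bs fs j = Some (i, C, fs0)"
  shows "i < length Bs" "fst (Bs ! i) = j" "valid n fs0" "seat n i C fs0" "unfocus Bs i C fs0 = fs"
proof -
  have "i < length Bs \<and> fst (Bs ! i) = j \<and> valid n fs0 \<and> seat n i C fs0 \<and> unfocus Bs i C fs0 = fs"
  proof (cases "fs \<noteq> [] \<and> fst (Bs ! fst (hd fs)) = j")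
    case True
    then have "fs = (i, C) # fs0" using assms(2) unfolding focus_def by (cases fs) auto
    then show ?thesis using assms(1) True first_SomeD(2)[of Bs "lvl fs0" j i]
      unfolding unfocus_def by (auto simp: seat_def)
  next
    case False
    then have "fs0 = fs" "C = ent (Bs ! i)" "first Bs (lvl fs) j = Some i"
      using assms(2) unfolding focus_def by auto
    moreover have "reach n (Bs ! i) (ent (Bs ! i))"
      unfolding reach_def by (rule bexI[of _ "[]"]) auto
    ultimately show ?thesis using assms(1) False first_SomeD[of Bs "lvl fs" j i]
      unfolding unfocus_def seat_def by auto
  qed
  then show "i < length Bs" "fst (Bs ! i) = j" "valid n fs0" "seat n i C fs0" "unfocus Bs i C fs0 = fs"
    by auto
qed

text \<open>Holds also when the frame has been dropped: a seat is the first free block of its factor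
  and the frame below belongs to another factor, so the next letter of this factor starts the same
  block again.\<close>

lemma focus_unfocus:
  assumes "seat n i C fs0"
  shows "focus Bs (unfocus Bs i C fs0) (fst (Bs ! i)) = Some (i, C, fs0)"
  using assms unfolding focus_def unfocus_def seat_def by auto

lemma valid_unfocus: "valid n fs0 \<Longrightarrow> seat n i C fs0 \<Longrightarrow> valid n (unfocus Bs i C fs0)"
  unfolding unfocus_def by auto

lemma seat_dels:
  assumes "seat n i C fs0" "v \<in> lists (in_alph (M (fst (Bs ! i))))"
    "dels (M (fst (Bs ! i))) C v = Some C'"
  shows "seat (n + length v) i C' fs0"
proof -
  obtain x where "x \<in> lists (in_alph (M (fst (Bs ! i))))" "length x \<le> n"
    "dels (M (fst (Bs ! i))) (ent (Bs ! i)) x = Some C"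
    using assms(1) unfolding seat_def reach_def by blast
  then have "reach (n + length v) (Bs ! i) C'"
    using assms(2,3) unfolding reach_def by (intro bexI[of _ "x @ v"]) (auto simp: iter_append)
  then show ?thesis using assms(1) unfolding seat_def by blast
qed

text \<open>A word over one factor stays on one block throughout, even when it passes through the
  entry configuration and the frame disappears for a while.\<close>

lemma iter_unfocus:
  assumes "seat n i C fs0" "v \<in> lists (in_alph (M (fst (Bs ! i))))"
  shows "iter (nstep Bs) (unfocus Bs i C fs0) (map (Pair (fst (Bs ! i))) v) =
    map_option (\<lambda>C'. unfocus Bs i C' fs0) (dels (M (fst (Bs ! i))) C v)"
  using assms
proof (induction v arbitrary: n C)
  case (Cons a v)
  show ?case
  proof (cases "del (M (fst (Bs ! i))) C a")
    case None
    then show ?thesis using focus_unfocus[OF Cons.prems(1)] by (simp add: nstep_def)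
  next
    case (Some C')
    then have "seat (n + length [a]) i C' fs0"
      using Cons.prems by (intro seat_dels[of n i C]) auto
    then show ?thesis using Some Cons.IH[of _ C'] Cons.prems(2) focus_unfocus[OF Cons.prems(1)]
      by (simp add: nstep_def)
  qed
qed simp

lemma iter_nstep_single:
  assumes "valid n fs" "focus Bs fs j = Some (i, C, fs0)" "v \<in> lists (in_alph (M j))"
  shows "iter (nstep Bs) fs (map (Pair j) v) = map_option (\<lambda>C'. unfocus Bs i C' fs0) (dels (M j) C v)"
  using iter_unfocus[of n i C fs0 v] focus_SomeD[OF assms(1,2)] assms(3) by auto

lemma valid_nstep:
  assumes "valid n fs" "l \<in> letters" "nstep Bs fs l = Some fs'"
  shows "valid (Suc n) fs'"
proof -
  obtain i C fs0 C' where f: "focus Bs fs (fst l) = Some (i, C, fs0)"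
    and C': "del (M (fst l)) C (snd l) = Some C'" "fs' = unfocus Bs i C' fs0"
    using assms(3) unfolding nstep_def by (auto split: option.splits)
  note F = focus_SomeD[OF assms(1) f]
  have "seat (n + length [snd l]) i C' fs0"
    using F(2,4) C'(1) assms(2) by (intro seat_dels[of n i C]) (auto simp: letters_def)
  then show ?thesis using valid_unfocus valid_mono[OF F(3)] C'(2) by simp
qed

lemma valid_iter:
  assumes "valid n fs" "w \<in> lists letters" "iter (nstep Bs) fs w = Some fs'"
  shows "valid (n + length w) fs'"
  using assms
proof (induction w arbitrary: n fs)
  case (Cons l w)
  then obtain fs1 where "nstep Bs fs l = Some fs1" "iter (nstep Bs) fs1 w = Some fs'"
    by (auto split: bind_splits)
  then show ?case using Cons.IH[of "Suc n" fs1] valid_nstep[OF Cons.prems(1), of l fs1] Cons.prems(2) by simp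
qed simp

definition accepts :: "('q, ('a, 's) stack_symbol) frame list \<Rightarrow> bool" where
  "accepts fs \<longleftrightarrow> fs \<noteq> [] \<and> (\<forall>f \<in> set fs. fst (snd f) \<in> accepting (M (fst (Bs ! fst f))))"

definition dead :: "('q, ('a, 's) stack_symbol) frame list \<Rightarrow> bool" where
  "dead fs \<longleftrightarrow> (\<exists>f \<in> set fs. failing_config (M (fst (Bs ! fst f))) (snd f))"

lemma dead_not_accepts: "dead fs \<Longrightarrow> \<not> accepts fs"
  unfolding dead_def accepts_def failing_config_def by blast

lemma dead_unfocus:
  "dead (unfocus Bs i C fs) \<longleftrightarrow> dead fs \<or> (failing_config (M (fst (Bs ! i))) C \<and> C \<noteq> ent (Bs ! i))"
  unfolding unfocus_def dead_def by auto

lemma failing_dels: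
  assumes "j \<in> J" "failing_config (M j) C" "dels (M j) C v = Some D"
  shows "failing_config (M j) D"
proof -
  have "reading_config (M j) C" using assms(2) unfolding failing_config_def by simp
  moreover from this have "reading_config (M j) D"
    using dels_reading[OF special_D(3)[OF special]] assms by blast
  ultimately show ?thesis
    using assms failing_iff[OF special[OF assms(1)]] iter_append[of "del (M j)" C v]
    by (metis bind.bind_lunit)
qed

lemma ent_not_failing:
  assumes "good b" shows "\<not> failing_config (M (fst b)) (ent b)"
  using assms failing_iff[OF special reading_ent[OF assms]] unfolding good_def by blast

lemma valid_nth: "valid n fs \<Longrightarrow> (i, C) \<in> set fs \<Longrightarrow> i < length Bs \<and> reach n (Bs ! i) C"
  by (induction fs) (auto simp: seat_def dest: first_SomeD)

lemma dead_nstep: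
  assumes "valid n fs" "dead fs" "nstep Bs fs l = Some fs'"
  shows "dead fs'"
proof -
  obtain i C fs0 C' where f: "focus Bs fs (fst l) = Some (i, C, fs0)"
    and C': "del (M (fst l)) C (snd l) = Some C'" "fs' = unfocus Bs i C' fs0"
    using assms(3) unfolding nstep_def by (auto split: option.splits)
  note F = focus_SomeD[OF assms(1) f]
  have "failing_config (M (fst l)) C \<Longrightarrow> failing_config (M (fst l)) C' \<and> C' \<noteq> ent (Bs ! i)"
    using failing_dels[of "fst l" C "[snd l]" C'] C'(1) good_nth[OF F(1)] F(2) ent_not_failing[of "Bs ! i"]
    by (auto simp: good_def)
  then show ?thesis using assms(2) F(2,5) C'(2) dead_unfocus by metis
qed

lemma dead_iter:
  assumes "valid n fs" "dead fs" "w \<in> lists letters" "iter (nstep Bs) fs w = Some fs'"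
  shows "dead fs'"
  using assms
proof (induction w arbitrary: n fs)
  case (Cons l w)
  then obtain fs1 where "nstep Bs fs l = Some fs1" "iter (nstep Bs) fs1 w = Some fs'"
    by (auto split: bind_splits)
  then show ?case
    using Cons.IH[of "Suc n" fs1] valid_nstep[OF Cons.prems(1), of l fs1]
      dead_nstep[OF Cons.prems(1,2), of l fs1] Cons.prems(3)
    by simp
qed simp

text \<open>Mirrors \<open>fails\<close> for frame lists: an undefined result replaces getting
  stuck, and a dead list replaces a failing configuration.\<close>

definition bad :: "('q, ('a, 's) stack_symbol) frame list \<Rightarrow> (nat \<times> 'a) list \<Rightarrow> bool" where
  "bad fs w \<longleftrightarrow> iter (nstep Bs) fs w = None \<or>
     (\<exists>x y fs'. w = x @ y \<and> iter (nstep Bs) fs x = Some fs' \<and> dead fs')"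

lemma bad_not_accepts:
  assumes "valid n fs" "w \<in> lists letters" "bad fs w" "iter (nstep Bs) fs w = Some fs'"
  shows "\<not> accepts fs'"
proof -
  obtain x y fs1 where "w = x @ y" "iter (nstep Bs) fs x = Some fs1" "dead fs1"
    using assms(3,4) unfolding bad_def by auto
  then show ?thesis
    using dead_iter[of "n + length x" fs1 y fs'] valid_iter[OF assms(1), of x fs1] assms(2,4) dead_not_accepts
    by (auto simp: iter_append)
qed

lemma bad_append1: "bad fs x \<Longrightarrow> bad fs (x @ y)"
  unfolding bad_def by (auto simp: iter_append) (metis append.assoc)

lemma bad_append2: "iter (nstep Bs) fs x = Some fs1 \<Longrightarrow> bad fs1 y \<Longrightarrow> bad fs (x @ y)"
  unfolding bad_def by (auto simp: iter_append) (metis append.assoc bind.bind_lunit iter_append)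

lemma bad_append:
  assumes "bad fs (x @ y)" "iter (nstep Bs) fs x = Some fs1"
  shows "bad fs x \<or> bad fs1 y"
proof (cases "iter (nstep Bs) fs (x @ y) = None")
  case True
  then show ?thesis using assms(2) by (simp add: bad_def iter_append)
next
  case False
  then obtain v w fs' where vw: "x @ y = v @ w" "iter (nstep Bs) fs v = Some fs'" "dead fs'"
    using assms(1) unfolding bad_def by auto
  from vw(1) obtain z where "x = v @ z \<and> z @ y = w \<or> x @ z = v \<and> y = z @ w"
    unfolding append_eq_append_conv2 by blast
  then show ?thesis
  proof
    assume "x @ z = v \<and> y = z @ w"
    moreover from this have "iter (nstep Bs) fs1 z = Some fs'"
      using vw(2) assms(2) by (auto simp: iter_append)
    ultimately show ?thesis using vw(3) unfolding bad_def by blast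
  qed (use vw in \<open>auto simp: bad_def\<close>)
qed

text \<open>This is where the condition (P6) of the factors is used.\<close>

lemma trivial_factor_word:
  assumes "valid n fs" "j \<in> J" "v \<in> lists (in_alph (M j))" "v \<notin> lang (M j)"
  shows "iter (nstep Bs) fs (map (Pair j) v) = Some fs \<or> bad fs (map (Pair j) v)"
proof (cases "focus Bs fs j")
  case None
  then show ?thesis by (cases v) (auto simp: bad_def nstep_def)
next
  case (Some f)
  obtain i C fs0 where f: "focus Bs fs j = Some (i, C, fs0)" using Some by (cases f) auto
  note F = focus_SomeD[OF assms(1) f]
  note G = iter_nstep_single[OF assms(1) f]
  let ?E = "ent (Bs ! i)"
  have E: "entry_config (M j) ?E" "\<not> failing_config (M j) ?E"
    using good_nth[OF F(1)] ent_not_failing[OF good_nth[OF F(1)]] F(2) unfolding good_def by auto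
  \<comment> \<open>(P6) speaks about entry configurations only, so the frame is traced back to the
    entry configuration of its block, and (P6) is applied to \<open>x @ v\<close>.\<close>
  obtain x where x: "x \<in> lists (in_alph (M j))" "dels (M j) ?E x = Some C"
    using F(2,4) unfolding seat_def reach_def by auto
  show ?thesis
  proof (rule P6_dels[OF special[OF assms(2)] E(1) x(1) assms(3,4)])
    fix D assume "dels (M j) ?E (x @ v) = Some D" "dels (M j) ?E x = Some D"
    then show ?thesis using x(2) G[OF assms(3)] F(5) by (simp add: iter_append)
  next
    assume "dels (M j) ?E (x @ v) = None"
    then show ?thesis using x(2) G[OF assms(3)] by (simp add: iter_append bad_def)
  next
    fix y z D assume yz: "x @ v = y @ z" and D: "dels (M j) ?E y = Some D" "failing_config (M j) D"
    from yz obtain t where "x = y @ t \<and> t @ v = z \<or> x @ t = y \<and> v = t @ z"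
      unfolding append_eq_append_conv2 by blast
    then show ?thesis
    proof
      \<comment> \<open>The failure lies in the past: the present frame is failing, so the list is
        dead before \<open>v\<close> is read.\<close>
      assume "x = y @ t \<and> t @ v = z"
      then have "failing_config (M j) C"
        using failing_dels[OF assms(2) D(2), of t C] x(2) D(1) by (simp add: iter_append)
      then have "dead fs" using E(2) F(2,5) dead_unfocus[of i C fs0] by auto
      then have "bad fs []" unfolding bad_def by auto
      then show ?thesis using bad_append1 by fastforce
    next
      assume t: "x @ t = y \<and> v = t @ z"
      then have "dels (M j) C t = Some D" using x(2) D(1) by (auto simp: iter_append)
      then have "iter (nstep Bs) fs (map (Pair j) t) = Some (unfocus Bs i D fs0)"
        using G[of t] t assms(3) by simp
      moreover have "dead (unfocus Bs i D fs0)" using D(2) E(2) F(2) dead_unfocus by auto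
      ultimately have "bad fs (map (Pair j) t)" unfolding bad_def by (metis append.right_neutral)
      then show ?thesis using t bad_append1 by auto
    qed
  qed
qed

end

section \<open>Deleting words that are trivial in a factor\<close>

context factor_machines
begin

text \<open>As \<open>lang (M j)\<close> will be a co-word problem, the deleted words are those that
  represent the identity of the factor \<open>j\<close>.\<close>

inductive reduces :: "(nat \<times> 'a) list \<Rightarrow> (nat \<times> 'a) list \<Rightarrow> bool" where
  refl: "reduces w w"
| delete: "j \<in> J \<Longrightarrow> t \<in> lists (in_alph (M j)) \<Longrightarrow> t \<notin> lang (M j) \<Longrightarrow> reduces (x @ y) w \<Longrightarrow>
    reduces (x @ map (Pair j) t @ y) w"

end

context block_list
begin

text \<open>If the deleted word fixes the frames present when it is read, badness of the shorter
  word carries over to the longer one; otherwise the longer word is bad itself.\<close>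

lemma iter_reduces:
  assumes "reduces w w'" "valid n fs" "w \<in> lists letters"
  shows "bad fs w \<or> (iter (nstep Bs) fs w = iter (nstep Bs) fs w' \<and> \<not> bad fs w')"
  using assms
proof (induction arbitrary: n rule: reduces.induct)
  case (delete j t x y w)
  have IH: "bad fs (x @ y) \<or> (iter (nstep Bs) fs (x @ y) = iter (nstep Bs) fs w \<and> \<not> bad fs w)"
    using delete.IH delete.prems by auto
  show ?case
  proof (cases "iter (nstep Bs) fs x")
    case None
    then show ?thesis using bad_append1[of fs x] by (auto simp: bad_def)
  next
    case (Some fs1)
    then have "valid (n + length x) fs1" using valid_iter[OF delete.prems(1)] delete.prems(2) by auto
    from trivial_factor_word[OF this delete.hyps(1-3)] show ?thesis
    proof
      assume t: "iter (nstep Bs) fs1 (map (Pair j) t) = Some fs1"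
      then have eq: "iter (nstep Bs) fs (x @ map (Pair j) t) = Some fs1"
        using Some by (simp add: iter_append)
      from IH show ?thesis
      proof
        assume "bad fs (x @ y)"
        then have "bad fs x \<or> bad fs1 y" using bad_append Some by blast
        then show ?thesis using bad_append1[of fs x] bad_append2[OF eq, of y] by auto
      next
        assume "iter (nstep Bs) fs (x @ y) = iter (nstep Bs) fs w \<and> \<not> bad fs w"
        then show ?thesis using Some t by (simp add: iter_append)
      qed
    next
      assume "bad fs1 (map (Pair j) t)"
      then show ?thesis using bad_append2[OF Some] bad_append1[of fs "x @ map (Pair j) t" y] by simp
    qed
  qed
qed auto

text \<open>This is (P6) for frame lists; \<open>P6_N\<close> transfers it to the product
  machine.\<close>

lemma iter_trivial_word:
  assumes "reduces v []" "u \<in> lists letters" "v \<in> lists letters"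
  shows "bad [] (u @ v) \<or> (iter (nstep Bs) [] (u @ v) \<noteq> None \<and> iter (nstep Bs) [] (u @ v) = iter (nstep Bs) [] u)"
proof (cases "iter (nstep Bs) [] u")
  case None
  then show ?thesis using bad_append1[of "[]" u] by (auto simp: bad_def)
next
  case (Some fs)
  then have "valid (length u) fs" using valid_iter[of 0 "[]" u fs] assms(2) by simp
  from iter_reduces[OF assms(1) this assms(3)] show ?thesis
    using Some bad_append2[OF Some] by (auto simp: iter_append)
qed

lemma not_accepts_trivial_word:
  assumes "reduces w []" "w \<in> lists letters" "iter (nstep Bs) [] w = Some fs"
  shows "\<not> accepts fs"
  using iter_reduces[OF assms(1), of 0 "[]"] assms(2,3) bad_not_accepts[of 0 "[]" w fs]
  by (auto simp: accepts_def)

end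

section \<open>Blocks that behave well on all short words\<close>

locale factor_groups = factor_machines J M
  for J :: "nat set" and M :: "nat \<Rightarrow> ('q, 'a, ('a, 's) stack_symbol) cspda" +
  assumes finite_J: "finite J"
    and Nil_lang: "\<And>j. j \<in> J \<Longrightarrow> [] \<notin> lang (M j)"
    and nontrivial: "\<And>j. j \<in> J \<Longrightarrow> lang (M j) \<noteq> {}"
    and inverse: "\<And>j x. j \<in> J \<Longrightarrow> x \<in> lists (in_alph (M j)) \<Longrightarrow>
      \<exists>y \<in> lists (in_alph (M j)). x @ y \<notin> lang (M j)"
    and lang_trivial: "\<And>j t z. j \<in> J \<Longrightarrow> t \<in> lists (in_alph (M j)) \<Longrightarrow> t \<notin> lang (M j) \<Longrightarrow>
      z \<in> lang (M j) \<Longrightarrow> t @ z \<in> lang (M j)"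
begin

text \<open>Each \<open>x\<close> in \<open>X\<close> puts a trivial word \<open>x @ y\<close> in
  front of the word found so far. Acceptance at the end makes every prefix non-failing,
  \<open>x\<close> in particular, and so excludes the failing alternatives of (P6).\<close>

lemma ex_robust_block_list:
  assumes "j \<in> J" "set X \<subseteq> lists (in_alph (M j))" "z \<in> lang (M j)"
  shows "\<exists>w \<in> lang (M j). \<forall>E D. entry_config (M j) E \<and> dels (M j) E w = Some D \<and> fst D \<in> accepting (M j) \<longrightarrow>
    dels (M j) E z = Some D \<and>
    (\<forall>x \<in> set X. \<exists>C. dels (M j) E x = Some C \<and> \<not> failing_config (M j) C)"
  using assms(2)
proof (induction X)
  case Nil
  then show ?case using assms(3) by auto
next
  case (Cons x X)
  note sp = special[OF assms(1)]
  from Cons obtain w where w: "w \<in> lang (M j)"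
    "\<And>E D. entry_config (M j) E \<Longrightarrow> dels (M j) E w = Some D \<Longrightarrow> fst D \<in> accepting (M j) \<Longrightarrow>
    dels (M j) E z = Some D \<and>
    (\<forall>x \<in> set X. \<exists>C. dels (M j) E x = Some C \<and> \<not> failing_config (M j) C)" by force
  have x: "x \<in> lists (in_alph (M j))" using Cons.prems by simp
  then obtain y where y: "y \<in> lists (in_alph (M j))" "x @ y \<notin> lang (M j)"
    using inverse[OF assms(1)] by blast
  then have xy: "x @ y \<in> lists (in_alph (M j))" using x by simp
  have "(x @ y) @ w \<in> lang (M j)" using lang_trivial[OF assms(1) xy y(2) w(1)] .
  moreover have "dels (M j) E z = Some D \<and>
    (\<forall>x \<in> set (x # X). \<exists>C. dels (M j) E x = Some C \<and> \<not> failing_config (M j) C)"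
    if E: "entry_config (M j) E" and d: "dels (M j) E ((x @ y) @ w) = Some D" and a: "fst D \<in> accepting (M j)"
    for E D
  proof -
    have nf: "\<exists>C. dels (M j) E p = Some C \<and> \<not> failing_config (M j) C"
      if "(x @ y) @ w = p @ p'" for p p'
    proof -
      have "dels (M j) E (p @ p') = Some D" using d that by metis
      then obtain C where C: "dels (M j) E p = Some C" "dels (M j) C p' = Some D"
        by (auto simp: iter_append[of _ _ p] split: bind_splits)
      moreover have "reading_config (M j) C"
        using dels_reading[OF special_D(3)[OF sp] entry_reading[OF sp E] C(1)] .
      ultimately show ?thesis using failing_iff[OF sp] a by blast
    qed
    \<comment> \<open>(P6) is used with the empty word as its first argument: \<open>x @ y\<close>
      must act on \<open>E\<close> as the empty word does.\<close>
    have "dels (M j) E (x @ y) = Some E"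
    proof (rule P6_dels[OF sp E _ xy y(2), of "[]"])
      fix p p' C assume p: "[] @ x @ y = p @ p'" "dels (M j) E p = Some C" "failing_config (M j) C"
      then have "(x @ y) @ w = p @ p' @ w" by simp
      from nf[OF this] show ?thesis using p by simp
    next
      assume "dels (M j) E ([] @ x @ y) = None"
      then show ?thesis using d by (simp add: iter_append[of _ _ "x @ y" w] del: append_assoc)
    qed simp_all
    then have "dels (M j) E w = Some D" using d by (simp add: iter_append[of _ _ "x @ y" w] del: append_assoc)
    then show ?thesis using w(2)[OF E _ a] nf[of x "y @ w"] by simp
  qed
  ultimately show ?case by blast
qed

definition robust :: "nat \<Rightarrow> ('q, ('a, 's) stack_symbol) block \<Rightarrow> bool" where
  "robust n b \<longleftrightarrow> good b \<and> (\<forall>x \<in> lists (in_alph (M (fst b))). length x \<le> n \<longrightarrow>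
     (\<exists>C. dels (M (fst b)) (ent b) x = Some C \<and> \<not> failing_config (M (fst b)) C))"

lemma ex_robust_block:
  assumes "j \<in> J" "z \<in> lang (M j)"
  shows "\<exists>b. robust n b \<and> fst b = j \<and>
    (\<exists>D. dels (M j) (ent b) z = Some D \<and> fst D \<in> accepting (M j))"
proof -
  note sp = special[OF assms(1)]
  have "finite (in_alph (M j))" using special_D(1)[OF sp] unfolding is_cspda_def by blast
  from finite_list[OF finite_lists_length_le[OF this, of n]] obtain X where X: "set X = {x. set x \<subseteq> in_alph (M j) \<and> length x \<le> n}"
    using finite_list by blast
  have "set X \<subseteq> lists (in_alph (M j))" unfolding X lists_eq_set by blast
  from ex_robust_block_list[OF assms(1) this assms(2)] obtain w where w: "w \<in> lang (M j)"
    "\<And>E D. entry_config (M j) E \<Longrightarrow> dels (M j) E w = Some D \<Longrightarrow> fst D \<in> accepting (M j) \<Longrightarrow>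
    dels (M j) E z = Some D \<and>
    (\<forall>x \<in> set X. \<exists>C. dels (M j) E x = Some C \<and> \<not> failing_config (M j) C)" by force
  moreover from w(1) have "w \<noteq> []" using Nil_lang[OF assms(1)] by blast
  ultimately obtain q u D where E: "entry_config (M j) (q, u, [Bot])"
    "dels (M j) (q, u, [Bot]) w = Some D" "fst D \<in> accepting (M j)"
    using lang_entry[OF sp] by blast
  note * = w(2)[OF E]
  have "good (j, q, u)" unfolding good_def using assms(1) E by (metis ent.simps fst_conv)
  moreover have "\<exists>C. dels (M j) (q, u, [Bot]) x = Some C \<and> \<not> failing_config (M j) C"
    if "x \<in> lists (in_alph (M j))" "length x \<le> n" for x
  proof -
    have "x \<in> set X" using X that by auto
    then show ?thesis using * by blast
  qed
  ultimately have "robust n (j, q, u)" unfolding robust_def by simp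
  then show ?thesis using * E(3) by (intro exI[of _ "(j, q, u)"]) simp
qed

text \<open>Below, \<open>B @ concat (replicate n R)\<close> provides enough blocks for every word of length \<open>n\<close>.\<close>

lemma robust_iter:
  fixes B R :: "('q, ('a, 's) stack_symbol) block list"
  assumes Bs: "Bs = B @ concat (replicate n R)" "\<And>b. b \<in> set Bs \<Longrightarrow> robust n b"
    and R: "\<And>j. j \<in> J \<Longrightarrow> \<exists>b \<in> set R. fst b = j"
    and "w \<in> lists letters" "length w \<le> n"
  shows "\<exists>fs. iter (nstep Bs) [] w = Some fs \<and> lvl fs \<le> length B + length w * length R"
  using assms(4,5)
proof (induction w rule: rev_induct)
  case (snoc l w)
  interpret block_list J M Bs by unfold_locales (use Bs(2) robust_def in blast)
  obtain fs where fs: "iter (nstep Bs) [] w = Some fs" "lvl fs \<le> length B + length w * length R"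
    using snoc by auto
  have v: "valid (length w) fs" using valid_iter[of 0 "[]" w fs] fs(1) snoc.prems by simp
  have l: "fst l \<in> J" "snd l \<in> in_alph (M (fst l))" using snoc.prems(1) unfolding letters_def by auto
  obtain r where r: "r < length R" "fst (R ! r) = fst l" using R[OF l(1)] by (auto simp: in_set_conv_nth)
  \<comment> \<open>Position, counted from the end of \<open>B\<close>, of the block for
    \<open>l\<close> in copy number \<open>length w\<close> of \<open>R\<close>. By the induction
    hypothesis this copy lies entirely at or above \<open>lvl fs\<close>, so each letter can use up
    at most one copy.\<close>
  let ?k = "length w * length R + r"
  have split: "replicate n R = replicate (length w) R @ R # replicate (n - Suc (length w)) R"
    using snoc.prems(2) by (simp flip: replicate_add replicate_Suc)
  then have Bs': "Bs = (B @ concat (replicate (length w) R)) @ R @ concat (replicate (n - Suc (length w)) R)"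
    using Bs(1) by simp
  have len: "length (concat (replicate k R)) = k * length R" for k
    by (induction k) auto
  have nth: "length B + ?k < length Bs" "Bs ! (length B + ?k) = R ! r"
    using r(1) unfolding Bs' by (simp_all add: nth_append len)
  have "\<exists>i C fs0. focus Bs fs (fst l) = Some (i, C, fs0) \<and> i \<le> length B + ?k"
  proof (cases "fs \<noteq> [] \<and> fst (Bs ! fst (hd fs)) = fst l")
    case True
    then show ?thesis using fs(2) by (cases fs) (auto simp: focus_def)
  next
    case False
    obtain i where "first Bs (lvl fs) (fst l) = Some i" "i \<le> length B + ?k"
      using first_ex[of "lvl fs" "length B + ?k" Bs "fst l"] fs(2) nth r(2) by auto
    moreover from this have "focus Bs fs (fst l) = Some (i, ent (Bs ! i), fs)"
      using False by (auto simp: focus_def)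
    ultimately show ?thesis by blast
  qed
  then obtain i C fs0 where f: "focus Bs fs (fst l) = Some (i, C, fs0)" "i \<le> length B + ?k" by blast
  note F = focus_SomeD[OF v f(1)]
  obtain x where x: "x \<in> lists (in_alph (M (fst l)))" "length x \<le> length w"
     "dels (M (fst l)) (ent (Bs ! i)) x = Some C"
    using F(2,4) unfolding seat_def reach_def by auto
  have "robust n (Bs ! i)" using Bs(2) F(1) by simp
  then have "\<forall>x \<in> lists (in_alph (M (fst l))). length x \<le> n \<longrightarrow>
      (\<exists>C. dels (M (fst l)) (ent (Bs ! i)) x = Some C)"
    using F(2) unfolding robust_def by auto
  moreover have "x @ [snd l] \<in> lists (in_alph (M (fst l)))" "length (x @ [snd l]) \<le> n"
    using x l snoc.prems(2) by auto
  ultimately obtain C' where "dels (M (fst l)) (ent (Bs ! i)) (x @ [snd l]) = Some C'"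
    by blast
  then have C': "del (M (fst l)) C (snd l) = Some C'" using x(3) by (auto simp: iter_append split: bind_splits)
  have "lvl (unfocus Bs i C' fs0) \<le> Suc i"
    using F(4) first_SomeD(1)[of Bs "lvl fs0" "fst (Bs ! i)" i] unfolding unfocus_def seat_def by auto
  moreover have "Suc i \<le> length B + length (w @ [l]) * length R" using f(2) r(1) by simp
  moreover have "nstep Bs fs l = Some (unfocus Bs i C' fs0)" using f(1) C' by (simp add: nstep_def)
  then have "iter (nstep Bs) [] (w @ [l]) = Some (unfocus Bs i C' fs0)" using fs(1) by (simp add: iter_append)
  ultimately show ?case by (metis order_trans)
qed simp

text \<open>No frame has consumed more than \<open>length w\<close> letters, so robustness applies
  to all frames at every prefix.\<close>

lemma robust_not_bad:
  fixes B R :: "('q, ('a, 's) stack_symbol) block list"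
  assumes Bs: "Bs = B @ concat (replicate n R)" "\<And>b. b \<in> set Bs \<Longrightarrow> robust n b"
    and R: "\<And>j. j \<in> J \<Longrightarrow> \<exists>b \<in> set R. fst b = j"
    and "w \<in> lists letters" "length w \<le> n"
  shows "\<not> block_list.bad M Bs [] w"
proof -
  interpret block_list J M Bs by unfold_locales (use Bs(2) robust_def in blast)
  have "\<not> dead fs" if "w = x @ y" "iter (nstep Bs) [] x = Some fs" for x y fs
  proof
    assume "dead fs"
    then obtain i C where iC: "(i, C) \<in> set fs" "failing_config (M (fst (Bs ! i))) C"
      unfolding dead_def by auto
    have "valid (length x) fs" using valid_iter[of 0 "[]" x fs] that assms(4) by simp
    then have i: "i < length Bs" "reach (length x) (Bs ! i) C" using valid_nth iC(1) by auto
    then have "reach n (Bs ! i) C" using reach_mono that(1) assms(5) by auto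
    moreover have "robust n (Bs ! i)" using Bs(2) i(1) by simp
    ultimately show False using iC(2) unfolding robust_def reach_def
      by (metis option.inject)
  qed
  then show ?thesis using robust_iter[OF assms] unfolding bad_def by auto
qed

text \<open>Neighbouring syllables belong to different factors, so each opens a new frame. The block
  in the position of a syllable has its factor and is the lowest free one, hence is the block
  chosen. The last conjunct tells the induction which block is free next.\<close>

lemma iter_normal_form:
  fixes Bs :: "('q, ('a, 's) stack_symbol) block list"
  assumes "\<And>b. b \<in> set Bs \<Longrightarrow> good b" "length ts \<le> length Bs" "ts \<noteq> []"
    and "\<And>k. k < length ts \<Longrightarrow> fst (Bs ! k) = fst (ts ! k) \<and> snd (ts ! k) \<in> lists (in_alph (M (fst (ts ! k)))) \<and>
      (\<exists>D. dels (M (fst (ts ! k))) (ent (Bs ! k)) (snd (ts ! k)) = Some D \<and> fst D \<in> accepting (M (fst (ts ! k))))"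
    and "successively (\<lambda>s t. fst s \<noteq> fst t) ts"
  shows "\<exists>fs. iter (nstep Bs) [] (concat (map (\<lambda>(j, t). map (Pair j) t) ts)) = Some fs \<and>
    block_list.accepts M Bs fs \<and> Suc (fst (hd fs)) = length ts"
  using assms(2-)
proof (induction ts rule: rev_induct)
  case (snoc t ts)
  interpret block_list J M Bs by unfold_locales (use assms(1) in blast)
  obtain j v where t: "t = (j, v)" by (cases t)
  let ?k = "length ts"
  have k: "?k < length Bs" "fst (Bs ! ?k) = j" "v \<in> lists (in_alph (M j))"
    using snoc.prems(1) snoc.prems(3)[of ?k] t by auto
  obtain D where D: "dels (M j) (ent (Bs ! ?k)) v = Some D" "fst D \<in> accepting (M j)"
    using snoc.prems(3)[of ?k] t by auto
  have "\<exists>fs. iter (nstep Bs) [] (concat (map (\<lambda>(j, t). map (Pair j) t) ts)) = Some fs \<and>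
    (fs = [] \<longleftrightarrow> ts = []) \<and> (fs \<noteq> [] \<longrightarrow> accepts fs) \<and> lvl fs = ?k"
  proof (cases "ts = []")
    case False
    have "fst (Bs ! i) = fst (ts ! i) \<and> snd (ts ! i) \<in> lists (in_alph (M (fst (ts ! i)))) \<and>
      (\<exists>D. dels (M (fst (ts ! i))) (ent (Bs ! i)) (snd (ts ! i)) = Some D \<and> fst D \<in> accepting (M (fst (ts ! i))))"
      if "i < length ts" for i
      using snoc.prems(3)[of i] that by (simp add: nth_append)
    then obtain fs where fs: "iter (nstep Bs) [] (concat (map (\<lambda>(j, t). map (Pair j) t) ts)) = Some fs"
      "accepts fs" "Suc (fst (hd fs)) = length ts"
      using snoc.IH snoc.prems(1,4) False by (auto simp: successively_append_iff)
    moreover have "fs \<noteq> []" using fs(2) unfolding accepts_def by simp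
    ultimately show ?thesis using False by (auto simp: lvl_def split: list.split)
  qed simp
  then obtain fs where fs: "iter (nstep Bs) [] (concat (map (\<lambda>(j, t). map (Pair j) t) ts)) = Some fs"
    "fs = [] \<longleftrightarrow> ts = []" "fs \<noteq> [] \<longrightarrow> accepts fs" "lvl fs = ?k" by blast
  have top: "fs \<noteq> [] \<Longrightarrow> fst (Bs ! fst (hd fs)) \<noteq> j"
  proof -
    assume ne: "fs \<noteq> []"
    then have "Suc (fst (hd fs)) = ?k" using fs(4) by (auto simp: lvl_def split: list.splits)
    moreover have "fst (last ts) \<noteq> j" using ne fs(2) snoc.prems(4) t by (auto simp: successively_append_iff)
    moreover have "ts \<noteq> []" using ne fs(2) by simp
    moreover from calculation have "last ts = ts ! fst (hd fs)" by (metis diff_Suc_1 last_conv_nth)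
    ultimately show ?thesis using snoc.prems(3)[of "fst (hd fs)"]
      by (auto simp: nth_append)
  qed
  have "first Bs (lvl fs) j = Some ?k" using fs(4) k by (intro first_eqI) auto
  then have foc: "focus Bs fs j = Some (?k, ent (Bs ! ?k), fs)"
    using top by (auto simp: focus_def)
  \<comment> \<open>Entry states are not accepting, so the syllable cannot have returned to the
    entry configuration and its frame is kept.\<close>
  have D_ent: "D \<noteq> ent (Bs ! ?k)"
  proof -
    have "good (Bs ! ?k)" using k(1) assms(1) by simp
    then show ?thesis
      using D(2) k(2) entry_configD(6)[OF special] unfolding good_def by (metis prod.collapse)
  qed
  have val: "valid (length (concat (map (\<lambda>(j, t). map (Pair j) t) ts))) fs"
  proof -
    have "set (concat (map (\<lambda>(j, t). map (Pair j) t) ts)) \<subseteq> letters"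
    proof clarsimp
      fix i w a assume "(i, w) \<in> set ts" "a \<in> set w"
      then obtain l where l: "l < length ts" "ts ! l = (i, w)" by (auto simp: in_set_conv_nth)
      then have "fst (Bs ! l) = i" "w \<in> lists (in_alph (M i))" "l < length Bs"
        using snoc.prems(3)[of l] snoc.prems(1) by (auto simp: nth_append)
      moreover from this have "i \<in> J" using good_nth unfolding good_def by blast
      ultimately show "(i, a) \<in> letters" using \<open>a \<in> set w\<close> unfolding letters_def by auto
    qed
    then have "concat (map (\<lambda>(j, t). map (Pair j) t) ts) \<in> lists letters"
      unfolding in_lists_conv_set by blast
    then show ?thesis using valid_iter[OF _ _ fs(1), of 0] by simp
  qed
  have "iter (nstep Bs) fs (map (Pair j) v) = Some ((?k, D) # fs)"
    using iter_nstep_single[OF val foc k(3)] D(1) D_ent by (simp add: unfocus_def)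
  then have "iter (nstep Bs) [] (concat (map (\<lambda>(j, t). map (Pair j) t) (ts @ [t]))) = Some ((?k, D) # fs)"
    using fs(1) t by (simp add: iter_append)
  moreover have "accepts ((?k, D) # fs)"
    using fs(3) D(2) k(2) unfolding accepts_def by auto
  ultimately show ?case by auto
qed simp

text \<open>The blocks in \<open>B\<close> accept the syllables of the normal form; the copies of
  \<open>R\<close> provide for the detours of \<open>w\<close>. By robustness \<open>w\<close> is
  not bad, so it ends with the same frames as its normal form.\<close>

lemma ex_accepting_block_list:
  assumes "w \<in> lists letters" "reduces w (concat (map (\<lambda>(j, t). map (Pair j) t) ts))"
    "ts \<noteq> []" "successively (\<lambda>s t. fst s \<noteq> fst t) ts"
    "\<And>j t. (j, t) \<in> set ts \<Longrightarrow> j \<in> J \<and> t \<in> lang (M j)"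
  shows "\<exists>Bs fs. (\<forall>b \<in> set Bs. good b) \<and> iter (nstep Bs) [] w = Some fs \<and> block_list.accepts M Bs fs"
proof -
  obtain n where n: "length w \<le> n" by blast
  have "\<exists>b. robust n b \<and> fst b = fst t \<and>
      (\<exists>D. dels (M (fst t)) (ent b) (snd t) = Some D \<and> fst D \<in> accepting (M (fst t)))" if "t \<in> set ts" for t
    using ex_robust_block[of "fst t" "snd t" n] assms(5)[of "fst t" "snd t"] that by simp
  then obtain f where f: "\<And>t. t \<in> set ts \<Longrightarrow> robust n (f t) \<and> fst (f t) = fst t \<and>
      (\<exists>D. dels (M (fst t)) (ent (f t)) (snd t) = Some D \<and> fst D \<in> accepting (M (fst t)))"
    by metis
  have "\<exists>b. robust n b \<and> fst b = j" if "j \<in> J" for j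
    using ex_robust_block[OF that] nontrivial[OF that] by blast
  then obtain g where g: "\<And>j. j \<in> J \<Longrightarrow> robust n (g j) \<and> fst (g j) = j" by metis
  define B where "B = map f ts"
  define R where "R = map g (sorted_list_of_set J)"
  define Bs where "Bs = B @ concat (replicate n R)"
  have rob: "robust n b" if "b \<in> set Bs" for b
    using that f g finite_J unfolding Bs_def B_def R_def by (auto split: if_splits)
  have R: "\<exists>b \<in> set R. fst b = j" if "j \<in> J" for j
    using g that finite_J unfolding R_def by auto
  interpret block_list J M Bs by unfold_locales (use rob robust_def in blast)
  have "fst (Bs ! k) = fst (ts ! k) \<and> snd (ts ! k) \<in> lists (in_alph (M (fst (ts ! k)))) \<and>
      (\<exists>D. dels (M (fst (ts ! k))) (ent (Bs ! k)) (snd (ts ! k)) = Some D \<and> fst D \<in> accepting (M (fst (ts ! k))))"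
    if "k < length ts" for k
  proof -
    have t: "ts ! k \<in> set ts" using that by simp
    moreover have "Bs ! k = f (ts ! k)" using that unfolding Bs_def B_def by (simp add: nth_append)
    moreover have "snd (ts ! k) \<in> lists (in_alph (M (fst (ts ! k))))"
      using assms(5)[of "fst (ts ! k)" "snd (ts ! k)"] t unfolding lang_def by auto
    ultimately show ?thesis using f by simp
  qed
  then obtain fs where fs: "iter (nstep Bs) [] (concat (map (\<lambda>(j, t). map (Pair j) t) ts)) = Some fs" "accepts fs"
    using iter_normal_form[of Bs ts] good assms(3,4) by (auto simp: Bs_def B_def)
  have "\<not> bad [] w" by (rule robust_not_bad[OF Bs_def rob R assms(1) n])
  then have "iter (nstep Bs) [] w = Some fs"
    using iter_reduces[OF assms(2), of 0 "[]"] assms(1) fs(1) by simp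
  then show ?thesis using fs(2) good by blast
qed

end

section \<open>The machine for the free product\<close>

text \<open>
  The state of a frame list: \<open>None\<close> if no frame is active, otherwise the factor and the state of the
  top frame, and whether some frame below it is not accepting.
\<close>

type_synonym fstate = "(nat \<times> nat \<times> bool) option"

text \<open>\<open>Init j q0 q t\<close> belongs to an unfinished block of the factor
  \<open>j\<close>: \<open>q0\<close> is the guessed entry state, \<open>q\<close> the current state
  of the first stage of \<open>M j\<close>, and \<open>t\<close> the promised class of the rest of
  the block. The number in \<open>Up\<close> codes the letter that has been read but not yet
  simulated; \<open>Back\<close> carries the state to be restored.\<close>

datatype pstate = Start | Between | Init nat nat nat nat | Final fstate
  | Read fstate | Up fstate nat | Simul nat nat bool | Back fstate

text \<open>A cell carries the entry state of its block: the bottom cell must supply the state in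
  which the factor machine starts and against which its return is tested.\<close>

datatype psymbol = Cell nat nat nat | Sym nat | Save fstate

instance pstate :: countable by countable_datatype

instance psymbol :: countable by countable_datatype

locale product_machine = factor_machines J M
  for J :: "nat set" and M :: "nat \<Rightarrow> (nat, 'a, ('a, nat) stack_symbol) cspda" +
  fixes A :: "'l set" and pr :: "'l \<Rightarrow> nat \<times> 'a"
  assumes finite_J: "finite J" and finite_A: "finite A" and pr_letters: "\<And>l. l \<in> A \<Longrightarrow> pr l \<in> letters"
begin

definition alph :: "('a, nat) stack_symbol set" where
  "alph = (\<Union>j\<in>J. check_alph (M j) \<union> push_alph (M j))"

definition code :: "('a, nat) stack_symbol \<Rightarrow> nat" where
  "code = (SOME f. inj_on f alph)"

definition decode :: "nat \<Rightarrow> ('a, nat) stack_symbol" where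
  "decode = inv_into alph code"

definition lcode :: "'l \<Rightarrow> nat" where
  "lcode = (SOME f. inj_on f A)"

definition ldecode :: "nat \<Rightarrow> 'l" where
  "ldecode = inv_into A lcode"

definition tcode :: "nat \<Rightarrow> ('a, nat) stack_symbol list \<Rightarrow> nat" where
  "tcode j = (SOME t. finite (range t) \<and>
    (\<forall>d s s'. t s = t s' \<longrightarrow> t (d # s) = t (d # s')) \<and>
    (\<forall>s s' q x. t s = t s' \<longrightarrow> accs (M j) s q x = accs (M j) s' q x))"

lemma finite_alph: "finite alph"
  using finite_J special_D(1)[OF special] unfolding alph_def is_cspda_def by simp

lemma decode_code: "x \<in> alph \<Longrightarrow> decode (code x) = x"
proof -
  have "inj_on code alph"
    unfolding code_def using finite_imp_inj_to_nat_seg[OF finite_alph] by (metis someI_ex)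
  then show "x \<in> alph \<Longrightarrow> decode (code x) = x" unfolding decode_def by simp
qed

lemma ldecode_lcode: "l \<in> A \<Longrightarrow> ldecode (lcode l) = l"
proof -
  have "inj_on lcode A"
    unfolding lcode_def using finite_imp_inj_to_nat_seg[OF finite_A] by (metis someI_ex)
  then show "l \<in> A \<Longrightarrow> ldecode (lcode l) = l" unfolding ldecode_def by simp
qed

lemma tcode:
  assumes "j \<in> J"
  shows "finite (range (tcode j))" "tcode j s = tcode j s' \<Longrightarrow> tcode j (d # s) = tcode j (d # s')"
    "tcode j s = tcode j s' \<Longrightarrow> accs (M j) s q x = accs (M j) s' q x"
proof -
  have "finite (range (tcode j)) \<and>
    (\<forall>d s s'. tcode j s = tcode j s' \<longrightarrow> tcode j (d # s) = tcode j (d # s')) \<and>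
    (\<forall>s s' q x. tcode j s = tcode j s' \<longrightarrow> accs (M j) s q x = accs (M j) s' q x)"
    unfolding tcode_def
    by (rule someI_ex[OF ex_suffix_code[OF special_D(1)[OF special[OF assms]]]])
  then show "finite (range (tcode j))" "tcode j s = tcode j s' \<Longrightarrow> tcode j (d # s) = tcode j (d # s')"
    "tcode j s = tcode j s' \<Longrightarrow> accs (M j) s q x = accs (M j) s' q x" by blast+
qed

lemma special_M:
  assumes "j \<in> J"
  shows "is_cspda (M j)" "P1 (M j)" "P2 (M j)" "P3 (M j)" "P4 (M j)" "P5 (M j)"
  using special_D[OF special[OF assms]] by auto

text \<open>The symbols of the factors, their \<open>Bot\<close> and \<open>Top\<close> included,
  are hidden inside \<open>Aux\<close>, so that the genuine \<open>Bot\<close> and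
  \<open>Top\<close> occur only where (P3) allows them.\<close>

definition cell :: "nat \<Rightarrow> nat \<Rightarrow> ('a, nat) stack_symbol \<Rightarrow> ('l, nat) stack_symbol" where
  "cell j q d = Aux (to_nat (Cell j q (code d)))"

definition symbol :: "('a, nat) stack_symbol \<Rightarrow> ('l, nat) stack_symbol" where
  "symbol x = Aux (to_nat (Sym (code x)))"

definition save :: "fstate \<Rightarrow> ('l, nat) stack_symbol" where
  "save \<sigma> = Aux (to_nat (Save \<sigma>))"

fun uncell :: "('l, nat) stack_symbol \<Rightarrow> (nat \<times> nat \<times> ('a, nat) stack_symbol) option" where
  "uncell (Aux n) = (case from_nat n of Cell j q c \<Rightarrow> Some (j, q, decode c) | _ \<Rightarrow> None)"
| "uncell _ = None"

fun unsym :: "('l, nat) stack_symbol \<Rightarrow> ('a, nat) stack_symbol" where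
  "unsym (Aux n) = (case from_nat n of Sym c \<Rightarrow> decode c | _ \<Rightarrow> Bot)"
| "unsym _ = Bot"

fun unsave :: "('l, nat) stack_symbol \<Rightarrow> fstate option" where
  "unsave (Aux n) = (case from_nat n of Save \<sigma> \<Rightarrow> Some \<sigma> | _ \<Rightarrow> None)"
| "unsave _ = None"

lemma codes [simp]:
  "d \<in> alph \<Longrightarrow> uncell (cell j q d) = Some (j, q, d)" "x \<in> alph \<Longrightarrow> unsym (symbol x) = x"
  "unsym (save \<sigma>) = Bot" "unsave (save \<sigma>) = Some \<sigma>" "unsave (symbol x) = None"
  "save \<sigma> = save \<tau> \<longleftrightarrow> \<sigma> = \<tau>" "symbol x \<noteq> save \<sigma>" "save \<sigma> \<noteq> symbol x"
  "uncell Bot = None" "uncell Top = None" "uncell Pad = None"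
  "symbol x \<noteq> Bot" "symbol x \<noteq> Top" "symbol x \<noteq> Pad" "save \<sigma> \<noteq> Bot" "save \<sigma> \<noteq> Top" "save \<sigma> \<noteq> Pad"
  "cell j q d \<noteq> Bot" "cell j q d \<noteq> Top" "cell j q d \<noteq> Pad"
  "Bot \<noteq> symbol x" "Top \<noteq> symbol x" "Pad \<noteq> symbol x" "Bot \<noteq> save \<sigma>" "Top \<noteq> save \<sigma>" "Pad \<noteq> save \<sigma>"
  "Bot \<noteq> cell j q d" "Top \<noteq> cell j q d" "Pad \<noteq> cell j q d"
  by (simp_all add: cell_def symbol_def save_def decode_code)

definition mstep where
  "mstep j q s l = (if \<exists>r. (q, s, l, r) \<in> trans (M j) then Some (THE r. (q, s, l, r) \<in> trans (M j)) else None)"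

lemma mstep_iff:
  assumes "j \<in> J"
  shows "mstep j q s l = Some r \<longleftrightarrow> (q, s, l, r) \<in> trans (M j)"
proof -
  have "r = r'" if "(q, s, l, r) \<in> trans (M j)" "(q, s, l, r') \<in> trans (M j)" for r r'
    using that special_M(3)[OF assms] unfolding P2_def by blast
  then have "(THE r. (q, s, l, r) \<in> trans (M j)) = r" if "(q, s, l, r) \<in> trans (M j)" for r
    using that by blast
  then show ?thesis unfolding mstep_def by (metis option.distinct(1) option.inject)
qed

text \<open>The bit that a new frame on top of a frame list with state \<open>\<sigma>\<close> has
  to carry.\<close>

definition debt :: "fstate \<Rightarrow> bool" where
  "debt \<sigma> = (case \<sigma> of None \<Rightarrow> False | Some (j, q, f) \<Rightarrow> f \<or> q \<notin> accepting (M j))"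

text \<open>At the bottom cell of a block, where \<open>c = Bot\<close>, the pushdown shows a saved
  state, which the factor machine has to see as its own \<open>Bot\<close>. Excluding
  \<open>x = Bot\<close> protects the genuine bottom symbol.\<close>

definition simulate where
  "simulate j q f x d l = (case uncell d of None \<Rightarrow> None | Some (j', q', c) \<Rightarrow>
     if x = Bot then None else
     map_option (\<lambda>(r, mv). (Simul j r f, map_pd_move symbol mv))
       (mstep j q (Some (if c = Bot then Bot else unsym x, c)) l))"

text \<open>\<open>Up\<close> passes every cell except the bottom cell of a block of the right
  factor, so it stops at the block given by \<open>first\<close>. \<open>Back\<close> removes copies
  of \<open>save \<sigma>\<close> until another symbol appears. A state \<open>Read (Some _)\<close>
  is blocked outside the blocks, in particular at \<open>Bot\<close>.\<close>

fun delta :: "pstate \<Rightarrow> (('l, nat) stack_symbol \<times> ('l, nat) stack_symbol) option \<Rightarrow> 'l option \<Rightarrow>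
    (pstate \<times> ('l, nat) stack_symbol pd_move) option" where
  "delta (Final \<sigma>) s l = (if s = None \<and> l = None then Some (Read \<sigma>, Push Bot) else None)"
| "delta (Read None) (Some (x, d)) (Some l) = (if d = Bot then Some (Up None (lcode l), Push (save None)) else None)"
| "delta (Read (Some (j, q, f))) (Some (x, d)) (Some l) = (if uncell d = None then None
     else if fst (pr l) = j then simulate j q f x d (Some (snd (pr l)))
     else Some (Up (Some (j, q, f)) (lcode l), Push (save (Some (j, q, f)))))"
| "delta (Up \<sigma> n) (Some (x, d)) None = (case uncell d of None \<Rightarrow> None | Some (j, q, c) \<Rightarrow>
     if j = fst (pr (ldecode n)) \<and> c = Bot then simulate j q (debt \<sigma>) x d (Some (snd (pr (ldecode n))))
     else Some (Up \<sigma> n, Push (save \<sigma>)))"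
| "delta (Simul j q f) (Some (x, d)) None = (case uncell d of None \<Rightarrow> None | Some (j', q', c) \<Rightarrow>
     if reading_state (M j) q then
       if c = Bot \<and> q = q' then map_option (\<lambda>\<sigma>. (Back \<sigma>, Pop)) (unsave x)
       else Some (Read (Some (j, q, f)), Stay)
     else simulate j q f x d None)"
| "delta (Back \<sigma>) (Some (x, d)) None =
     (if x = save \<sigma> then Some (Back \<sigma>, Pop) else Some (Read \<sigma>, Stay))"
| "delta _ _ _ = None"

fun is_read :: "pstate \<Rightarrow> bool" where
  "is_read (Read \<sigma>) = True"
| "is_read _ = False"

text \<open>The silent loops at the unreachable pair of padding symbols prevent the states without
  proper out-transitions from counting as reading states.\<close>

definition delta' where
  "delta' s o' l = (if o' = Some (Pad, Pad) then (if l = None \<and> \<not> is_read s then Some (s, Stay) else None)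
     else delta s o' l)"

definition fstates :: "fstate set" where
  "fstates = insert None (Some ` (SIGMA j:J. states (M j) \<times> UNIV))"

definition pstates :: "pstate set" where
  "pstates = {s. case s of Init j q r t \<Rightarrow> j \<in> J \<and> q \<in> states (M j) \<and> r \<in> states (M j) \<and> t \<in> range (tcode j)
     | Final \<sigma> \<Rightarrow> \<sigma> \<in> fstates | Read \<sigma> \<Rightarrow> \<sigma> \<in> fstates | Up \<sigma> n \<Rightarrow> \<sigma> \<in> fstates \<and> n \<in> lcode ` A
     | Simul j q f \<Rightarrow> j \<in> J \<and> q \<in> states (M j) | Back \<sigma> \<Rightarrow> \<sigma> \<in> fstates | _ \<Rightarrow> True}"

lemma in_pstates [simp]:
  "Start \<in> pstates" "Between \<in> pstates" "Final \<sigma> \<in> pstates \<longleftrightarrow> \<sigma> \<in> fstates"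
  "Read \<sigma> \<in> pstates \<longleftrightarrow> \<sigma> \<in> fstates" "Back \<sigma> \<in> pstates \<longleftrightarrow> \<sigma> \<in> fstates"
  "Simul j q f \<in> pstates \<longleftrightarrow> j \<in> J \<and> q \<in> states (M j)"
  "Init j q r t \<in> pstates \<longleftrightarrow> j \<in> J \<and> q \<in> states (M j) \<and> r \<in> states (M j) \<and> t \<in> range (tcode j)"
  "Up \<sigma> n \<in> pstates \<longleftrightarrow> \<sigma> \<in> fstates \<and> n \<in> lcode ` A"
  by (simp_all add: pstates_def)

lemma fstates_Some [simp]: "Some (j, q, f) \<in> fstates \<longleftrightarrow> j \<in> J \<and> q \<in> states (M j)" "None \<in> fstates"
  unfolding fstates_def by auto

definition is_acc :: "fstate \<Rightarrow> bool" where
  "is_acc \<sigma> \<longleftrightarrow> \<sigma> \<noteq> None \<and> \<not> debt \<sigma>"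

text \<open>
  (P7) forces every non-accepting reading state to be an entry state. This is harmless, as only
  \<open>Read None\<close> has a transition when \<open>Bot\<close> is seen on the check stack.
\<close>

inductive itrans :: "pstate \<Rightarrow> ('l, nat) stack_symbol \<Rightarrow> pstate \<Rightarrow> bool" where
  start: "itrans Start Bot Between"
| final: "\<not> is_acc \<sigma> \<Longrightarrow> itrans Between Top (Final \<sigma>)"
| first: "j \<in> J \<Longrightarrow> (start (M j), d, q) \<in> init_trans (M j) \<Longrightarrow>
    (\<And>s. tcode j s = t \<Longrightarrow> accs (M j) (d # s) q0 Bot) \<Longrightarrow> itrans Between (cell j q0 d) (Init j q0 q t)"
| mid: "j \<in> J \<Longrightarrow> (q, d, q') \<in> init_trans (M j) \<Longrightarrow> (\<And>s. tcode j s = t' \<Longrightarrow> tcode j (d # s) = t) \<Longrightarrow>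
    itrans (Init j q0 q t) (cell j q0 d) (Init j q0 q' t')"
| last: "j \<in> J \<Longrightarrow> (q, d, q') \<in> init_trans (M j) \<Longrightarrow> (q', None, None, q0, Push Bot) \<in> trans (M j) \<Longrightarrow>
    tcode j [d] = t \<Longrightarrow> itrans (Init j q0 q t) (cell j q0 d) Between"

definition calph :: "('l, nat) stack_symbol set" where
  "calph = {Bot, Pad, Top} \<union> Letter ` A \<union>
     (\<lambda>(j, q, d). cell j q d) ` (SIGMA j:J. states (M j) \<times> check_alph (M j))"

definition palph :: "('l, nat) stack_symbol set" where
  "palph = {Bot, Pad} \<union> Letter ` A \<union> save ` fstates \<union> symbol ` (\<Union>j\<in>J. push_alph (M j))"

text \<open>As \<open>delta'\<close> is defined on all symbols, the transitions are cut down to the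
  two stack alphabets and \<open>A\<close>.\<close>

definition N :: "(nat, 'l, ('l, nat) stack_symbol) cspda" where
  "N = \<lparr>states = to_nat ` pstates, start = to_nat Start,
     accepting = (to_nat \<circ> Read) ` {\<sigma> \<in> fstates. is_acc \<sigma>}, in_alph = A,
     check_alph = calph, push_alph = palph,
     init_trans = {(to_nat s, d, to_nat s') | s d s'. itrans s d s' \<and> s \<in> pstates \<and> s' \<in> pstates},
     trans = {(to_nat s, o', l, to_nat s', mv) | s o' l s' mv. delta' s o' l = Some (s', mv) \<and> s \<in> pstates \<and>
       (\<forall>x d. o' = Some (x, d) \<longrightarrow> x \<in> palph \<and> d \<in> calph) \<and> (\<forall>a. l = Some a \<longrightarrow> a \<in> A)}\<rparr>"

lemma N_sel [simp]:
  "states N = to_nat ` pstates" "start N = to_nat Start" "in_alph N = A"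
  "accepting N = (to_nat \<circ> Read) ` {\<sigma> \<in> fstates. is_acc \<sigma>}" "check_alph N = calph" "push_alph N = palph"
  by (simp_all add: N_def)

lemma trans_N_iff:
  "(to_nat s, o', l, r, mv) \<in> trans N \<longleftrightarrow> (\<exists>s'. r = to_nat s' \<and> delta' s o' l = Some (s', mv)) \<and> s \<in> pstates \<and>
     (\<forall>x d. o' = Some (x, d) \<longrightarrow> x \<in> palph \<and> d \<in> calph) \<and> (\<forall>a. l = Some a \<longrightarrow> a \<in> A)"
  by (auto simp: N_def)

lemma trans_ND:
  assumes "(r, o', l, r', mv) \<in> trans N"
  obtains s s' where "r = to_nat s" "r' = to_nat s'" "delta' s o' l = Some (s', mv)" "s \<in> pstates"
    "\<And>x d. o' = Some (x, d) \<Longrightarrow> x \<in> palph \<and> d \<in> calph" "\<And>a. l = Some a \<Longrightarrow> a \<in> A"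
  using assms unfolding N_def by auto

lemma init_trans_N_iff:
  "(to_nat s, d, to_nat s') \<in> init_trans N \<longleftrightarrow> itrans s d s' \<and> s \<in> pstates \<and> s' \<in> pstates"
  by (auto simp: N_def)

lemma init_trans_ND:
  assumes "(r, d, r') \<in> init_trans N"
  obtains s s' where "r = to_nat s" "r' = to_nat s'" "itrans s d s'" "s \<in> pstates" "s' \<in> pstates"
  using assms unfolding N_def by auto

lemma finite_fstates: "finite fstates"
proof -
  have "finite (states (M j))" if "j \<in> J" for j using special_M(1)[OF that] unfolding is_cspda_def by blast
  then show ?thesis unfolding fstates_def using finite_J by (intro finite.insertI finite_imageI finite_SigmaI) auto
qed

lemma finite_pstates: "finite pstates"
proof -
  let ?I = "\<Union>j\<in>J. \<Union>q\<in>states (M j). \<Union>r\<in>states (M j). Init j q r ` range (tcode j)"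
  let ?S = "\<Union>j\<in>J. \<Union>q\<in>states (M j). range (Simul j q)"
  let ?U = "\<Union>\<sigma>\<in>fstates. Up \<sigma> ` lcode ` A"
  let ?X = "{{Start, Between}, ?I, Final ` fstates, Read ` fstates, ?U, ?S, Back ` fstates}"
  have fin: "finite (states (M j))" if "j \<in> J" for j using special_M(1)[OF that] unfolding is_cspda_def by blast
  have "s \<in> \<Union>?X" if s: "s \<in> pstates" for s
  proof (cases s)
    case (Init j q r t)
    then have "j \<in> J" "q \<in> states (M j)" "r \<in> states (M j)" "t \<in> range (tcode j)"
      using s by simp_all
    then have "s \<in> ?I" unfolding Init by (intro UN_I[of j] UN_I[of q] UN_I[of r] imageI[of t])
    then show ?thesis by (rule UnionI[rotated]) simp
  next
    case (Up \<sigma> n)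
    then have "\<sigma> \<in> fstates" "n \<in> lcode ` A" using s by simp_all
    then have "s \<in> ?U" unfolding Up by (intro UN_I[of \<sigma>] imageI[of n])
    then show ?thesis by (rule UnionI[rotated]) simp
  next
    case (Simul j q f)
    then have "j \<in> J" "q \<in> states (M j)" using s by simp_all
    then have "s \<in> ?S" unfolding Simul by (intro UN_I[of j] UN_I[of q] rangeI)
    then show ?thesis by (rule UnionI[rotated]) simp
  qed (use s in simp_all)
  then have "pstates \<subseteq> \<Union>?X" by (rule subsetI)
  moreover have "finite ?I" using finite_J fin by (intro finite_UN_I finite_imageI[OF tcode(1)]) auto
  moreover have "finite ?S" using finite_J fin by (intro finite_UN_I finite_imageI) auto
  moreover have "finite ?U" using finite_fstates finite_A by (intro finite_UN_I finite_imageI) auto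
  ultimately show ?thesis using finite_fstates by (elim finite_subset, intro finite_Union) auto
qed

lemma states_trans: "j \<in> J \<Longrightarrow> (q, s, l, q', mv) \<in> trans (M j) \<Longrightarrow> q' \<in> states (M j)"
  using special_M(1) unfolding is_cspda_def by fast

lemma push_trans: "j \<in> J \<Longrightarrow> (q, s, l, q', Push x) \<in> trans (M j) \<Longrightarrow> x \<in> push_alph (M j)"
  using special_M(1) unfolding is_cspda_def by fast

lemma simulate_closed:
  assumes "simulate j q f x d l = Some (s', mv)" "j \<in> J"
  shows "s' \<in> pstates" "\<And>y. mv = Push y \<Longrightarrow> y \<in> palph" "\<not> is_read s'"
proof -
  obtain j' q' c r mv' where u: "uncell d = Some (j', q', c)"
    and m: "mstep j q (Some (if c = Bot then Bot else unsym x, c)) l = Some (r, mv')"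
    and s: "s' = Simul j r f" "mv = map_pd_move symbol mv'"
    using assms(1) unfolding simulate_def by (auto split: option.splits if_splits)
  have t: "(q, Some (if c = Bot then Bot else unsym x, c), l, r, mv') \<in> trans (M j)"
    using m mstep_iff[OF assms(2)] by blast
  show "s' \<in> pstates" using states_trans[OF assms(2) t] assms(2) s(1) by simp
  show "\<not> is_read s'" using s(1) by simp
  show "y \<in> palph" if "mv = Push y" for y
  proof -
    have "map_pd_move symbol mv' = Push y" using s(2) that by simp
    then obtain z where "mv' = Push z" "y = symbol z" by (cases mv') auto
    then have "z \<in> push_alph (M j)" using push_trans[OF assms(2)] t by blast
    then show ?thesis using assms(2) \<open>y = symbol z\<close> unfolding palph_def by blast
  qed
qed

lemma unsave_palph: "x \<in> palph \<Longrightarrow> unsave x = Some \<sigma> \<Longrightarrow> \<sigma> \<in> fstates"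
  unfolding palph_def by auto

lemma delta_closed:
  assumes "delta' s o' l = Some (s', mv)" "s \<in> pstates"
    "\<And>x d. o' = Some (x, d) \<Longrightarrow> x \<in> palph \<and> d \<in> calph" "\<And>a. l = Some a \<Longrightarrow> a \<in> A"
  shows "s' \<in> pstates \<and> (\<forall>y. mv = Push y \<longrightarrow> y \<in> palph)"
proof (cases "o' = Some (Pad, Pad)")
  case True
  then show ?thesis using assms(1,2) unfolding delta'_def by (auto split: if_splits)
next
  case False
  then have d: "delta s o' l = Some (s', mv)" using assms(1) unfolding delta'_def by auto
  have fs: "save ` fstates \<subseteq> palph" "Bot \<in> palph" unfolding palph_def by auto
  from d show ?thesis
  proof (cases rule: delta.elims)
    case (1 \<sigma> s l)
    then show ?thesis using assms(2) fs by (auto split: if_splits)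
  next
    case (2 x d a)
    then show ?thesis using assms(2,4) fs by (auto split: if_splits)
  next
    case (3 j q f x d a)
    then show ?thesis using assms(2,4) fs simulate_closed[of j q f x d "Some (snd (pr a))" s' mv]
      by (auto split: if_splits)
  next
    case (4 \<sigma> n x d)
    then obtain j q c where u: "uncell d = Some (j, q, c)" by (auto split: option.splits)
    obtain a where a: "a \<in> A" "n = lcode a" using assms(2) 4 by auto
    then have "fst (pr (ldecode n)) \<in> J" using pr_letters[of a] ldecode_lcode[of a] by (auto simp: letters_def)
    then show ?thesis using 4 u assms(2) fs
        simulate_closed[of j q "debt \<sigma>" x d "Some (snd (pr (ldecode n)))" s' mv]
      by (auto split: if_splits)
  next
    case (5 j q f x d)
    then show ?thesis
      using assms(2,3) unsave_palph[of x] simulate_closed[of j q f x d None s' mv]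
      by (cases "unsave x") (auto split: option.splits if_splits)
  next
    case (6 \<sigma> x d)
    then show ?thesis using assms(2) by (auto split: if_splits)
  qed simp_all
qed

lemma init_states: "j \<in> J \<Longrightarrow> (q, d, q') \<in> init_trans (M j) \<Longrightarrow> q \<in> states (M j) \<and> d \<in> check_alph (M j) \<and> q' \<in> states (M j)"
  using special_M(1) unfolding is_cspda_def by fast

lemma itrans_calph:
  assumes "itrans s d s'" "s \<in> pstates" "s' \<in> pstates"
  shows "d \<in> calph"
proof -
  have cell: "cell j q c \<in> calph" if "j \<in> J" "q \<in> states (M j)" "c \<in> check_alph (M j)" for j q c
    using that unfolding calph_def by (intro UnI2 image_eqI[of _ _ "(j, q, c)"]) auto
  from assms(1) show ?thesis
  proof cases
    case (first j c q t q0)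
    then show ?thesis using assms(3) cell init_states[of j] by simp
  next
    case (mid j q c q' t' t q0)
    then show ?thesis using assms(3) cell init_states[of j q c] by simp
  next
    case (last j q c q' q0 t)
    then show ?thesis using assms(2) cell init_states[of j q c] by simp
  qed (simp_all add: calph_def)
qed

lemma is_cspda_N: "is_cspda N"
proof -
  have "finite (states (M j)) \<and> finite (check_alph (M j)) \<and> finite (push_alph (M j))" if "j \<in> J" for j
    using special_M(1)[OF that] unfolding is_cspda_def by blast
  then have fin: "finite calph" "finite palph"
    unfolding calph_def palph_def
    by (intro finite_UnI finite_imageI finite_SigmaI finite_UN_I finite_J finite_A finite_fstates finite.intros; blast)+
  have it: "q \<in> to_nat ` pstates \<and> d \<in> calph \<and> q' \<in> to_nat ` pstates" if "(q, d, q') \<in> init_trans N" for q d q'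
    using that by (rule init_trans_ND) (use itrans_calph in blast)
  have tr: "q \<in> to_nat ` pstates \<and> q' \<in> to_nat ` pstates \<and>
     (\<forall>x d. s = Some (x, d) \<longrightarrow> x \<in> palph \<and> d \<in> calph) \<and>
     (\<forall>a. l = Some a \<longrightarrow> a \<in> A) \<and> (\<forall>x. mv = Push x \<longrightarrow> x \<in> palph)" if "(q, s, l, q', mv) \<in> trans N" for q s l q' mv
    using that by (rule trans_ND) (use delta_closed in blast)
  have "(to_nat \<circ> Read) ` {\<sigma> \<in> fstates. is_acc \<sigma>} \<subseteq> to_nat ` pstates" by auto
  moreover have "\<forall>(q, d, q') \<in> init_trans N. q \<in> to_nat ` pstates \<and> d \<in> calph \<and> q' \<in> to_nat ` pstates"
    using it by blast
  moreover have "\<forall>(q, s, l, q', mv) \<in> trans N. q \<in> to_nat ` pstates \<and> q' \<in> to_nat ` pstates \<and>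
     (\<forall>x d. s = Some (x, d) \<longrightarrow> x \<in> palph \<and> d \<in> calph) \<and>
     (\<forall>a. l = Some a \<longrightarrow> a \<in> A) \<and> (\<forall>x. mv = Push x \<longrightarrow> x \<in> palph)"
    using tr by blast
  ultimately show ?thesis
    unfolding is_cspda_def N_sel using fin finite_pstates finite_A by simp
qed

text \<open>The state alone decides whether a transition reads. This gives (P1), and reduces (P2) to
  \<open>delta'\<close> being a function.\<close>

lemma is_read_delta': "delta' s o' l = Some r \<Longrightarrow> l = None \<longleftrightarrow> \<not> is_read s"
proof -
  assume "delta' s o' l = Some r"
  then consider "l = None" "\<not> is_read s" | "delta s o' l = Some r"
    unfolding delta'_def by (auto split: if_splits)
  then show "l = None \<longleftrightarrow> \<not> is_read s"
  proof cases
    case 2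
    then show ?thesis by (cases rule: delta.elims) (simp_all split: if_splits)
  qed simp
qed

lemma reading_state_N_iff: "s \<in> pstates \<Longrightarrow> reading_state N (to_nat s) \<longleftrightarrow> is_read s"
proof
  assume s: "s \<in> pstates" and r: "reading_state N (to_nat s)"
  show "is_read s"
  proof (rule ccontr)
    assume "\<not> is_read s"
    then have "(to_nat s, Some (Pad, Pad), None, to_nat s, Stay) \<in> trans N"
      using s unfolding trans_N_iff by (auto simp: delta'_def palph_def calph_def)
    then show False using r unfolding reading_state_def by blast
  qed
next
  assume s: "s \<in> pstates" and r: "is_read s"
  have "\<not> itrans s d s'" for d s' using r by (auto elim: itrans.cases)
  then have "(to_nat s, d, q) \<notin> init_trans N" for d q by (auto elim: init_trans_ND)
  moreover have "l \<noteq> None" if "(to_nat s, o', l, q, mv) \<in> trans N" for o' l q mv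
    using that by (rule trans_ND) (use r is_read_delta'[of s] in auto)
  ultimately show "reading_state N (to_nat s)" unfolding reading_state_def using s by simp
qed

lemma P1_N: "P1 N"
proof -
  have "nonreading_state N (to_nat s)" if "s \<in> pstates" "\<not> is_read s" for s
    unfolding nonreading_state_def using that is_read_delta' by (auto elim!: trans_ND)
  then show ?thesis unfolding P1_def using reading_state_N_iff by auto
qed

lemma P2_N: "P2 N"
  unfolding P2_def
proof (intro allI impI)
  fix q s l l' r r'
  assume *: "(q, s, l, r) \<in> trans N \<and> (q, s, l', r') \<in> trans N \<and> (l = l' \<or> l = None \<or> l' = None)"
  obtain x y where r: "r = (x, y)" by (cases r)
  obtain x' y' where r': "r' = (x', y')" by (cases r')
  from * have "(q, s, l, x, y) \<in> trans N" "(q, s, l', x', y') \<in> trans N" unfolding r r' by auto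
  then obtain a b a' b' where 1: "q = to_nat a" "x = to_nat b" "delta' a s l = Some (b, y)"
    and 2: "q = to_nat a'" "x' = to_nat b'" "delta' a' s l' = Some (b', y')"
    by (elim trans_ND)
  have "a = a'" using 1 2 by simp
  moreover from this have "l = None \<longleftrightarrow> l' = None" using is_read_delta' 1 2 by blast
  then have "l = l'" using * by auto
  ultimately show "l = l' \<and> r = r'" using 1 2 r r' by simp
qed

lemma step_N_iff:
  assumes "s \<in> pstates" "set p \<subseteq> palph" "set U \<subseteq> calph" "length p \<le> length U"
    "\<And>a. l = Some a \<Longrightarrow> a \<in> A"
  shows "step N (to_nat s, U, p) l D \<longleftrightarrow> (\<exists>s' mv. delta' s (seen U p) l = Some (s', mv) \<and>
    (case mv of Push x \<Rightarrow> length p < length U \<and> D = (to_nat s', U, x # p)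
     | Pop \<Rightarrow> p \<noteq> [] \<and> D = (to_nat s', U, tl p) | Stay \<Rightarrow> D = (to_nat s', U, p)))"
proof -
  have sn: "x \<in> palph \<and> d \<in> calph" if "seen U p = Some (x, d)" for x d
    using that assms(2-4) unfolding seen_def by (cases p) (auto split: if_splits)
  have t: "(to_nat s, seen U p, l, r, mv) \<in> trans N \<longleftrightarrow> (\<exists>s'. r = to_nat s' \<and> delta' s (seen U p) l = Some (s', mv))"
    for r mv unfolding trans_N_iff using sn assms(1,5) by blast
  show ?thesis
  proof
    assume "step N (to_nat s, U, p) l D"
    then show "\<exists>s' mv. delta' s (seen U p) l = Some (s', mv) \<and>
      (case mv of Push x \<Rightarrow> length p < length U \<and> D = (to_nat s', U, x # p)
       | Pop \<Rightarrow> p \<noteq> [] \<and> D = (to_nat s', U, tl p) | Stay \<Rightarrow> D = (to_nat s', U, p))"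
    proof cases
      case (push r x)
      then show ?thesis using t[of r "Push x"] by force
    next
      case (pop x p' r)
      then show ?thesis using t[of r Pop] by force
    next
      case (stay r)
      then show ?thesis using t[of r Stay] by force
    qed
  next
    assume "\<exists>s' mv. delta' s (seen U p) l = Some (s', mv) \<and>
      (case mv of Push x \<Rightarrow> length p < length U \<and> D = (to_nat s', U, x # p)
       | Pop \<Rightarrow> p \<noteq> [] \<and> D = (to_nat s', U, tl p) | Stay \<Rightarrow> D = (to_nat s', U, p))"
    then obtain s' mv where d: "delta' s (seen U p) l = Some (s', mv)"
      and D: "case mv of Push x \<Rightarrow> length p < length U \<and> D = (to_nat s', U, x # p)
       | Pop \<Rightarrow> p \<noteq> [] \<and> D = (to_nat s', U, tl p) | Stay \<Rightarrow> D = (to_nat s', U, p)" by blast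
    then have "(to_nat s, seen U p, l, to_nat s', mv) \<in> trans N" using t by blast
    then show "step N (to_nat s, U, p) l D"
      using D by (cases mv; cases p) (auto intro: step.intros)
  qed
qed

end

section \<open>Initialisation and entry configurations of the product machine\<close>

context product_machine
begin

fun enc :: "(nat, ('a, nat) stack_symbol) block \<Rightarrow> ('l, nat) stack_symbol list" where
  "enc (j, q, u) = map (cell j q) u"

definition cstack :: "(nat, ('a, nat) stack_symbol) block list \<Rightarrow> ('l, nat) stack_symbol list" where
  "cstack Bs = Bot # concat (map enc Bs) @ [Top]"

text \<open>Trades reachability of acceptance for \<open>accs\<close>, which the initialisation can
  check through suffix classes.\<close>

lemma good_iff:
  "good (j, q, u) \<longleftrightarrow> j \<in> J \<and> entry_config (M j) (q, u, [Bot]) \<and> accs (M j) u q Bot"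
proof -
  have "(\<exists>w D. dels (M j) (q, u, [Bot]) w = Some D \<and> fst D \<in> accepting (M j)) \<longleftrightarrow> accs (M j) u q Bot"
    if j: "j \<in> J" and e: "entry_config (M j) (q, u, [Bot])"
  proof -
    note dd = dels_eq_Some[OF special_M(2,3,1)[OF j] entry_reading[OF special[OF j] e]]
    have "(\<exists>w D. dels (M j) (q, u, [Bot]) w = Some D \<and> fst D \<in> accepting (M j)) \<longleftrightarrow>
      (\<exists>w D. run (M j) (q, u, [Bot]) w D \<and> fst D \<in> accepting (M j))"
      unfolding dd after_def using special_M(6)[OF j] unfolding P5_def reading_config_def by blast
    then show ?thesis using accs_Bot_iff[OF special[OF j] e] by simp
  qed
  then show ?thesis unfolding good_def by auto
qed

lemma entry_config_iff:
  assumes "j \<in> J"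
  shows "entry_config (M j) (q, u, [Bot]) \<longleftrightarrow>
    u \<noteq> [] \<and> (\<exists>r. initialises (M j) r u \<and> (r, None, None, q, Push Bot) \<in> trans (M j))"
proof
  assume e: "entry_config (M j) (q, u, [Bot])"
  then obtain r v l where r: "initialises (M j) r v" "step (M j) (r, v, []) l (q, u, [Bot])"
    unfolding entry_config_def by blast
  then have "l = None" using special_M(4)[OF assms] unfolding P3_def by blast
  from r(2) have "v = u \<and> (r, None, l, q, Push Bot) \<in> trans (M j)"
    by cases (auto simp: seen_def)
  then show "u \<noteq> [] \<and> (\<exists>r. initialises (M j) r u \<and> (r, None, None, q, Push Bot) \<in> trans (M j))"
    using r(1) \<open>l = None\<close> entry_configD(2)[OF special[OF assms] e] by blast
next
  assume "u \<noteq> [] \<and> (\<exists>r. initialises (M j) r u \<and> (r, None, None, q, Push Bot) \<in> trans (M j))"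
  then obtain r where "initialises (M j) r u" "(r, seen u [], None, q, Push Bot) \<in> trans (M j)" "length [] < length u"
    by (auto simp: seen_def)
  then have "initialises (M j) r u" "step (M j) (r, u, []) None (q, u, [Bot])"
    using step.push[of r u "[]" None q Bot "M j"] by auto
  then show "entry_config (M j) (q, u, [Bot])" unfolding entry_config_def by blast
qed

text \<open>The \<open>Init\<close> clause is the promise behind the guess: every continuation of
  class \<open>t\<close> completes the partial block to a stack that admits acceptance. The rule
  \<open>last\<close> redeems it with a continuation of one symbol.\<close>

fun init_inv :: "pstate \<Rightarrow> ('l, nat) stack_symbol list \<Rightarrow> bool" where
  "init_inv Start U \<longleftrightarrow> U = []"
| "init_inv Between U \<longleftrightarrow> (\<exists>Bs. (\<forall>b \<in> set Bs. good b) \<and> U = Bot # concat (map enc Bs))"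
| "init_inv (Init j q0 q t) U \<longleftrightarrow> (\<exists>Bs x. (\<forall>b \<in> set Bs. good b) \<and> U = Bot # concat (map enc Bs) @ map (cell j q0) x \<and>
     initialises (M j) q x \<and> (\<forall>s. tcode j s = t \<longrightarrow> accs (M j) (x @ s) q0 Bot))"
| "init_inv (Final \<sigma>) U \<longleftrightarrow> \<not> is_acc \<sigma> \<and> (\<exists>Bs. (\<forall>b \<in> set Bs. good b) \<and> U = cstack Bs)"
| "init_inv _ U \<longleftrightarrow> False"

lemma init_inv_itrans:
  assumes "itrans s d s'" "init_inv s U"
  shows "init_inv s' (U @ [d])"
  using assms(1)
proof cases
  case start
  then show ?thesis using assms(2) by (auto intro!: exI[of _ "[]"])
next
  case (final \<sigma>)
  then show ?thesis using assms(2) by (auto simp: cstack_def)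
next
  case (first j c q t q0)
  from assms(2) obtain Bs where Bs: "\<forall>b \<in> set Bs. good b" "U = Bot # concat (map enc Bs)" using first by auto
  have "initialises (M j) q ([] @ [c])" using first(5) by (rule initialises.push[OF initialises.start])
  then show ?thesis using first Bs by (auto intro!: exI[of _ Bs] exI[of _ "[c]"])
next
  case (mid j q c q' t' t q0)
  from assms(2) obtain Bs x where Bs: "\<forall>b \<in> set Bs. good b" "U = Bot # concat (map enc Bs) @ map (cell j q0) x"
    "initialises (M j) q x" "\<And>s. tcode j s = t \<Longrightarrow> accs (M j) (x @ s) q0 Bot" using mid by auto
  have "initialises (M j) q' (x @ [c])" using mid Bs(3) by (intro initialises.push) auto
  moreover have "accs (M j) ((x @ [c]) @ s) q0 Bot" if "tcode j s = t'" for s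
    using Bs(4)[of "c # s"] mid that by simp
  ultimately show ?thesis using mid Bs(1,2) by (auto intro!: exI[of _ Bs] exI[of _ "x @ [c]"])
next
  case (last j q c q' q0 t)
  from assms(2) obtain Bs x where Bs: "\<forall>b \<in> set Bs. good b" "U = Bot # concat (map enc Bs) @ map (cell j q0) x"
    "initialises (M j) q x" "\<And>s. tcode j s = t \<Longrightarrow> accs (M j) (x @ s) q0 Bot" using last by auto
  have "initialises (M j) q' (x @ [c])" using last Bs(3) by (intro initialises.push) auto
  then have "entry_config (M j) (q0, x @ [c], [Bot])" using last entry_config_iff by auto
  then have "good (j, q0, x @ [c])" using Bs(4)[of "[c]"] last good_iff by simp
  then show ?thesis using Bs(1,2) last by (auto intro!: exI[of _ "Bs @ [(j, q0, x @ [c])]"])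
qed

lemma initialises_N_D: "initialises N r U \<Longrightarrow> \<exists>s \<in> pstates. r = to_nat s \<and> init_inv s U"
proof (induction rule: initialises.induct)
  case start
  then show ?case by (intro bexI[of _ Start]) auto
next
  case (push r U d r')
  from push.hyps(2) show ?case
    by (rule init_trans_ND) (use push.IH init_inv_itrans in auto)
qed

text \<open>All guesses are made correctly: the class recorded after \<open>x\<close> is that of the
  actual remainder \<open>s\<close>. Generalising over \<open>s\<close> lets the induction shift the
  last symbol of the prefix into the remainder.\<close>

lemma initialises_N_cells:
  assumes U: "initialises N (to_nat Between) U" and j: "j \<in> J" and q0: "q0 \<in> states (M j)"
    and x: "initialises (M j) q x" "x \<noteq> []" and acc: "accs (M j) (x @ s) q0 Bot"
  shows "initialises N (to_nat (Init j q0 q (tcode j s))) (U @ map (cell j q0) x)"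
  using x acc
proof (induction arbitrary: s rule: initialises.induct)
  case (push q x d q')
  have st: "q \<in> states (M j)" "q' \<in> states (M j)" using init_states[OF j push.hyps(2)] by auto
  show ?case
  proof (cases "x = []")
    case True
    have "q = start (M j)" using push.hyps(1) True by cases auto
    moreover have "accs (M j) (d # s') q0 Bot" if "tcode j s' = tcode j s" for s'
      using tcode(3)[OF j tcode(2)[OF j that]] push.prems(2) True by simp
    ultimately have "itrans Between (cell j q0 d) (Init j q0 q' (tcode j s))"
      using push.hyps(2) j by (intro itrans.first) auto
    then have "(to_nat Between, cell j q0 d, to_nat (Init j q0 q' (tcode j s))) \<in> init_trans N"
      using j q0 st by (simp add: init_trans_N_iff)
    then show ?thesis using initialises.push[OF U] True by simp
  next
    case False
    have "initialises N (to_nat (Init j q0 q (tcode j (d # s)))) (U @ map (cell j q0) x)"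
      using push.IH[of "d # s"] push.prems(2) False by simp
    moreover have "itrans (Init j q0 q (tcode j (d # s))) (cell j q0 d) (Init j q0 q' (tcode j s))"
      by (rule itrans.mid[OF j push.hyps(2)]) (rule tcode(2)[OF j])
    then have "(to_nat (Init j q0 q (tcode j (d # s))), cell j q0 d, to_nat (Init j q0 q' (tcode j s))) \<in> init_trans N"
      using j q0 st by (simp add: init_trans_N_iff)
    ultimately have "initialises N (to_nat (Init j q0 q' (tcode j s))) ((U @ map (cell j q0) x) @ [cell j q0 d])"
      by (rule initialises.push)
    then show ?thesis by simp
  qed
qed simp

lemma initialises_N_block:
  assumes U: "initialises N (to_nat Between) U" and b: "good (j, q0, u)"
  shows "initialises N (to_nat Between) (U @ enc (j, q0, u))"
proof -
  have j: "j \<in> J" and e: "entry_config (M j) (q0, u, [Bot])" and a: "accs (M j) u q0 Bot"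
    using b good_iff by auto
  obtain r where r: "initialises (M j) r u" "(r, None, None, q0, Push Bot) \<in> trans (M j)"
    using e entry_config_iff[OF j] by blast
  have u: "u \<noteq> []" "hd u = Bot" "last u = Top" using entry_configD[OF special[OF j] e] by auto
  from r(1) obtain x d q where x: "u = x @ [d]" "initialises (M j) q x" "(q, d, r) \<in> init_trans (M j)"
    using u(1) by cases auto
  \<comment> \<open>The ends of a block carry \<open>Bot\<close> and \<open>Top\<close>, so it has
    at least two cells; therefore the first and the last cell can have separate rules.\<close>
  have "x \<noteq> []" using u x(1) by auto
  have q0: "q0 \<in> states (M j)" using entry_config_push_alph(2)[OF special[OF j] e] .
  have "initialises N (to_nat (Init j q0 q (tcode j [d]))) (U @ map (cell j q0) x)"
    using initialises_N_cells[OF U j q0 x(2) \<open>x \<noteq> []\<close>] a x(1) by simp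
  moreover have "itrans (Init j q0 q (tcode j [d])) (cell j q0 d) Between"
    using j x(3) r(2) by (intro itrans.last) auto
  then have "(to_nat (Init j q0 q (tcode j [d])), cell j q0 d, to_nat Between) \<in> init_trans N"
    using j q0 init_states[OF j x(3)] by (simp add: init_trans_N_iff)
  ultimately have "initialises N (to_nat Between) ((U @ map (cell j q0) x) @ [cell j q0 d])"
    by (rule initialises.push)
  then show ?thesis using x(1) by simp
qed

lemma initialises_N_cstack:
  assumes "\<And>b. b \<in> set Bs \<Longrightarrow> good b" "\<sigma> \<in> fstates" "\<not> is_acc \<sigma>"
  shows "initialises N (to_nat (Final \<sigma>)) (cstack Bs)"
proof -
  have "(to_nat Start, Bot, to_nat Between) \<in> init_trans N"
    by (simp add: init_trans_N_iff itrans.start)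
  then have "initialises N (to_nat Between) ([] @ [Bot])"
    using initialises.start[of N] by (intro initialises.push) auto
  then have "initialises N (to_nat Between) (Bot # concat (map enc Bs))"
    using assms(1)
  proof (induction Bs rule: rev_induct)
    case (snoc b Bs)
    then show ?case using initialises_N_block[of "Bot # concat (map enc Bs)"] by (cases b) auto
  qed simp
  moreover have "(to_nat Between, Top, to_nat (Final \<sigma>)) \<in> init_trans N"
    using assms by (simp add: init_trans_N_iff itrans.final)
  ultimately have "initialises N (to_nat (Final \<sigma>)) ((Bot # concat (map enc Bs)) @ [Top])"
    by (rule initialises.push)
  then show ?thesis unfolding cstack_def by simp
qed

text \<open>The state \<open>\<sigma>\<close> and the blocks are guessed independently. Only
  configurations with \<open>\<sigma> = None\<close> can move, see
  \<open>stuck_entry\<close>.\<close>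

lemma entry_config_N_iff:
  "entry_config N C \<longleftrightarrow> (\<exists>Bs. \<exists>\<sigma> \<in> fstates. (\<forall>b \<in> set Bs. good b) \<and> \<not> is_acc \<sigma> \<and>
     C = (to_nat (Read \<sigma>), cstack Bs, [Bot]))"
proof
  assume "entry_config N C"
  then obtain r U l where r: "initialises N r U" "step N (r, U, []) l C"
    unfolding entry_config_def by blast
  obtain s where s: "s \<in> pstates" "r = to_nat s" "init_inv s U" using initialises_N_D[OF r(1)] by blast
  from r(2) obtain r' mv where t: "(r, None, l, r', mv) \<in> trans N" "\<And>x. mv = Push x \<Longrightarrow> C = (r', U, [x])"
    by cases (auto simp: seen_def)
  from t(1) obtain s' where d: "delta' s None l = Some (s', mv)" "r' = to_nat s'"
    unfolding s(2) trans_N_iff by blast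
  then obtain \<sigma> where "s = Final \<sigma>" "s' = Read \<sigma>" "mv = Push Bot"
    unfolding delta'_def by (cases s) (auto split: if_splits elim: delta.elims)
  then show "\<exists>Bs. \<exists>\<sigma> \<in> fstates. (\<forall>b \<in> set Bs. good b) \<and> \<not> is_acc \<sigma> \<and> C = (to_nat (Read \<sigma>), cstack Bs, [Bot])"
    using s t(2) d(2) by auto
next
  assume "\<exists>Bs. \<exists>\<sigma> \<in> fstates. (\<forall>b \<in> set Bs. good b) \<and> \<not> is_acc \<sigma> \<and> C = (to_nat (Read \<sigma>), cstack Bs, [Bot])"
  then obtain Bs \<sigma> where C: "C = (to_nat (Read \<sigma>), cstack Bs, [Bot])" "\<sigma> \<in> fstates" "\<not> is_acc \<sigma>" "\<forall>b \<in> set Bs. good b"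
    by blast
  then have "initialises N (to_nat (Final \<sigma>)) (cstack Bs)" using initialises_N_cstack by blast
  moreover have "(to_nat (Final \<sigma>), seen (cstack Bs) [], None, to_nat (Read \<sigma>), Push Bot) \<in> trans N"
    using C(2) by (simp add: trans_N_iff seen_def delta'_def)
  ultimately show "entry_config N C" unfolding entry_config_def C(1)
    using step.push[of "to_nat (Final \<sigma>)" "cstack Bs" "[]" None "to_nat (Read \<sigma>)" Bot N]
    by (auto simp: cstack_def)
qed

lemma cstack_simps [simp]: "cstack Bs \<noteq> []" "hd (cstack Bs) = Bot" "last (cstack Bs) = Top"
  "set (cstack Bs) = insert Bot (insert Top (set (concat (map enc Bs))))"
  unfolding cstack_def by auto

lemma enc_not_special: "Bot \<notin> set (enc b)" "Top \<notin> set (enc b)" "Pad \<notin> set (enc b)"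
  by (cases b; auto)+

lemma cstack_tl: "Bot \<notin> set (tl (cstack Bs))" "Top \<notin> set (butlast (cstack Bs))" "Pad \<notin> set (cstack Bs)"
  using enc_not_special by (auto simp: cstack_def butlast_append)

lemma cstack_calph:
  assumes "\<And>b. b \<in> set Bs \<Longrightarrow> good b"
  shows "set (cstack Bs) \<subseteq> calph"
proof -
  have "set (enc b) \<subseteq> calph" if "b \<in> set Bs" for b
  proof -
    obtain j q u where b: "b = (j, q, u)" by (cases b)
    then have "good (j, q, u)" using assms that by simp
    then have j: "j \<in> J" and e: "entry_config (M j) (q, u, [Bot])" using good_iff by auto
    have "set u \<subseteq> check_alph (M j)" "q \<in> states (M j)"
      using entry_config_check_alph[OF special[OF j] e] entry_config_push_alph[OF special[OF j] e] by auto
    then have "cell j q d \<in> calph" if "d \<in> set u" for d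
      using that j unfolding calph_def by (intro UnI2 image_eqI[of _ _ "(j, q, d)"]) auto
    then show ?thesis unfolding b by auto
  qed
  moreover have "Bot \<in> calph" "Top \<in> calph" unfolding calph_def by auto
  ultimately show ?thesis by auto
qed

end

section \<open>Simulation of frame lists\<close>

lemma run_check_stack: "run M C w D \<Longrightarrow> fst (snd D) = fst (snd C)"
  by (induction rule: run.induct) (auto elim!: step.cases)

lemma run_silent1: "step M C None D \<Longrightarrow> run M C [] D"
  by (rule run.silent[OF _ run.refl])

lemma run_read1: "step M C (Some a) D \<Longrightarrow> run M C [a] D"
  by (rule run.read[OF _ run.refl])

lemma seen_Cons: "p \<noteq> [] \<Longrightarrow> seen u p = Some (hd p, u ! (length p - 1))"
  by (simp add: seen_def)

locale product_run = product_machine J M A pr + block_list J M Bs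
  for J :: "nat set" and M :: "nat \<Rightarrow> (nat, 'a, ('a, nat) stack_symbol) cspda"
    and A :: "'l set" and pr :: "'l \<Rightarrow> nat \<times> 'a" and Bs :: "(nat, ('a, nat) stack_symbol) block list"
begin

abbreviation U where "U \<equiv> cstack Bs"

text \<open>The index in the check stack of the bottom cell of block \<open>i\<close>, the
  \<open>Suc\<close> accounting for the initial \<open>Bot\<close>; at \<open>length Bs\<close> it
  is the index of \<open>Top\<close>.\<close>

definition off :: "nat \<Rightarrow> nat" where
  "off i = Suc (length (concat (map enc (take i Bs))))"

abbreviation chk where "chk i \<equiv> snd (snd (Bs ! i))"

lemma length_enc [simp]: "length (enc b) = length (snd (snd b))"
  by (cases b) simp

lemma off_Suc: "i < length Bs \<Longrightarrow> off (Suc i) = off i + length (chk i)"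
  unfolding off_def by (simp add: take_Suc_conv_app_nth)

lemma off_mono: "i \<le> k \<Longrightarrow> off i \<le> off k"
proof -
  assume "i \<le> k"
  then have "take k Bs = take i Bs @ take (k - i) (drop i Bs)" by (metis le_add_diff_inverse take_add)
  then show ?thesis unfolding off_def by simp
qed

lemma length_U: "length U = Suc (off (length Bs))"
  unfolding off_def cstack_def by simp

lemma U_nth:
  assumes "i < length Bs" "k < length (chk i)"
  shows "U ! (off i + k) = cell (fst (Bs ! i)) (fst (snd (Bs ! i))) (chk i ! k)"
proof -
  have "concat (map enc Bs) = concat (map enc (take i Bs)) @ enc (Bs ! i) @ concat (map enc (drop (Suc i) Bs))"
    by (subst id_take_nth_drop[OF assms(1)]) simp
  then have "U ! (off i + k) = enc (Bs ! i) ! k"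
    using assms(2) unfolding cstack_def off_def by (simp add: nth_append)
  then show ?thesis using assms(2) by (cases "Bs ! i") auto
qed

lemma off_locate:
  assumes "1 \<le> h" "h < off n" "n \<le> length Bs"
  shows "\<exists>i k. i < n \<and> k < length (chk i) \<and> h = off i + k"
  using assms(2,3)
proof (induction n)
  case 0
  then show ?case using assms(1) by (simp add: off_def)
next
  case (Suc n)
  show ?case
  proof (cases "h < off n")
    case True
    then show ?thesis using Suc by (meson Suc_leD less_Suc_eq)
  next
    case False
    then show ?thesis using Suc.prems off_Suc[of n]
      by (intro exI[of _ n] exI[of _ "h - off n"]) auto
  qed
qed

lemma off_bound: "i < length Bs \<Longrightarrow> off i + length (chk i) < length U"
  using off_mono[of "Suc i" "length Bs"] off_Suc[of i] length_U by simp

lemma set_U: "set U \<subseteq> calph"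
  using cstack_calph good by blast

lemma block_facts:
  assumes "i < length Bs"
  shows "fst (Bs ! i) \<in> J" "entry_config (M (fst (Bs ! i))) (ent (Bs ! i))"
    "set (chk i) \<subseteq> alph" "chk i \<noteq> []" "last (chk i) = Top"
    "k < length (chk i) \<Longrightarrow> chk i ! k = Bot \<longleftrightarrow> k = 0"
    "ent (Bs ! i) = (fst (snd (Bs ! i)), chk i, [Bot])"
proof -
  obtain j q u where b: "Bs ! i = (j, q, u)" by (cases "Bs ! i")
  show j: "fst (Bs ! i) \<in> J" and e: "entry_config (M (fst (Bs ! i))) (ent (Bs ! i))"
    using good_nth[OF assms] unfolding good_def by auto
  have E: "entry_config (M j) (q, u, [Bot])" and "j \<in> J" using e j b by auto
  note D = entry_configD[OF special[OF \<open>j \<in> J\<close>] E]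
  note S = second_stage_configD[OF special[OF \<open>j \<in> J\<close>] entry_second_stage[OF special[OF \<open>j \<in> J\<close>] E]]
  show "set (chk i) \<subseteq> alph" using S(6) \<open>j \<in> J\<close> b unfolding alph_def by auto
  show "chk i \<noteq> []" "last (chk i) = Top" using D b by auto
  show "chk i ! k = Bot \<longleftrightarrow> k = 0" if "k < length (chk i)"
  proof (cases k)
    case (Suc k')
    then have "u ! k = tl u ! k'" "k' < length (tl u)" using that b by (simp_all add: nth_tl)
    then show ?thesis using S(8) b Suc by (metis fst_conv nat.distinct(1) nth_mem snd_conv)
  qed (use S(7) b that in \<open>simp add: hd_conv_nth\<close>)
  show "ent (Bs ! i) = (fst (snd (Bs ! i)), chk i, [Bot])" using b by simp
qed

lemma reach_config:
  assumes "i < length Bs" "reach n (Bs ! i) C"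
  shows "second_stage_config (M (fst (Bs ! i))) C" "fst (snd C) = chk i" "reading_config (M (fst (Bs ! i))) C"
proof -
  note B = block_facts[OF assms(1)]
  show r: "reading_config (M (fst (Bs ! i))) C" using reading_reach[OF good_nth[OF assms(1)] assms(2)] .
  obtain x where "dels (M (fst (Bs ! i))) (ent (Bs ! i)) x = Some C"
    using assms(2) unfolding reach_def by blast
  then have r: "run (M (fst (Bs ! i))) (ent (Bs ! i)) x C"
    using dels_eq_Some[OF special_M(2,3,1)[OF B(1)] entry_reading[OF special[OF B(1)] B(2)]]
    unfolding after_def by blast
  show "second_stage_config (M (fst (Bs ! i))) C"
    by (rule second_stage_run[OF entry_second_stage[OF special[OF B(1)] B(2)] r])
  show "fst (snd C) = chk i" using run_check_stack[OF r] B(7) by simp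
qed

fun st :: "(nat, ('a, nat) stack_symbol) frame list \<Rightarrow> fstate" where
  "st [] = None"
| "st ((i, C) # fs) = Some (fst (Bs ! i), fst C, debt (st fs))"

text \<open>
  On its way up to block \<open>i\<close> the machine fills the pushdown with copies of the state to be restored.
  The last copy lies at the bottom of the block and plays the role of the symbol \<open>Bot\<close> there.
\<close>

definition stk where
  "stk i p \<sigma> s = map symbol (butlast s) @ replicate (Suc (off i) - length p) (save \<sigma>) @ p"

fun pd :: "(nat, ('a, nat) stack_symbol) frame list \<Rightarrow> ('l, nat) stack_symbol list" where
  "pd [] = [Bot]"
| "pd ((i, C) # fs) = stk i (pd fs) (st fs) (snd (snd C))"

definition cfg :: "(nat, ('a, nat) stack_symbol) frame list \<Rightarrow> (nat, ('l, nat) stack_symbol) config" where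
  "cfg fs = (to_nat (Read (st fs)), U, pd fs)"

text \<open>Alignment of the heads: the top of \<open>s\<close> comes to lie at index
  \<open>off i + length s - 1\<close>, where the check stack holds the cell that encodes the symbol
  seen by the factor machine.\<close>

lemma length_stk: "length p \<le> off i \<Longrightarrow> s \<noteq> [] \<Longrightarrow> length (stk i p \<sigma> s) = off i + length s"
  unfolding stk_def by (cases s) auto

lemma stk_palph:
  assumes "i < length Bs" "second_stage_config (M (fst (Bs ! i))) (q, u, s)" "set p \<subseteq> palph" "\<sigma> \<in> fstates"
  shows "set (stk i p \<sigma> s) \<subseteq> palph"
proof -
  note B = block_facts[OF assms(1)]
  have "set s \<subseteq> push_alph (M (fst (Bs ! i)))" using second_stage_configD(5)[OF special[OF B(1)] assms(2)] .
  then have "symbol ` set (butlast s) \<subseteq> palph" using B(1) in_set_butlastD unfolding palph_def by fastforce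
  moreover have "save \<sigma> \<in> palph" using assms(4) unfolding palph_def by auto
  ultimately show ?thesis using assms(3) unfolding stk_def by auto
qed

lemma seat_facts:
  assumes "seat n i C fs"
  shows "i < length Bs" "lvl fs \<le> i" "reach n (Bs ! i) C"
  using assms first_SomeD unfolding seat_def by blast+

lemma valid_facts:
  assumes "valid n fs"
  shows "length (pd fs) \<le> off (lvl fs) \<and> set (pd fs) \<subseteq> palph \<and> pd fs \<noteq> [] \<and> st fs \<in> fstates \<and> lvl fs \<le> length Bs"
  using assms
proof (induction fs)
  case Nil
  then show ?case by (simp add: off_def palph_def)
next
  case (Cons f fs)
  obtain i q u s where f: "f = (i, (q, u, s))" by (cases f) auto
  have v: "valid n fs" "seat n i (q, u, s) fs" using Cons.prems f by auto
  note S = seat_facts[OF v(2)]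
  note R = reach_config[OF S(1,3)]
  note D = second_stage_configD[OF special[OF block_facts(1)[OF S(1)]] R(1)]
  have IH: "length (pd fs) \<le> off i" "set (pd fs) \<subseteq> palph" "st fs \<in> fstates"
    using Cons.IH[OF v(1)] off_mono[OF S(2)] by auto
  have "length (pd (f # fs)) = off i + length s" unfolding f using length_stk[OF IH(1) D(2)] by simp
  moreover have "length s \<le> length (chk i)" using D(4) R(2) by simp
  moreover have "set (pd (f # fs)) \<subseteq> palph" unfolding f using stk_palph[OF S(1) R(1) IH(2,3)] by simp
  moreover have "pd (f # fs) \<noteq> []" using calculation(1) D(2) by auto
  ultimately show ?case using off_Suc[OF S(1)] block_facts(1)[OF S(1)] D(1) S(1) f by simp
qed

text \<open>\<open>Pad\<close> does not occur on an initialised check stack, so the added loops are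
  out of reach.\<close>

lemma delta'_U:
  assumes "p \<noteq> []" "length p \<le> length U"
  shows "delta' s (seen U p) l = delta s (Some (hd p, U ! (length p - 1))) l"
proof -
  have "U ! (length p - 1) \<in> set U" using assms by (intro nth_mem) (cases p; simp)
  then have "U ! (length p - 1) \<noteq> Pad" using cstack_tl(3) by metis
  then show ?thesis using seen_Cons[OF assms(1)] unfolding delta'_def by auto
qed

lemma seen_stk:
  assumes "i < length Bs" "second_stage_config (M (fst (Bs ! i))) (q, chk i, s)" "length p \<le> off i"
  shows "seen U (stk i p \<sigma> s) = Some (if length s = 1 then save \<sigma> else symbol (hd s),
      cell (fst (Bs ! i)) (fst (snd (Bs ! i))) (chk i ! (length s - 1)))"
proof -
  note D = second_stage_configD[OF special[OF block_facts(1)[OF assms(1)]] assms(2)]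
  obtain k where k: "length s = Suc k" using D(2) by (cases s) auto
  have "length (stk i p \<sigma> s) = off i + length s" using length_stk assms(3) D(2) by blast
  moreover have "hd (stk i p \<sigma> s) = (if length s = 1 then save \<sigma> else symbol (hd s))"
    using D(2) assms(3) unfolding stk_def by (cases s; cases "tl s") (auto simp: Suc_diff_le)
  moreover have "stk i p \<sigma> s \<noteq> []" using calculation(1) D(2) by auto
  ultimately show ?thesis using seen_Cons[of "stk i p \<sigma> s" U] U_nth[OF assms(1), of k] k D(4) by simp
qed

text \<open>The saved copy shows exactly when \<open>s\<close> has length one, and then the factor
  machine sees \<open>Bot\<close> on both of its stacks, as \<open>simulate\<close>
  pretends.\<close>

lemma simulate_stk:
  assumes "i < length Bs" "second_stage_config (M (fst (Bs ! i))) (q, chk i, s)"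
  shows "simulate (fst (Bs ! i)) q f (if length s = 1 then save \<sigma> else symbol (hd s))
      (cell (fst (Bs ! i)) (fst (snd (Bs ! i))) (chk i ! (length s - 1))) l =
    map_option (\<lambda>(r, mv). (Simul (fst (Bs ! i)) r f, map_pd_move symbol mv)) (mstep (fst (Bs ! i)) q (seen (chk i) s) l)"
proof -
  note B = block_facts[OF assms(1)]
  note D = second_stage_configD[OF special[OF B(1)] assms(2)]
  obtain x t where s: "s = x # t" using D(2) by (cases s) auto
  have k: "length s - 1 < length (chk i)" using D(4) s by simp
  then have "chk i ! (length s - 1) \<in> alph" using B(3) nth_mem by blast
  moreover have "x \<in> alph" using D(5) s B(1) unfolding alph_def by auto
  moreover have "chk i ! (length s - 1) = Bot \<longleftrightarrow> t = []" using B(6)[OF k] s by simp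
  moreover have "t = [] \<Longrightarrow> x = Bot" using D(3) s by simp
  ultimately show ?thesis unfolding simulate_def using s by (auto simp: seen_def)
qed

text \<open>Stated for arbitrary \<open>s0\<close> and \<open>l0\<close> because a simulated step
  arises in three ways: from \<open>Read\<close> while the letter is read, from \<open>Up\<close>
  with the letter remembered, and silently from \<open>Simul\<close>. The second claim transfers the
  absence of a step, from which failure of the product machine is derived.\<close>

lemma simulated_step:
  fixes \<sigma> i q s l l0 f
  defines "j \<equiv> fst (Bs ! i)"
  assumes i: "i < length Bs" and C: "second_stage_config (M j) (q, chk i, s)"
    and p: "length p \<le> off i" "set p \<subseteq> palph" "\<sigma> \<in> fstates"
    and s0: "s0 \<in> pstates" "\<And>a. l0 = Some a \<Longrightarrow> a \<in> A"
    and d: "delta' s0 (seen U (stk i p \<sigma> s)) l0 =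
      simulate j q f (if length s = 1 then save \<sigma> else symbol (hd s)) (cell j (fst (snd (Bs ! i))) (chk i ! (length s - 1))) l"
  shows "step (M j) (q, chk i, s) l (q', u', s') \<Longrightarrow>
      u' = chk i \<and> step N (to_nat s0, U, stk i p \<sigma> s) l0 (to_nat (Simul j q' f), U, stk i p \<sigma> s')"
    and "\<nexists>D. step (M j) (q, chk i, s) l D \<Longrightarrow> \<nexists>D. step N (to_nat s0, U, stk i p \<sigma> s) l0 D"
proof -
  note B = block_facts[OF i, folded j_def]
  note D = second_stage_configD[OF special[OF B(1)] C]
  obtain x t where s: "s = x # t" using D(2) by (cases s) auto
  have len: "length (stk i p \<sigma> s) = off i + length s" using length_stk p(1) D(2) by blast
  have dd: "delta' s0 (seen U (stk i p \<sigma> s)) l0 =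
      map_option (\<lambda>(r, mv). (Simul j r f, map_pd_move symbol mv)) (mstep j q (seen (chk i) s) l)"
    using d simulate_stk[OF i] C unfolding j_def by simp
  have iff: "step N (to_nat s0, U, stk i p \<sigma> s) l0 D \<longleftrightarrow> (\<exists>r mv. delta' s0 (seen U (stk i p \<sigma> s)) l0 = Some (r, mv) \<and>
    (case mv of Push x \<Rightarrow> length (stk i p \<sigma> s) < length U \<and> D = (to_nat r, U, x # stk i p \<sigma> s)
     | Pop \<Rightarrow> stk i p \<sigma> s \<noteq> [] \<and> D = (to_nat r, U, tl (stk i p \<sigma> s)) | Stay \<Rightarrow> D = (to_nat r, U, stk i p \<sigma> s)))" for D
    using stk_palph[OF i _ p(2,3)] C off_bound[OF i] D(4) len s0 set_U unfolding j_def
    by (intro step_N_iff) auto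
  {
    assume st: "step (M j) (q, chk i, s) l (q', u', s')"
    have "run (M j) (q, chk i, s) (case l of None \<Rightarrow> [] | Some a \<Rightarrow> [a]) (q', u', s')"
      using st by (cases l) (auto intro: run_silent1 run_read1)
    then have C': "second_stage_config (M j) (q', u', s')" using second_stage_run C by blast
    then have "s' \<noteq> []" using second_stage_configD(2)[OF special[OF B(1)]] by blast
    from st show "u' = chk i \<and> step N (to_nat s0, U, stk i p \<sigma> s) l0 (to_nat (Simul j q' f), U, stk i p \<sigma> s')"
    proof cases
      case (push y)
      then have "mstep j q (seen (chk i) s) l = Some (q', Push y)" using mstep_iff[OF B(1)] by simp
      moreover have "stk i p \<sigma> s' = symbol y # stk i p \<sigma> s" using push D(2) unfolding stk_def by simp
      moreover have "off i + length s < length U" using D(4) off_bound[OF i] by simp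
      ultimately show ?thesis using push dd len unfolding iff by simp
    next
      case (pop y)
      then have "mstep j q (seen (chk i) s) l = Some (q', Pop)" using mstep_iff[OF B(1)] by simp
      moreover have "stk i p \<sigma> s = symbol y # stk i p \<sigma> s'" using pop \<open>s' \<noteq> []\<close> unfolding stk_def by simp
      ultimately show ?thesis using pop dd unfolding iff by simp
    next
      case stay
      then have "mstep j q (seen (chk i) s) l = Some (q', Stay)" using mstep_iff[OF B(1)] by simp
      then show ?thesis using stay dd unfolding iff by simp
    qed
  }
  assume no: "\<nexists>D. step (M j) (q, chk i, s) l D"
  show "\<nexists>D. step N (to_nat s0, U, stk i p \<sigma> s) l0 D"
  proof
    assume "\<exists>D. step N (to_nat s0, U, stk i p \<sigma> s) l0 D"
    then obtain r mv where "mstep j q (seen (chk i) s) l = Some (r, mv)" unfolding iff dd by auto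
    then have t: "(q, seen (chk i) s, l, r, mv) \<in> trans (M j)" using mstep_iff[OF B(1)] by simp
    have "\<exists>D. step (M j) (q, chk i, s) l D"
    proof (cases mv)
      case (Push y)
      \<comment> \<open>The check stack continues above the block, so height alone does not stop the
        product machine from pushing; (P3) of the factor does, as it forbids a push when
        \<open>Top\<close> is seen.\<close>
      have "length s < length (chk i)"
      proof (rule ccontr)
        assume "\<not> length s < length (chk i)"
        then have "chk i ! (length s - 1) = Top" using D(4) B(4,5) by (simp add: last_conv_nth)
        then have "(q, Some (x, Top), l, r, Push y) \<in> trans (M j)"
          using t Push s by (simp add: seen_def)
        then show False using special_M(4)[OF B(1)] unfolding P3_def by blast
      qed
      then show ?thesis using step.push t Push by metis
    next
      case Pop
      then show ?thesis using step.pop t s by metis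
    next
      case Stay
      then show ?thesis using step.stay t by metis
    qed
    then show False using no by blast
  qed
qed

end

section \<open>Reading one letter on the product machine\<close>

context product_run
begin

text \<open>Tells \<open>Back\<close> where to stop. When the top frame is down to its bottom entry,
  the symbol there saves the state of the list below, whose top frame has a different factor or does
  not exist.\<close>

lemma hd_pd:
  assumes "valid n fs"
  shows "hd (pd fs) \<noteq> save (st fs)"
proof (cases fs)
  case (Cons f fs')
  obtain i q u s where f: "f = (i, (q, u, s))" by (cases f) auto
  have v: "valid n fs'" "seat n i (q, u, s) fs'" using assms Cons f by auto
  note S = seat_facts[OF v(2)]
  note R = reach_config[OF S(1,3)]
  have "length (pd fs') \<le> off i" using valid_facts[OF v(1)] off_mono[OF S(2)] by auto
  moreover have "pd fs \<noteq> []" using valid_facts[OF assms] by blast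
  ultimately have "hd (pd fs) = (if length s = 1 then save (st fs') else symbol (hd s))"
    using seen_stk[OF S(1), of q s "pd fs'" "st fs'"] R(1,2) seen_Cons[of "pd fs" U] Cons f by auto
  moreover have "st fs' \<noteq> st fs"
  proof (cases fs')
    case (Cons g fs'')
    then show ?thesis using v(2) \<open>fs = f # fs'\<close> f unfolding seat_def by (cases g) auto
  qed (simp add: Cons f)
  ultimately show ?thesis by auto
qed simp

lemma length_pd_U:
  assumes "valid n fs"
  shows "length (pd fs) < length U"
  using valid_facts[OF assms] off_mono[of "lvl fs" "length Bs"] length_U by simp

lemma back_run:
  assumes "valid n fs" "length (replicate k (save (st fs)) @ pd fs) \<le> length U"
  shows "run N (to_nat (Back (st fs)), U, replicate k (save (st fs)) @ pd fs) [] (cfg fs)"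
  using assms(2)
proof (induction k)
  case 0
  note V = valid_facts[OF assms(1)]
  have "delta' (Back (st fs)) (seen U (pd fs)) None = Some (Read (st fs), Stay)"
    using delta'_U[of "pd fs"] hd_pd[OF assms(1)] length_pd_U[OF assms(1)] V by simp
  then have "step N (to_nat (Back (st fs)), U, pd fs) None (cfg fs)"
    using V length_pd_U[OF assms(1)] set_U unfolding cfg_def by (subst step_N_iff) auto
  then show ?case using run_silent1 by simp
next
  case (Suc k)
  let ?p = "replicate (Suc k) (save (st fs)) @ pd fs"
  note V = valid_facts[OF assms(1)]
  have "delta' (Back (st fs)) (seen U ?p) None = Some (Back (st fs), Pop)"
    using delta'_U[of ?p] Suc.prems by simp
  moreover have "set ?p \<subseteq> palph" using V unfolding palph_def by auto
  ultimately have "step N (to_nat (Back (st fs)), U, ?p) None (to_nat (Back (st fs)), U, replicate k (save (st fs)) @ pd fs)"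
    using V Suc.prems set_U by (subst step_N_iff) auto
  then show ?case using Suc by (auto intro: run.silent)
qed

lemma stk_le_U:
  assumes "i < length Bs" "second_stage_config (M (fst (Bs ! i))) (q, chk i, s)" "length p \<le> off i"
  shows "length (stk i p \<sigma> s) < length U" "stk i p \<sigma> s \<noteq> []"
proof -
  note D = second_stage_configD[OF special[OF block_facts(1)[OF assms(1)]] assms(2)]
  show "length (stk i p \<sigma> s) < length U"
    using length_stk[OF assms(3) D(2)] D(4) off_bound[OF assms(1)] by simp
  show "stk i p \<sigma> s \<noteq> []" using length_stk[OF assms(3) D(2), of \<sigma>] D(2) by auto
qed

text \<open>The return to the entry configuration is recognised at the bottom cell by the entry
  state stored there, and the saved copy lying on it supplies the state for
  \<open>Back\<close>.\<close>

lemma finish_run: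
  assumes "valid n fs" "seat n i C fs" "C = (q, chk i, s)"
  shows "run N (to_nat (Simul (fst (Bs ! i)) q (debt (st fs))), U, stk i (pd fs) (st fs) s) [] (cfg (unfocus Bs i C fs))"
proof -
  let ?j = "fst (Bs ! i)" and ?P = "stk i (pd fs) (st fs) s"
  note S = seat_facts[OF assms(2)]
  note B = block_facts[OF S(1)]
  note R = reach_config[OF S(1,3)]
  have C: "second_stage_config (M ?j) (q, chk i, s)" "reading_state (M ?j) q"
    using R assms(3) unfolding reading_config_def by auto
  note D = second_stage_configD[OF special[OF B(1)] C(1)]
  note V = valid_facts[OF assms(1)]
  have lp: "length (pd fs) \<le> off i" using V off_mono[OF S(2)] by simp
  note L = stk_le_U[OF S(1) C(1) lp, of "st fs"]
  note se = seen_stk[OF S(1) C(1) lp, of "st fs"]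
  have k: "length s - 1 < length (chk i)" using D(2,4) by (cases s) auto
  then have al: "chk i ! (length s - 1) \<in> alph" using B(3) nth_mem by blast
  have bot: "chk i ! (length s - 1) = Bot \<longleftrightarrow> length s = 1"
    using B(6)[OF k] D(2) by (cases s) auto
  have ent: "C = ent (Bs ! i) \<longleftrightarrow> q = fst (snd (Bs ! i)) \<and> length s = 1"
    unfolding B(7) assms(3) using D(2,3) by (cases s) auto
  have P: "set ?P \<subseteq> palph" using stk_palph[OF S(1) C(1)] V by blast
  have d: "delta' (Simul ?j q (debt (st fs))) (seen U ?P) None =
      (if C = ent (Bs ! i) then Some (Back (st fs), Pop) else Some (Read (Some (?j, q, debt (st fs))), Stay))"
    using se C(2) al bot unfolding delta'_def ent by auto
  have iff: "step N (to_nat (Simul ?j q (debt (st fs))), U, ?P) None D \<longleftrightarrow>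
    (if C = ent (Bs ! i) then D = (to_nat (Back (st fs)), U, tl ?P)
     else D = (to_nat (Read (Some (?j, q, debt (st fs)))), U, ?P))" for D
    using L P D(1) B(1) set_U by (subst step_N_iff) (auto simp: d)
  show ?thesis
  proof (cases "C = ent (Bs ! i)")
    case True
    have "tl ?P = replicate (off i - length (pd fs)) (save (st fs)) @ pd fs"
      using True ent lp unfolding stk_def by (cases s) (auto simp: Suc_diff_le)
    then have "step N (to_nat (Simul ?j q (debt (st fs))), U, ?P) None
        (to_nat (Back (st fs)), U, replicate (off i - length (pd fs)) (save (st fs)) @ pd fs)"
      using True iff by simp
    moreover have "off i < length U" using off_bound[OF S(1)] by simp
    then have "run N (to_nat (Back (st fs)), U, replicate (off i - length (pd fs)) (save (st fs)) @ pd fs) [] (cfg fs)"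
      using lp by (intro back_run[OF assms(1)]) simp
    ultimately show ?thesis using True unfolding unfocus_def by (auto intro: run.silent)
  next
    case False
    then have "step N (to_nat (Simul ?j q (debt (st fs))), U, ?P) None (cfg (unfocus Bs i C fs))"
      using iff assms(3) unfolding unfocus_def cfg_def by simp
    then show ?thesis by (rule run_silent1)
  qed
qed

text \<open>A cell showing \<open>Bot\<close> is the bottom of a block. Above the head this block is
  at or beyond \<open>lvl fs\<close>, as the rest of the block of the top frame has no further
  bottom cell, and there the factor \<open>j\<close> does not occur below \<open>i\<close>.\<close>

lemma passable:
  assumes "valid n fs" "i \<le> length Bs" "\<And>l. lvl fs \<le> l \<Longrightarrow> l < i \<Longrightarrow> fst (Bs ! l) \<noteq> j"
    "length (pd fs) \<le> h" "h < off i"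
  shows "\<exists>j' q c. uncell (U ! h) = Some (j', q, c) \<and> \<not> (j' = j \<and> c = Bot)"
proof -
  have "1 \<le> h" using valid_facts[OF assms(1)] assms(4) by (cases "pd fs") auto
  from off_locate[OF this assms(5,2)] obtain i' k where h: "i' < i" "k < length (chk i')" "h = off i' + k" by blast
  then have i': "i' < length Bs" using assms(2) by simp
  note B = block_facts[OF i']
  have "chk i' ! k \<in> alph" using B(3) h(2) nth_mem by blast
  then have u: "uncell (U ! h) = Some (fst (Bs ! i'), fst (snd (Bs ! i')), chk i' ! k)"
    using U_nth[OF i' h(2)] h(3) by simp
  have "fst (Bs ! i') \<noteq> j" if "chk i' ! k = Bot"
  proof (rule assms(3)[OF _ h(1)])
    have hk: "h = off i'" using B(6)[OF h(2)] that h(3) by simp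
    show "lvl fs \<le> i'"
    proof (cases fs)
      case (Cons f fs')
      obtain t q u s where f: "f = (t, (q, u, s))" by (cases f) auto
      have v: "valid n fs'" "seat n t (q, u, s) fs'" using assms(1) Cons f by auto
      note S = seat_facts[OF v(2)]
      note R = reach_config[OF S(1,3)]
      note D = second_stage_configD[OF special[OF block_facts(1)[OF S(1)]] R(1)]
      have "length (pd fs') \<le> off t" using valid_facts[OF v(1)] off_mono[OF S(2)] by simp
      then have "length (pd fs) = off t + length s" using length_stk[OF _ D(2)] Cons f by simp
      then have "off t < off i'" using assms(4) hk D(2) by (cases s) auto
      then have "\<not> i' \<le> t" using off_mono[of i' t] by auto
      then show ?thesis using Cons f by simp
    qed simp
  qed
  then show ?thesis using u by blast
qed

lemma up_run:
  assumes "valid n fs" "l \<in> A" "fs \<noteq> [] \<Longrightarrow> fst (Bs ! fst (hd fs)) \<noteq> fst (pr l)"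
    and "length (pd fs) + k < length U"
    and "\<And>h. length (pd fs) \<le> h \<Longrightarrow> h < length (pd fs) + k \<Longrightarrow>
      \<exists>j' q c. uncell (U ! h) = Some (j', q, c) \<and> \<not> (j' = fst (pr l) \<and> c = Bot)"
  shows "run N (cfg fs) [l] (to_nat (Up (st fs) (lcode l)), U, replicate (Suc k) (save (st fs)) @ pd fs)"
  using assms(4,5)
proof (induction k)
  case 0
  note V = valid_facts[OF assms(1)]
  have "delta' (Read (st fs)) (seen U (pd fs)) (Some l) = Some (Up (st fs) (lcode l), Push (save (st fs)))"
  proof (cases fs)
    case Nil
    then show ?thesis using delta'_U[of "pd fs" "Read (st fs)"] by (simp add: cstack_def)
  next
    case (Cons f fs')
    obtain i q u s where f: "f = (i, (q, u, s))" by (cases f) auto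
    have v: "valid n fs'" "seat n i (q, u, s) fs'" using assms(1) Cons f by auto
    note S = seat_facts[OF v(2)]
    note B = block_facts[OF S(1)]
    have C: "second_stage_config (M (fst (Bs ! i))) (q, chk i, s)" "u = chk i" using reach_config[OF S(1,3)] by auto
    note D = second_stage_configD[OF special[OF B(1)] C(1)]
    have lp: "length (pd fs') \<le> off i" using valid_facts[OF v(1)] off_mono[OF S(2)] by simp
    have "chk i ! (length s - 1) \<in> alph" using B(3) D(2,4) by (cases s) (auto simp: subset_iff)
    then show ?thesis using seen_stk[OF S(1) C(1) lp, of "st fs'"] assms(3) Cons f
      by (simp add: delta'_def)
  qed
  then have "step N (cfg fs) (Some l) (to_nat (Up (st fs) (lcode l)), U, save (st fs) # pd fs)"
    using V length_pd_U[OF assms(1)] set_U assms(2) unfolding cfg_def by (subst step_N_iff) auto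
  then show ?case using run_read1 by simp
next
  case (Suc k)
  note V = valid_facts[OF assms(1)]
  let ?p = "replicate (Suc k) (save (st fs)) @ pd fs"
  have r: "run N (cfg fs) [l] (to_nat (Up (st fs) (lcode l)), U, ?p)" using Suc by simp
  obtain j' q c where u: "uncell (U ! (length (pd fs) + k)) = Some (j', q, c)" "\<not> (j' = fst (pr l) \<and> c = Bot)"
    using Suc.prems(2)[of "length (pd fs) + k"] by auto
  have "length ?p - 1 = length (pd fs) + k" by simp
  then have "delta' (Up (st fs) (lcode l)) (seen U ?p) None = Some (Up (st fs) (lcode l), Push (save (st fs)))"
    using delta'_U[of ?p "Up (st fs) (lcode l)"] Suc.prems(1) u ldecode_lcode[OF assms(2)] by (auto simp: add.commute)
  moreover have "set ?p \<subseteq> palph" using V unfolding palph_def by auto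
  ultimately have "step N (to_nat (Up (st fs) (lcode l)), U, ?p) None (to_nat (Up (st fs) (lcode l)), U, save (st fs) # ?p)"
    using V Suc.prems(1) set_U assms(2) by (subst step_N_iff) auto
  then show ?case using run_append[OF r run_silent1] by simp
qed

text \<open>A configuration with a silent move is not a reading one, so \<open>Simul\<close> goes on
  simulating instead of finishing.\<close>

lemma simul_run:
  assumes "run (M j) C w D" "w = []" "C = (q, chk i, s)" "i < length Bs" "j = fst (Bs ! i)"
    "second_stage_config (M j) C" "length p \<le> off i" "set p \<subseteq> palph" "\<sigma> \<in> fstates"
  shows "run N (to_nat (Simul j q f), U, stk i p \<sigma> s) [] (to_nat (Simul j (fst D) f), U, stk i p \<sigma> (snd (snd D)))"
  using assms(1-3,6)
proof (induction arbitrary: q s rule: run.induct)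
  case (refl C)
  then show ?case by (simp add: run.refl)
next
  case (silent C D w E)
  obtain q' u' s' where D: "D = (q', u', s')" by (cases D)
  have nr: "\<not> reading_state (M j) q"
    using reading_no_silent[of "M j" C D] silent.hyps(1) silent.prems unfolding reading_config_def by auto
  have C: "second_stage_config (M (fst (Bs ! i))) (q, chk i, s)" using silent.prems assms(5) by simp
  note B = block_facts[OF assms(4)]
  note S = second_stage_configD[OF special[OF B(1)] C]
  have "chk i ! (length s - 1) \<in> alph" using B(3) S(2,4) by (cases s) (auto simp: subset_iff)
  then have "delta' (Simul j q f) (seen U (stk i p \<sigma> s)) None = simulate j q f (if length s = 1 then save \<sigma> else symbol (hd s))
      (cell j (fst (snd (Bs ! i))) (chk i ! (length s - 1))) None"
    using seen_stk[OF assms(4) C assms(7), of \<sigma>] nr assms(5) by (auto simp: delta'_def)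
  then have st: "u' = chk i \<and> step N (to_nat (Simul j q f), U, stk i p \<sigma> s) None (to_nat (Simul j q' f), U, stk i p \<sigma> s')"
    using simulated_step(1)[OF assms(4) C assms(7,8,9), of "Simul j q f" None f None q' u' s'] assms(5) S(1) B(1)
      silent.hyps(1) silent.prems(2) D by auto
  have "second_stage_config (M j) D" using second_stage_run[OF silent.prems(3) run_silent1[OF silent.hyps(1)]] .
  then show ?case using run.silent[OF conjunct2[OF st]] silent.IH[of q' s'] silent.prems(1) D st by simp
qed simp

text \<open>An undefined step of the frame list must become a visible halt: the letter is not read
  at all, or finitely many moves lead to a non-reading configuration without silent moves. Both
  \<open>del_cfg\<close> and \<open>no_silent_chain\<close> rely on this form.\<close>

lemma letter_run:
  assumes v: "valid n fs" and l: "l \<in> A"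
  shows "case nstep Bs fs (pr l) of Some fs' \<Rightarrow> run N (cfg fs) [l] (cfg fs')
    | None \<Rightarrow> (\<nexists>D. step N (cfg fs) (Some l) D) \<or>
        (\<exists>T. run N (cfg fs) [l] T \<and> \<not> reading_config N T \<and> (\<nexists>D. step N T None D))"
proof -
  define j a where "j = fst (pr l)" and "a = snd (pr l)"
  have ja: "j \<in> J" "a \<in> in_alph (M j)" using pr_letters[OF l] unfolding j_def a_def letters_def by auto
  note V = valid_facts[OF v]
  have up_pstate: "Up (st fs) (lcode l) \<in> pstates" using V l by simp
  show ?thesis
  proof (cases "focus Bs fs j")
    case None
    then have top: "fs \<noteq> [] \<Longrightarrow> fst (Bs ! fst (hd fs)) \<noteq> j" and fi: "first Bs (lvl fs) j = None"
      unfolding focus_def by (auto split: if_splits)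
    have nb: "fst (Bs ! i) \<noteq> j" if "lvl fs \<le> i" "i < length Bs" for i
      using first_ex[OF that, of j] fi by auto
    \<comment> \<open>Without a suitable block the climb ends level with \<open>Top\<close>, where
      \<open>Up\<close> has no transition.\<close>
    let ?k = "off (length Bs) - length (pd fs)"
    let ?p = "replicate (Suc ?k) (save (st fs)) @ pd fs"
    have le: "length (pd fs) \<le> off (length Bs)" using length_pd_U[OF v] length_U by simp
    have r: "run N (cfg fs) [l] (to_nat (Up (st fs) (lcode l)), U, ?p)"
      using passable[OF v order_refl nb] le length_U top l v unfolding j_def by (intro up_run) auto
    have "U ! (length ?p - 1) = Top"
      using le length_U last_conv_nth[of U] by simp
    then have "delta' (Up (st fs) (lcode l)) (seen U ?p) None = None"
      using delta'_U[of ?p] le length_U by simp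
    moreover have "set ?p \<subseteq> palph" using V unfolding palph_def by auto
    ultimately have "\<nexists>D. step N (to_nat (Up (st fs) (lcode l)), U, ?p) None D"
      using up_pstate le length_U set_U by (subst step_N_iff) auto
    moreover have "\<not> reading_config N (to_nat (Up (st fs) (lcode l)), U, ?p)"
      unfolding reading_config_def using reading_state_N_iff[OF up_pstate] by simp
    ultimately have "\<exists>T. run N (cfg fs) [l] T \<and> \<not> reading_config N T \<and> (\<nexists>D. step N T None D)"
      using r by blast
    moreover have "nstep Bs fs (pr l) = None" using None unfolding nstep_def j_def by simp
    ultimately show ?thesis by (simp del: not_ex)
  next
    case (Some f)
    obtain i q u s fs0 where f: "focus Bs fs j = Some (i, (q, u, s), fs0)" using Some by (cases f) auto
    note F = focus_SomeD[OF v f]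
    note S = seat_facts[OF F(4)]
    note B = block_facts[OF S(1)]
    have C: "second_stage_config (M j) (q, chk i, s)" "u = chk i" "reading_config (M j) (q, chk i, s)"
      using reach_config[OF S(1,3)] F(2) by auto
    have C': "second_stage_config (M (fst (Bs ! i))) (q, chk i, s)" using C(1) F(2) by simp
    note D = second_stage_configD[OF special[OF ja(1)] C(1)]
    note V0 = valid_facts[OF F(3)]
    have lp: "length (pd fs0) \<le> off i" using V0 off_mono[OF S(2)] by simp
    let ?P = "stk i (pd fs0) (st fs0)" and ?f = "debt (st fs0)"
    have al: "chk i ! (length s - 1) \<in> alph" using B(3) D(2,4) by (cases s) (auto simp: subset_iff)
    note se = seen_stk[OF S(1) C' lp, of "st fs0"]
    have nst: "nstep Bs fs (pr l) = map_option (\<lambda>C'. unfocus Bs i C' fs0) (del (M j) (q, chk i, s) a)"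
      using f C(2) unfolding nstep_def j_def a_def by simp
    \<comment> \<open>A common form for both ways of starting: with \<open>w0 = []\<close> the top
      frame is used and the letter is still to be read; with \<open>w0 = [l]\<close> the letter was
      read at the start of the climb.\<close>
    obtain s0 l0 w0 where s0: "s0 \<in> pstates"
      and r0: "run N (cfg fs) w0 (to_nat s0, U, ?P s)"
      and l0: "w0 = [] \<and> l0 = Some l \<and> (to_nat s0, U, ?P s) = cfg fs \<or> w0 = [l] \<and> l0 = None \<and> \<not> is_read s0"
      and d: "delta' s0 (seen U (?P s)) l0 = simulate j q ?f (if length s = 1 then save (st fs0) else symbol (hd s))
        (cell j (fst (snd (Bs ! i))) (chk i ! (length s - 1))) (Some a)"
    proof (cases "fs \<noteq> [] \<and> fst (Bs ! fst (hd fs)) = j")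
      case True
      then have fs: "fs = (i, (q, u, s)) # fs0" using f unfolding focus_def by (cases fs) auto
      let ?s0 = "Read (Some (j, q, ?f))"
      have "delta' ?s0 (seen U (?P s)) (Some l) = simulate j q ?f (if length s = 1 then save (st fs0) else symbol (hd s))
        (cell j (fst (snd (Bs ! i))) (chk i ! (length s - 1))) (Some a)"
        using se al F(2) by (auto simp: delta'_def j_def a_def)
      moreover have "(to_nat ?s0, U, ?P s) = cfg fs" using F(2) unfolding fs cfg_def by simp
      moreover have "?s0 \<in> pstates" using ja(1) D(1) by simp
      ultimately show thesis using that[of ?s0 "[]" "Some l"] run.refl[of N "cfg fs"] by auto
    next
      case False
      then have fs: "fs0 = fs" "(q, u, s) = ent (Bs ! i)" "first Bs (lvl fs) j = Some i"
        using f unfolding focus_def by auto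
      note fi = first_SomeD[OF fs(3)]
      have qs: "q = fst (snd (Bs ! i))" "s = [Bot]" using fs(2) B(7) by auto
      let ?s0 = "Up (st fs) (lcode l)" and ?k = "off i - length (pd fs)"
      have P: "?P s = replicate (Suc ?k) (save (st fs)) @ pd fs"
        using lp unfolding qs(2) fs(1) stk_def by (simp add: Suc_diff_le)
      have "off i < length U" using off_bound[OF S(1)] by simp
      then have r: "run N (cfg fs) [l] (to_nat ?s0, U, ?P s)"
        unfolding P using passable[OF v less_imp_le[OF S(1)] fi(4)] lp False l v fs(1) unfolding j_def
        by (intro up_run) auto
      have "chk i ! 0 = Bot" using B(6)[of 0] B(4) by simp
      then have "delta' ?s0 (seen U (?P s)) None = simulate j q ?f (if length s = 1 then save (st fs0) else symbol (hd s))
        (cell j (fst (snd (Bs ! i))) (chk i ! (length s - 1))) (Some a)"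
        using se al F(2) ldecode_lcode[OF l] unfolding qs fs(1) by (auto simp: delta'_def j_def a_def)
      then show thesis using that[of ?s0 "[l]" None] r up_pstate by auto
    qed
    note sim = simulated_step[OF S(1) C' lp, of "st fs0" s0 l0 ?f "Some a"]
    have l0A: "\<And>b. l0 = Some b \<Longrightarrow> b \<in> A" using l0 l by auto
    show ?thesis
    proof (cases "\<exists>D. step (M j) (q, chk i, s) (Some a) D")
      case False
      then have no: "\<nexists>D. step N (to_nat s0, U, ?P s) l0 D"
        using sim(2) F(2) V0 s0 l0A d by auto
      have "del (M j) (q, chk i, s) a = None"
      proof (rule ccontr)
        assume "del (M j) (q, chk i, s) a \<noteq> None"
        then obtain D where "run (M j) (q, chk i, s) [a] D"
          using del_eq_Some[OF special_M(3)[OF ja(1)]] unfolding after_def by blast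
        from run_Cons_split[OF this] show False
          using False run_from_reading[OF C(3)] by blast
      qed
      then have "nstep Bs fs (pr l) = None" using nst by simp
      moreover have "\<not> reading_config N (to_nat s0, U, ?P s)" if "\<not> is_read s0"
        unfolding reading_config_def using reading_state_N_iff[OF s0] that by simp
      moreover have "(\<nexists>D. step N (cfg fs) (Some l) D) \<or>
        (\<exists>T. run N (cfg fs) [l] T \<and> \<not> reading_config N T \<and> (\<nexists>D. step N T None D))"
        using l0
      proof (elim disjE conjE)
        assume "l0 = Some l" "(to_nat s0, U, ?P s) = cfg fs"
        then show ?thesis using no by simp
      next
        assume "w0 = [l]" "l0 = None" "\<not> is_read s0"
        then show ?thesis using no r0 calculation(2) by blast
      qed
      ultimately show ?thesis by (simp del: not_ex)
    next
      case True
      then obtain q1 u1 s1 where st1: "step (M j) (q, chk i, s) (Some a) (q1, u1, s1)" by (metis prod_cases3)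
      have n1: "u1 = chk i" "step N (to_nat s0, U, ?P s) l0 (to_nat (Simul j q1 ?f), U, ?P s1)"
        using sim(1)[of q1 u1 s1] F(2) V0 s0 l0A d st1 by auto
      have D1: "second_stage_config (M j) (q1, chk i, s1)"
        using second_stage_run[OF C(1) run_read1[OF st1]] n1(1) by simp
      obtain T where T: "run (M j) (q1, chk i, s1) [] T" "\<nexists>E. step (M j) T None E"
        using silent_normal[OF special_M(5)[OF ja(1)] D1] by blast
      obtain q2 s2 where T2: "T = (q2, chk i, s2)"
        using run_check_stack[OF T(1)] by (cases T) auto
      have rT: "run (M j) (q, chk i, s) [a] T" using st1 T(1) n1(1) by (auto intro: run.read)
      have "run N (to_nat (Simul j q1 ?f), U, ?P s1) [] (to_nat (Simul j q2 ?f), U, ?P s2)"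
        using simul_run[OF T(1) _ HOL.refl S(1) F(2)[symmetric] D1 lp] V0 T2 by simp
      then have "run N (to_nat s0, U, ?P s) (case l0 of None \<Rightarrow> [] | Some b \<Rightarrow> [b]) (to_nat (Simul j q2 ?f), U, ?P s2)"
        using n1(2) by (cases l0) (auto intro: run.intros)
      then have rS: "run N (cfg fs) [l] (to_nat (Simul j q2 ?f), U, ?P s2)"
        using run_append[OF r0] l0 by fastforce
      have T3: "second_stage_config (M j) (q2, chk i, s2)"
        using second_stage_run[OF C(1) rT] T2 by simp
      note DT = second_stage_configD[OF special[OF ja(1)] T3]
      have ps: "Simul j q2 ?f \<in> pstates" using ja(1) DT(1) by simp
      show ?thesis
      proof (cases "reading_state (M j) q2")
        case True
        then have dl: "del (M j) (q, chk i, s) a = Some T"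
          using del_eq_Some[OF special_M(3)[OF ja(1)]] rT T2 unfolding after_def reading_config_def by simp
        have "seat (n + length [a]) i T fs0"
          using F(2,4) C(2) ja(2) dl by (intro seat_dels[of n i "(q, chk i, s)"]) auto
        then have "run N (to_nat (Simul j q2 ?f), U, ?P s2) [] (cfg (unfocus Bs i T fs0))"
          using finish_run[of "Suc n" fs0 i T q2 s2] valid_mono[OF F(3)] T2 F(2) by simp
        then show ?thesis using nst dl run_append[OF rS] by auto
      next
        case False
        have al2: "chk i ! (length s2 - 1) \<in> alph" using B(3) DT(2,4) by (cases s2) (auto simp: subset_iff)
        have T3': "second_stage_config (M (fst (Bs ! i))) (q2, chk i, s2)" using T3 F(2) by simp
        have "delta' (Simul j q2 ?f) (seen U (?P s2)) None = simulate j q2 ?f (if length s2 = 1 then save (st fs0) else symbol (hd s2))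
          (cell j (fst (snd (Bs ! i))) (chk i ! (length s2 - 1))) None"
          using seen_stk[OF S(1) T3' lp, of "st fs0"] False F(2) al2 by (auto simp: delta'_def)
        then have no: "\<nexists>D. step N (to_nat (Simul j q2 ?f), U, ?P s2) None D"
          using simulated_step(2)[OF S(1) T3' lp, of "st fs0" "Simul j q2 ?f" None ?f None] F(2) V0 ps T(2) T2
          by auto
        moreover have "\<not> reading_config N (to_nat (Simul j q2 ?f), U, ?P s2)"
          unfolding reading_config_def using reading_state_N_iff[OF ps] by simp
        \<comment> \<open>By determinism a reading configuration reached on \<open>a\<close> would
          have to be \<open>T\<close>, which is not reading.\<close>
        moreover have "del (M j) (q, chk i, s) a = None"
        proof (rule ccontr)
          assume "del (M j) (q, chk i, s) a \<noteq> None"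
          then obtain D where D: "run (M j) (q, chk i, s) [a] D" "reading_config (M j) D"
            using del_eq_Some[OF special_M(3)[OF ja(1)]] unfolding after_def by blast
          have "run (M j) T [] D \<or> run (M j) D [] T"
            using run_linear[OF special_M(3)[OF ja(1)] rT, of "[]" D] D(1) by auto
          then have "T = D"
          proof
            assume "run (M j) T [] D"
            then show ?thesis using T(2) by cases auto
          qed (use run_from_reading[OF D(2)] in blast)
          then show False using D(2) False T2 unfolding reading_config_def by auto
        qed
        moreover from this have "nstep Bs fs (pr l) = None" using nst by simp
        moreover have "\<exists>T. run N (cfg fs) [l] T \<and> \<not> reading_config N T \<and> (\<nexists>D. step N T None D)"
          using rS calculation(1,2) by blast
        ultimately show ?thesis by (simp del: not_ex)
      qed
    qed
  qed
qed

end

text \<open>Determinism keeps every finite silent run from the start of the chain on the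
  chain.\<close>

lemma silent_chain:
  assumes "P2 M" "run M C [] D" "c 0 = C" "\<And>n::nat. step M (c n) None (c (Suc n))"
  shows "\<exists>E. step M D None E"
proof -
  have "\<exists>n. c n = D" if "run M C w D" "w = []" "c k = C" for k w C
    using that
  proof (induction arbitrary: k rule: run.induct)
    case (silent C D w E)
    then have "c (Suc k) = D" using step_deterministic[OF assms(1), of C None D] assms(4)[of k] by metis
    then show ?case using silent.IH silent.prems(1) by blast
  qed auto
  then obtain n where "c n = D" using assms(2,3) by blast
  then show ?thesis using assms(4) by blast
qed

section \<open>From single letters to whole inputs\<close>

context product_run
begin

lemma reading_cfg: "valid n fs \<Longrightarrow> reading_config N (cfg fs)"
  using reading_state_N_iff[of "Read (st fs)"] valid_facts unfolding cfg_def reading_config_def by auto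

lemma del_cfg:
  assumes "valid n fs" "l \<in> A"
  shows "del N (cfg fs) l = map_option cfg (nstep Bs fs (pr l))"
proof (cases "nstep Bs fs (pr l)")
  case (Some fs')
  then have "run N (cfg fs) [l] (cfg fs')" using letter_run[OF assms] by simp
  moreover have "valid (Suc n) fs'" using valid_nstep[OF assms(1) pr_letters[OF assms(2)] Some] .
  ultimately show ?thesis using del_eq_Some[OF P2_N] reading_cfg Some unfolding after_def by simp
next
  case None
  note L = letter_run[OF assms, unfolded None option.case]
  have "\<not> after N (cfg fs) [l] D" for D
  proof
    assume "after N (cfg fs) [l] D"
    then have D: "run N (cfg fs) [l] D" "reading_config N D" unfolding after_def by auto
    from run_Cons_split[OF D(1)] obtain Y where "step N (cfg fs) (Some l) Y"
      using run_from_reading[OF reading_cfg[OF assms(1)]] by blast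
    then obtain T where T: "run N (cfg fs) [l] T" "\<not> reading_config N T" "\<nexists>E. step N T None E"
      using L by blast
    have "run N T [] D \<or> run N D [] T"
      using run_linear[OF P2_N T(1), of "[]" D] D(1) by auto
    then have "T = D"
    proof
      assume "run N T [] D"
      then show ?thesis using T(3) by cases auto
    qed (use run_from_reading[OF D(2)] in blast)
    then show False using D(2) T(2) by simp
  qed
  then have "del N (cfg fs) l = None" unfolding del_def by simp
  then show ?thesis using None by simp
qed

lemma dels_cfg:
  assumes "valid n fs" "w \<in> lists A"
  shows "dels N (cfg fs) w = map_option cfg (iter (nstep Bs) fs (map pr w))"
  using assms
proof (induction w arbitrary: n fs)
  case (Cons l w)
  show ?case
  proof (cases "nstep Bs fs (pr l)")
    case (Some fs')
    moreover have "pr l \<in> letters" using pr_letters Cons.prems(2) by simp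
    ultimately have "valid (Suc n) fs'" using valid_nstep[OF Cons.prems(1)] by blast
    then show ?thesis using Cons.IH Cons.prems(2) del_cfg[OF Cons.prems(1)] Some by simp
  qed (use Cons.prems del_cfg in simp)
qed simp

text \<open>Each letter leads to a configuration without silent moves. A chain that starts before
  this point would have to pass through it; a later start falls to the induction hypothesis, or is
  impossible if the machine is stuck there.\<close>

lemma no_silent_chain:
  assumes "valid n fs" "run N (cfg fs) w (c 0)" "\<And>n::nat. step N (c n) None (c (Suc n))" "w \<in> lists A"
  shows False
  using assms(1,2,4)
proof (induction w arbitrary: n fs)
  case Nil
  then have "c 0 = cfg fs" using run_from_reading reading_cfg by blast
  then show ?case using assms(3)[of 0] reading_no_silent[OF reading_cfg[OF Nil.prems(1)]] by metis
next
  case (Cons l w)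
  have l: "l \<in> A" using Cons.prems(3) by simp
  note L = letter_run[OF Cons.prems(1) l]
  have stop: False if "run N (cfg fs) [l] T" "\<nexists>E. step N T None E" "run N T w (c 0) \<Longrightarrow> False" for T
    using run_linear[OF P2_N that(1), of w "c 0"] Cons.prems(2) that(2,3) silent_chain[OF P2_N, of "c 0" T c] assms(3)
    by auto
  show ?case
  proof (cases "nstep Bs fs (pr l)")
    case (Some fs')
    then have v: "valid (Suc n) fs'" using valid_nstep[OF Cons.prems(1) pr_letters[OF l]] by blast
    have "run N (cfg fs) [l] (cfg fs')" using L Some by simp
    then show ?thesis
      using stop[of "cfg fs'"] Cons.IH[OF v] Cons.prems(3) reading_no_silent[OF reading_cfg[OF v]] by auto
  next
    case None
    note L = L[unfolded None option.case]
    from run_Cons_split[OF Cons.prems(2)] obtain Y where "step N (cfg fs) (Some l) Y"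
      using run_from_reading[OF reading_cfg[OF Cons.prems(1)]] by blast
    then obtain T where T: "run N (cfg fs) [l] T" "\<not> reading_config N T" "\<nexists>E. step N T None E"
      using L by blast
    have False if r: "run N T w (c 0)"
      using r
    proof cases
      case refl
      then show ?thesis using T(3) assms(3)[of 0] by blast
    next
      case (silent D)
      then show ?thesis using T(3) by blast
    next
      case (read a D w')
      then show ?thesis using step_reading_state[OF P1_N is_cspda_N] T(2) by blast
    qed
    then show ?thesis using stop T by blast
  qed
qed

lemma cfg_Nil: "cfg [] = (to_nat (Read None), U, [Bot])"
  by (simp add: cfg_def)

lemma is_acc_st: "is_acc (st fs) \<longleftrightarrow> accepts fs"
proof -
  have "debt (st fs) \<longleftrightarrow> \<not> (\<forall>f \<in> set fs. fst (snd f) \<in> accepting (M (fst (Bs ! fst f))))" for fs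
    by (induction fs rule: st.induct) (auto simp: debt_def)
  moreover have "st fs = None \<longleftrightarrow> fs = []" by (cases fs rule: st.cases) auto
  ultimately show ?thesis unfolding is_acc_def accepts_def by simp
qed

lemma accepting_cfg:
  assumes "valid n fs"
  shows "fst (cfg fs) \<in> accepting N \<longleftrightarrow> accepts fs"
  using is_acc_st[of fs] valid_facts[OF assms] by (auto simp: cfg_def image_iff)


end

lemma run_in_alph: "is_cspda M \<Longrightarrow> run M C w D \<Longrightarrow> w \<in> lists (in_alph M)"
proof (rotate_tac, induction rule: run.induct)
  case (read C a D w E)
  from read.hyps(1) obtain q s q' mv where "(q, s, Some a, q', mv) \<in> trans M" by cases auto
  then have "a \<in> in_alph M" using read.prems unfolding is_cspda_def by fast
  then show ?case using read by simp
qed auto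

section \<open>Normal forms of words over the factors\<close>

context factor_machines
begin

lemma syllables:
  "\<exists>ts. successively (\<lambda>s t. fst s \<noteq> fst t) ts \<and> (\<forall>t \<in> set ts. snd t \<noteq> []) \<and>
     w = concat (map (\<lambda>(j, t). map (Pair j) t) ts)"
  for w :: "(nat \<times> 'a) list"
proof (induction w)
  case Nil
  then show ?case by (intro exI[of _ "[]"]) simp
next
  case (Cons l w)
  then obtain ts where ts: "successively (\<lambda>s t. fst s \<noteq> fst t) ts" "\<forall>t \<in> set ts. snd t \<noteq> []"
     "w = concat (map (\<lambda>(j, t). map (Pair j) t) ts)" by blast
  obtain j a where l: "l = (j, a)" by (cases l)
  show ?case
  proof (cases "ts \<noteq> [] \<and> fst (hd ts) = j")
    case True
    then obtain t ts' where t: "ts = (j, t) # ts'" by (cases ts) auto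
    then show ?thesis using ts l
      by (intro exI[of _ "(j, a # t) # ts'"]) (auto simp: successively_Cons)
  next
    case False
    then show ?thesis using ts l
      by (intro exI[of _ "(j, [a]) # ts"]) (auto simp: successively_Cons)
  qed
qed

text \<open>Induction on the length and not on the syllables: deleting a trivial syllable may bring
  two syllables of one factor together, so the shorter word is cut into syllables anew.\<close>

lemma ex_normal_form:
  assumes "w \<in> lists letters"
  shows "\<exists>ts. successively (\<lambda>s t. fst s \<noteq> fst t) ts \<and> (\<forall>(j, t) \<in> set ts. j \<in> J \<and> t \<in> lang (M j)) \<and>
     reduces w (concat (map (\<lambda>(j, t). map (Pair j) t) ts))"
  using assms
proof (induction "length w" arbitrary: w rule: less_induct)
  case less
  obtain ts where ts: "successively (\<lambda>s t. fst s \<noteq> fst t) ts" "\<forall>t \<in> set ts. snd t \<noteq> []"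
     "w = concat (map (\<lambda>(j, t). map (Pair j) t) ts)" using syllables by blast
  have let': "j \<in> J \<and> t \<in> lists (in_alph (M j))" if jt: "(j, t) \<in> set ts" for j t
  proof -
    have "set (map (Pair j) t) \<subseteq> set w" using jt unfolding ts(3) by force
    then have "Pair j ` set t \<subseteq> letters" using less.prems by auto
    moreover have "t \<noteq> []" using ts(2) jt by auto
    ultimately show ?thesis unfolding letters_def by (cases t) auto
  qed
  show ?case
  proof (cases "\<forall>(j, t) \<in> set ts. t \<in> lang (M j)")
    case True
    then show ?thesis using ts let' reduces.refl by blast
  next
    case False
    then obtain j t where jt: "(j, t) \<in> set ts" "t \<notin> lang (M j)" by blast
    then obtain as bs where "ts = as @ (j, t) # bs" by (meson split_list)
    then obtain x y where w: "w = x @ map (Pair j) t @ y" using ts(3) by auto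
    have "t \<noteq> []" using ts(2) jt(1) by auto
    then have "length (x @ y) < length w" "x @ y \<in> lists letters" using w less.prems by auto
    from less.hyps[OF this] obtain ts' where ts': "successively (\<lambda>s t. fst s \<noteq> fst t) ts'"
      "\<forall>(j, t) \<in> set ts'. j \<in> J \<and> t \<in> lang (M j)"
      "reduces (x @ y) (concat (map (\<lambda>(j, t). map (Pair j) t) ts'))" by blast
    have "reduces w (concat (map (\<lambda>(j, t). map (Pair j) t) ts'))"
      unfolding w using let'[OF jt(1)] jt(2) ts'(3) by (intro reduces.delete) auto
    then show ?thesis using ts'(1,2) by blast
  qed
qed

end

section \<open>The product machine is special and accepts the non-trivial words\<close>

locale product_groups = product_machine J M A pr + factor_groups J M
  for J :: "nat set" and M :: "nat \<Rightarrow> (nat, 'a, ('a, nat) stack_symbol) cspda"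
    and A :: "'l set" and pr :: "'l \<Rightarrow> nat \<times> 'a"
begin

lemma delta'_Push: "delta' s (Some xd) l = Some (s', Push y) \<Longrightarrow> y \<noteq> Bot \<and> y \<noteq> Top"
proof -
  assume d: "delta' s (Some xd) l = Some (s', Push y)"
  have sim: "y \<noteq> Bot \<and> y \<noteq> Top" if "simulate j q f x d l = Some (s', Push y)" for j q f x d l s' y
  proof -
    have "\<exists>mv'. mv = map_pd_move symbol mv'" if "simulate j q f x d l = Some (s', mv)" for mv
      using that unfolding simulate_def by (auto split: option.splits if_splits)
    from this[OF that] obtain mv' where "Push y = map_pd_move symbol mv'" by blast
    then show ?thesis by (cases mv') auto
  qed
  from d have "delta s (Some xd) l = Some (s', Push y)" unfolding delta'_def by (auto split: if_splits)
  then show ?thesis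
  proof (cases rule: delta.elims)
    case (5 j q f x d)
    then show ?thesis by (cases "unsave x") (auto split: option.splits if_splits dest: sim sim[OF HOL.sym])
  qed (auto split: option.splits if_splits dest: sim sim[OF HOL.sym])
qed

lemma simulate_Bot: "simulate j q f Bot d l = None"
  unfolding simulate_def by (auto split: option.splits)

lemma delta'_Bot_Pop: "delta' s (Some (Bot, d)) l \<noteq> Some (s', Pop)"
proof
  assume "delta' s (Some (Bot, d)) l = Some (s', Pop)"
  then have "delta s (Some (Bot, d)) l = Some (s', Pop)" unfolding delta'_def by (auto split: if_splits)
  then show False
    by (cases rule: delta.elims) (auto split: option.splits if_splits simp: simulate_Bot)
qed

lemma delta'_Top_Push: "delta' s (Some (x, Top)) l \<noteq> Some (s', Push y)"
proof
  assume "delta' s (Some (x, Top)) l = Some (s', Push y)"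
  then have "delta s (Some (x, Top)) l = Some (s', Push y)" unfolding delta'_def by (auto split: if_splits)
  then show False
    by (cases rule: delta.elims) (auto split: option.splits if_splits)
qed

lemma stack_N_step:
  assumes "step N C l D" "snd (snd C) \<noteq> []" "last (snd (snd C)) = Bot" "Bot \<notin> set (butlast (snd (snd C)))"
    "Top \<notin> set (snd (snd C))"
  shows "snd (snd D) \<noteq> [] \<and> last (snd (snd D)) = Bot \<and> Bot \<notin> set (butlast (snd (snd D))) \<and> Top \<notin> set (snd (snd D))"
  using assms(1)
proof cases
  case (push q u p q' y)
  then obtain x d where "seen u p = Some (x, d)" using assms(2) by (auto simp: seen_def)
  with push(3) obtain s s' where "delta' s (Some (x, d)) l = Some (s', Push y)"
    by (auto elim!: trans_ND)
  then have "y \<noteq> Bot \<and> y \<noteq> Top" by (rule delta'_Push)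
  then show ?thesis using push assms(2-) by auto
next
  case (pop q u x p q')
  have "x \<noteq> Bot" using pop(3) delta'_Bot_Pop by (auto elim!: trans_ND simp: seen_def)
  then show ?thesis using pop assms(2-) by (auto split: if_splits)
next
  case stay
  then show ?thesis using assms(2-) by auto
qed

lemma stack_N_run:
  "run N C w D \<Longrightarrow> snd (snd C) \<noteq> [] \<Longrightarrow> last (snd (snd C)) = Bot \<Longrightarrow> Bot \<notin> set (butlast (snd (snd C))) \<Longrightarrow>
    Top \<notin> set (snd (snd C)) \<Longrightarrow> Bot \<notin> set (butlast (snd (snd D))) \<and> Top \<notin> set (snd (snd D))"
proof (induction rule: run.induct)
  case (silent C D w E)
  then show ?case using stack_N_step[OF silent.hyps(1)] by blast
next
  case (read C a D w E)
  then show ?case using stack_N_step[OF read.hyps(1)] by blast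
qed simp

lemma P3_N: "P3 N"
  unfolding P3_def
proof (intro conjI allI impI)
  fix q u l q' u' p
  assume a: "initialises N q u \<and> step N (q, u, []) l (q', u', p)"
  then have "entry_config N (q', u', p)" unfolding entry_config_def by blast
  then obtain Bs \<sigma> where e: "\<sigma> \<in> fstates" "q' = to_nat (Read \<sigma>)" "u' = cstack Bs" "p = [Bot]"
    unfolding entry_config_N_iff by auto
  have "u' = u" using a by (auto elim: step.cases)
  then show "u \<noteq> []" "hd u = Bot" "last u = Top" "p = [Bot]" "reading_state N q'"
    using e reading_state_N_iff[of "Read \<sigma>"] by (auto simp: cstack_def)
  obtain s where s: "q = to_nat s" "init_inv s u" using a initialises_N_D by blast
  from a have "step N (q, u, []) l (q', u', p)" by blast
  then have "\<exists>o' r mv. (q, o', l, r, mv) \<in> trans N" by cases blast+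
  then obtain o' r mv where "(q, o', l, r, mv) \<in> trans N" by blast
  then have "l = None \<longleftrightarrow> \<not> is_read s" using is_read_delta'[of s o' l] s(1) by (auto elim!: trans_ND)
  moreover have "\<not> is_read s" using s(2) by (cases s) auto
  ultimately show "l = None" by blast
next
  fix q u p
  assume "second_stage_config N (q, u, p)"
  then obtain E w where E: "entry_config N E" "run N E w (q, u, p)" unfolding second_stage_config_def by blast
  from E(1) obtain Bs \<sigma> where e: "E = (to_nat (Read \<sigma>), cstack Bs, [Bot])"
    unfolding entry_config_N_iff by blast
  have "u = cstack Bs" using run_check_stack[OF E(2)] e by simp
  then show "Bot \<notin> set (tl u)" "Top \<notin> set (butlast u)" using cstack_tl by auto
  show "Bot \<notin> set (butlast p)" "Top \<notin> set p" using stack_N_run[OF E(2)] e by auto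
next
  fix q d l q'
  show "(q, Some (Bot, d), l, q', Pop) \<notin> trans N" using delta'_Bot_Pop by (auto elim!: trans_ND)
next
  fix q x l q' y
  show "(q, Some (x, Top), l, q', Push y) \<notin> trans N" using delta'_Top_Push by (auto elim!: trans_ND)
qed (simp_all add: calph_def palph_def)

lemma P5_N: "P5 N"
  unfolding P5_def using reading_state_N_iff by auto

lemma P7_N: "P7 N"
proof -
  have entry: "entry_state N q \<longleftrightarrow> (\<exists>\<sigma> \<in> fstates. \<not> is_acc \<sigma> \<and> q = to_nat (Read \<sigma>))" for q
  proof
    assume "\<exists>\<sigma> \<in> fstates. \<not> is_acc \<sigma> \<and> q = to_nat (Read \<sigma>)"
    \<comment> \<open>The empty list of blocks suffices, because \<open>\<sigma>\<close> is guessed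
      without regard to the check stack.\<close>
    then have "entry_config N (q, cstack [], [Bot])"
      unfolding entry_config_N_iff by (intro exI[of _ "[]"]) auto
    then show "entry_state N q" unfolding entry_state_def by blast
  qed (auto simp: entry_state_def entry_config_N_iff)
  have read: "reading_state N q \<longleftrightarrow> (\<exists>\<sigma> \<in> fstates. q = to_nat (Read \<sigma>))" for q
  proof
    assume r: "reading_state N q"
    then obtain s where "q = to_nat s" "s \<in> pstates" unfolding reading_state_def by auto
    then show "\<exists>\<sigma> \<in> fstates. q = to_nat (Read \<sigma>)" using r reading_state_N_iff by (cases s) auto
  qed (use reading_state_N_iff in auto)
  show ?thesis unfolding P7_def entry read by (auto simp: image_iff)
qed

lemma stuck_entry:
  assumes "\<sigma> \<noteq> None" shows "\<not> step N (to_nat (Read \<sigma>), cstack Bs, [Bot]) l D"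
proof
  assume "step N (to_nat (Read \<sigma>), cstack Bs, [Bot]) l D"
  then have "\<exists>r mv. (to_nat (Read \<sigma>), Some (Bot, Bot), l, r, mv) \<in> trans N"
    by cases (auto simp: seen_def cstack_def)
  then obtain s' mv where "delta' (Read \<sigma>) (Some (Bot, Bot)) l = Some (s', mv)"
    unfolding trans_N_iff by blast
  then show False using assms unfolding delta'_def by (cases \<sigma>; cases l) auto
qed

lemma stuck_entry_run:
  "run N (to_nat (Read \<sigma>), cstack Bs, [Bot]) w D \<Longrightarrow> \<sigma> \<noteq> None \<Longrightarrow> w = [] \<and> D = (to_nat (Read \<sigma>), cstack Bs, [Bot])"
proof (erule run.cases)
  fix C D E w
  assume "(to_nat (Read \<sigma>), cstack Bs, [Bot]) = C" "\<sigma> \<noteq> None" "step N C None D"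
  then show ?thesis using stuck_entry by blast
next
  fix C a D w E
  assume "(to_nat (Read \<sigma>), cstack Bs, [Bot]) = C" "\<sigma> \<noteq> None" "step N C (Some a) D"
  then show ?thesis using stuck_entry by blast
qed simp

lemma product_runI: "(\<And>b. b \<in> set Bs \<Longrightarrow> good b) \<Longrightarrow> product_run J M A pr Bs"
  by unfold_locales

lemma P4_N: "P4 N"
  unfolding P4_def
proof
  assume "\<exists>c. second_stage_config N (c 0) \<and> (\<forall>n. step N (c n) None (c (Suc n)))"
  then obtain c where c: "second_stage_config N (c 0)" "\<And>n. step N (c n) None (c (Suc n))" by blast
  then obtain E w where E: "entry_config N E" "run N E w (c 0)" unfolding second_stage_config_def by blast
  from E(1) obtain Bs \<sigma> where e: "E = (to_nat (Read \<sigma>), cstack Bs, [Bot])" "\<forall>b \<in> set Bs. good b"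
    unfolding entry_config_N_iff by blast
  interpret product_run J M A pr Bs using product_runI e(2) by blast
  show False
  proof (cases "\<sigma> = None")
    case True
    then show False using no_silent_chain[of 0 "[]" w c] E(2) c(2) run_in_alph[OF is_cspda_N E(2)]
      unfolding cfg_Nil e(1) by simp
  next
    case False
    then show False using stuck_entry_run E(2) c(2)[of 0] stuck_entry unfolding e(1) by metis
  qed
qed

lemma lang_N: "lang N = {w \<in> lists A. \<not> reduces (map pr w) []}"
proof (intro equalityI subsetI)
  fix w assume w: "w \<in> lang N"
  then obtain r u D where i: "initialises N r u" and r: "run N (r, u, []) w D" and a: "fst D \<in> accepting N"
    and wA: "w \<in> lists A" unfolding lang_def by auto
  obtain s where s: "r = to_nat s" "init_inv s u" using i initialises_N_D by blast
  obtain \<sigma> where \<sigma>: "fst D = to_nat (Read \<sigma>)" "is_acc \<sigma>" using a by auto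
  have "\<exists>E. entry_config N E \<and> run N E w D"
    using r
  proof cases
    case refl
    \<comment> \<open>A run of length zero is still in the first stage, where no \<open>Read\<close>
      state occurs.\<close>
    then have "s = Read \<sigma>" using \<sigma>(1) s(1) by auto
    then show ?thesis using s(2) by simp
  next
    case (silent E)
    then show ?thesis using i unfolding entry_config_def by blast
  next
    case (read b E v)
    then have "entry_config N E" using i unfolding entry_config_def by blast
    moreover obtain q' u' p' where "E = (q', u', p')" by (cases E)
    ultimately have False using P3_N i read(2) unfolding P3_def by blast
    then show ?thesis ..
  qed
  then obtain E where E: "entry_config N E" "run N E w D" by blast
  from E(1) obtain Bs \<tau> where e: "E = (to_nat (Read \<tau>), cstack Bs, [Bot])" "\<forall>b \<in> set Bs. good b" "\<not> is_acc \<tau>"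
    unfolding entry_config_N_iff by blast
  interpret product_run J M A pr Bs using product_runI e(2) by blast
  have \<tau>: "\<tau> = None"
  proof (rule ccontr)
    assume "\<tau> \<noteq> None"
    then have "D = E" using stuck_entry_run E(2) unfolding e(1) by blast
    then show False using \<sigma> e by auto
  qed
  have "reading_config N (cfg [])" using reading_cfg[of 0] by simp
  moreover have "reading_config N D" using a P5_N unfolding P5_def reading_config_def by blast
  ultimately have "dels N (cfg []) w = Some D"
    using dels_eq_Some[OF P1_N P2_N is_cspda_N] E(2) e(1) \<tau> unfolding after_def cfg_Nil by simp
  then obtain fs where fs: "iter (nstep Bs) [] (map pr w) = Some fs" "D = cfg fs"
    using dels_cfg[of 0 "[]" w] wA by auto
  have pw: "map pr w \<in> lists letters" using wA pr_letters by auto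
  have "valid (length (map pr w)) fs" using valid_iter[of 0 "[]" "map pr w" fs] fs(1) pw by simp
  then have "accepts fs" using accepting_cfg a fs(2) by blast
  then show "w \<in> {w \<in> lists A. \<not> reduces (map pr w) []}"
    using not_accepts_trivial_word[OF _ pw fs(1)] wA by blast
next
  fix w assume w: "w \<in> {w \<in> lists A. \<not> reduces (map pr w) []}"
  then have pw: "map pr w \<in> lists letters" using pr_letters by auto
  obtain ts where ts: "successively (\<lambda>s t. fst s \<noteq> fst t) ts" "\<forall>(j, t) \<in> set ts. j \<in> J \<and> t \<in> lang (M j)"
    "reduces (map pr w) (concat (map (\<lambda>(j, t). map (Pair j) t) ts))" using ex_normal_form[OF pw] by blast
  have "ts \<noteq> []" using ts(3) w by auto
  then obtain Bs fs where Bs: "\<forall>b \<in> set Bs. good b" "iter (nstep Bs) [] (map pr w) = Some fs"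
    "block_list.accepts M Bs fs"
    using ex_accepting_block_list[OF pw ts(3) _ ts(1)] ts(2) by blast
  interpret product_run J M A pr Bs using product_runI Bs(1) by blast
  have v: "valid (length (map pr w)) fs" using valid_iter[of 0 "[]" "map pr w" fs] Bs(2) pw by simp
  have "dels N (cfg []) w = Some (cfg fs)" using dels_cfg[of 0 "[]" w] w Bs(2) by simp
  then have r: "run N (cfg []) w (cfg fs)"
    using dels_eq_Some[OF P1_N P2_N is_cspda_N reading_cfg[of 0]] unfolding after_def by simp
  have "entry_config N (cfg [])"
    unfolding entry_config_N_iff cfg_Nil using Bs(1) by (auto simp: is_acc_def)
  then obtain q u l where "initialises N q u" "step N (q, u, []) l (cfg [])" unfolding entry_config_def by blast
  moreover from this have "l = None" using P3_N unfolding P3_def cfg_Nil by blast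
  ultimately have "initialises N q u" "run N (q, u, []) w (cfg fs)" using r run.silent by blast+
  moreover have "fst (cfg fs) \<in> accepting N" using Bs(3) accepting_cfg[OF v] by blast
  moreover have "w \<in> lists (in_alph N)" using w by simp
  ultimately show "w \<in> lang N" unfolding lang_def by blast
qed

lemma P6_N: "P6 N"
  unfolding P6_def
proof (intro allI impI)
  fix C u v
  assume "entry_config N C \<and> u \<in> lists (in_alph N) \<and> v \<in> lists (in_alph N) \<and> v \<notin> lang N"
  then have C: "entry_config N C" and uv: "u \<in> lists A" "v \<in> lists A" and red: "reduces (map pr v) []"
    using lang_N by auto
  from C obtain Bs \<sigma> where e: "C = (to_nat (Read \<sigma>), cstack Bs, [Bot])" "\<forall>b \<in> set Bs. good b" "\<sigma> \<in> fstates"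
    unfolding entry_config_N_iff by blast
  have rC: "reading_config N C" using reading_state_N_iff[of "Read \<sigma>"] e(1,3) unfolding reading_config_def by simp
  interpret product_run J M A pr Bs using product_runI e(2) by blast
  show "(\<exists>D. after N C (u @ v) D \<and> after N C u D) \<or> fails N C (u @ v)"
  proof (cases "\<sigma> = None")
    case False
    show ?thesis
    \<comment> \<open>Being stuck in a reading configuration counts as failing only while letters
      remain, so the empty word is treated apart; there both sides of (P6) are \<open>C\<close>
      itself.\<close>
    proof (cases "u @ v = []")
      case True
      then have "after N C (u @ v) C" "after N C u C" using rC run.refl[of N C] unfolding after_def by auto
      then show ?thesis by blast
    next
      case nonempty: False
      have "stuck N C (u @ v)" using stuck_entry[OF False] unfolding stuck_def e(1) by blast
      then show ?thesis unfolding fails_def using nonempty run.refl by (metis append_Nil)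
    qed
  next
    case True
    then have c: "C = cfg []" using e(1) cfg_Nil by simp
    have pu: "map pr u \<in> lists letters" "map pr v \<in> lists letters" using uv pr_letters by auto
    note dd = dels_eq_Some[OF P1_N P2_N is_cspda_N rC]
    have dc: "dels N C w = map_option cfg (iter (nstep Bs) [] (map pr w))" if "w \<in> lists A" for w
      using dels_cfg[of 0 "[]" w] that c by simp
    have uvA: "u @ v \<in> lists A" using uv by simp
    from iter_trivial_word[OF red pu] show ?thesis
    proof
      assume b: "bad [] (map pr u @ map pr v)"
      show ?thesis
      proof (cases "dels N C (u @ v)")
        case None
        have "second_stage_config N C" using C run.refl unfolding second_stage_config_def by blast
        then show ?thesis using fails_if_dels_None[OF P1_N P2_N P4_N is_cspda_N _ rC None] by blast
      next
        case (Some D)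
        then have "iter (nstep Bs) [] (map pr u @ map pr v) \<noteq> None" using dc[OF uvA] by auto
        then obtain x y fs where xy: "map pr (u @ v) = x @ y" "iter (nstep Bs) [] x = Some fs" "dead fs"
          using b unfolding bad_def by auto
        then obtain x' y' where x': "u @ v = x' @ y'" "x = map pr x'" unfolding map_eq_append_conv by metis
        have x'A: "x' \<in> lists A" using uvA x'(1) by auto
        have v: "valid (length x) fs"
        proof -
          have "x \<in> lists letters" unfolding x'(2) using x'A pr_letters by auto
          then show ?thesis using valid_iter[of 0 "[]" x fs] xy(2) by simp
        qed
        \<comment> \<open>A dead list stays dead, so the configuration of the product machine that
          encodes it is failing.\<close>
        have "fst D' \<notin> accepting N" if D': "dels N (cfg fs) w = Some D'" for w D'
        proof -
          have wA: "w \<in> lists A"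
            using D' dels_eq_Some[OF P1_N P2_N is_cspda_N reading_cfg[OF v]]
              run_in_alph[OF is_cspda_N, of "cfg fs" w D']
            unfolding after_def by simp
          then obtain fs' where fs': "iter (nstep Bs) fs (map pr w) = Some fs'" "D' = cfg fs'"
            using dels_cfg[OF v] D' by auto
          have pw: "map pr w \<in> lists letters" using wA pr_letters by auto
          have "\<not> accepts fs'" using dead_not_accepts[OF dead_iter[OF v xy(3) pw fs'(1)]] .
          then show ?thesis using accepting_cfg[OF valid_iter[OF v pw fs'(1)]] fs'(2) by simp
        qed
        then have "failing_config N (cfg fs)"
          using failing_config_iff[OF P1_N P2_N P5_N is_cspda_N reading_cfg[OF v]] by blast
        moreover have "run N C x' (cfg fs)" using dc[OF x'A] dd xy(2) x'(2) unfolding after_def by simp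
        ultimately show ?thesis unfolding fails_def using x'(1) by blast
      qed
    next
      assume "iter (nstep Bs) [] (map pr u @ map pr v) \<noteq> None \<and>
        iter (nstep Bs) [] (map pr u @ map pr v) = iter (nstep Bs) [] (map pr u)"
      then obtain fs where "iter (nstep Bs) [] (map pr (u @ v)) = Some fs" "iter (nstep Bs) [] (map pr u) = Some fs"
        by (metis map_append option.exhaust)
      then have "dels N C (u @ v) = Some (cfg fs)" "dels N C u = Some (cfg fs)" using dc[OF uvA] dc[OF uv(1)] by auto
      then have "after N C (u @ v) (cfg fs)" "after N C u (cfg fs)" using dd by blast+
      then show ?thesis by blast
    qed
  qed
qed

theorem special_N: "special_cspda N"
  unfolding special_cspda_def
  using is_cspda_N P1_N P2_N P3_N P4_N P5_N P6_N P7_N by blast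

end

section \<open>Free products of groups\<close>

locale group_family =
  fixes I :: "'i set" and G :: "'i \<Rightarrow> ('a, 'b) monoid_scheme"
  assumes grp: "\<And>i. i \<in> I \<Longrightarrow> group (G i)"
begin

abbreviation W where "W \<equiv> lists (SIGMA i:I. carrier (G i))"
abbreviation F where "F \<equiv> free_product I G"
abbreviation eq where "eq \<equiv> fp_eq I G"
abbreviation cls where "cls \<equiv> fp_class I G"
abbreviation prodl where "prodl i t \<equiv> foldr (\<otimes>\<^bsub>G i\<^esub>) t \<one>\<^bsub>G i\<^esub>"

lemma eq_W: "eq x y \<Longrightarrow> x \<in> W \<and> y \<in> W"
proof (induction rule: fp_eq.induct)
  case (one i)
  then show ?case using group.is_monoid[OF grp] monoid.one_closed by force
next
  case (mult i g h)
  then show ?case using group.is_monoid[OF grp[OF mult(1)]] monoid.m_closed by fastforce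
qed auto

lemma cls_eq_iff: "x \<in> W \<Longrightarrow> cls x = cls y \<longleftrightarrow> eq x y"
  unfolding fp_class_def using fp_eq.refl fp_eq.sym fp_eq.trans by (metis (mono_tags, lifting) Collect_cong mem_Collect_eq)

text \<open>Van der Waerden's action of the letters on normal forms.\<close>

fun act :: "'i \<times> 'a \<Rightarrow> ('i \<times> 'a) list \<Rightarrow> ('i \<times> 'a) list" where
  "act (i, g) [] = (if g = \<one>\<^bsub>G i\<^esub> then [] else [(i, g)])"
| "act (i, g) ((k, h) # r) = (if i = k then (if g \<otimes>\<^bsub>G i\<^esub> h = \<one>\<^bsub>G i\<^esub> then r else (i, g \<otimes>\<^bsub>G i\<^esub> h) # r)
     else if g = \<one>\<^bsub>G i\<^esub> then (k, h) # r else (i, g) # (k, h) # r)"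

definition reduced :: "('i \<times> 'a) list \<Rightarrow> bool" where
  "reduced r \<longleftrightarrow> r \<in> W \<and> successively (\<lambda>s t. fst s \<noteq> fst t) r \<and> (\<forall>(i, g) \<in> set r. g \<noteq> \<one>\<^bsub>G i\<^esub>)"

lemma reduced_Nil: "reduced []"
  by (simp add: reduced_def)

lemma reduced_Cons: "reduced ((i, g) # r) \<longleftrightarrow> i \<in> I \<and> g \<in> carrier (G i) \<and> g \<noteq> \<one>\<^bsub>G i\<^esub> \<and> reduced r \<and>
    (r \<noteq> [] \<longrightarrow> fst (hd r) \<noteq> i)"
  unfolding reduced_def by (auto simp: successively_Cons)

lemma act_reduced:
  assumes "reduced r" "i \<in> I" "g \<in> carrier (G i)"
  shows "reduced (act (i, g) r)"
proof -
  interpret group "G i" using grp assms(2) .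
  show ?thesis
  proof (cases r)
    case Nil
    then show ?thesis using assms by (auto simp: reduced_Cons reduced_Nil)
  next
    case (Cons p r')
    then show ?thesis using assms by (cases p) (auto simp: reduced_Cons)
  qed
qed

lemma act_one:
  assumes "reduced r" "i \<in> I"
  shows "act (i, \<one>\<^bsub>G i\<^esub>) r = r"
proof -
  interpret group "G i" using grp assms(2) .
  show ?thesis
  proof (cases r)
    case (Cons p r')
    then show ?thesis using assms by (cases p) (auto simp: reduced_Cons)
  qed simp
qed

lemma act_mult:
  assumes "reduced r" "i \<in> I" "g \<in> carrier (G i)" "h \<in> carrier (G i)"
  shows "act (i, g) (act (i, h) r) = act (i, g \<otimes>\<^bsub>G i\<^esub> h) r"
proof -
  interpret group "G i" using grp assms(2) .
  have *: "act (i, g) r' = (if g = \<one>\<^bsub>G i\<^esub> then r' else (i, g) # r')" if "r' \<noteq> [] \<longrightarrow> fst (hd r') \<noteq> i" for r' g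
    using that by (cases r') auto
  show ?thesis
  proof (cases r)
    case Nil
    then show ?thesis using assms by (auto simp: inv_comm)
  next
    case (Cons p r')
    obtain k x where p: "p = (k, x)" by (cases p)
    show ?thesis
    proof (cases "k = i")
      case True
      then have r: "x \<in> carrier (G i)" "r' \<noteq> [] \<longrightarrow> fst (hd r') \<noteq> i"
        using assms(1) Cons p by (auto simp: reduced_Cons)
      have "g \<otimes>\<^bsub>G i\<^esub> h \<otimes>\<^bsub>G i\<^esub> x = g \<otimes>\<^bsub>G i\<^esub> (h \<otimes>\<^bsub>G i\<^esub> x)" using m_assoc assms r by simp
      then show ?thesis using Cons p True *[OF r(2)] assms r(1) by auto
    next
      case False
      then show ?thesis using Cons p assms by auto
    qed
  qed
qed

lemma foldr_act_reduced: "reduced r \<Longrightarrow> x \<in> W \<Longrightarrow> reduced (foldr act x r)"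
  by (induction x) (auto intro: act_reduced)

text \<open>The action respects every defining rule of \<open>fp_eq\<close>, so it can tell classes
  apart.\<close>

lemma eq_act: "eq x y \<Longrightarrow> reduced r \<Longrightarrow> foldr act x r = foldr act y r"
proof (induction arbitrary: r rule: fp_eq.induct)
  case (append x y x' y')
  have "reduced (foldr act y' r)" using foldr_act_reduced append.prems eq_W append.hyps by blast
  then show ?case using append by simp
qed (simp_all add: act_one act_mult)

lemma eq_prodl:
  assumes "i \<in> I" "t \<in> lists (carrier (G i))"
  shows "eq (map (Pair i) t) [(i, prodl i t)]"
  using assms(2)
proof (induction t rule: list.induct)
  case Nil
  then show ?case using fp_eq.sym[OF fp_eq.one[OF assms(1)]] by simp
next
  case (Cons a t)
  interpret group "G i" using grp assms(1) .
  have "prodl i t \<in> carrier (G i)" using eq_W[OF Cons.IH] Cons.prems by simp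
  then have "eq ([(i, a)] @ [(i, prodl i t)]) [(i, prodl i (a # t))]"
    using fp_eq.mult[OF assms(1), where G = G and g = a and h = "prodl i t"] Cons.prems by simp
  moreover have "eq ([(i, a)] @ map (Pair i) t) ([(i, a)] @ [(i, prodl i t)])"
    using Cons assms(1) by (intro fp_eq.append fp_eq.refl) auto
  ultimately show ?case using fp_eq.trans by fastforce
qed

text \<open>Each syllable acts like the single letter carrying its product, which meets a list
  beginning with another factor and is simply put in front.\<close>

lemma normal_form_act:
  assumes "successively (\<lambda>s t. fst s \<noteq> fst t) ts"
    "\<forall>(i, t) \<in> set ts. i \<in> I \<and> t \<in> lists (carrier (G i)) \<and> prodl i t \<noteq> \<one>\<^bsub>G i\<^esub>"
  shows "foldr act (concat (map (\<lambda>(i, t). map (Pair i) t) ts)) [] = map (\<lambda>(i, t). (i, prodl i t)) ts \<and>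
    reduced (map (\<lambda>(i, t). (i, prodl i t)) ts)"
  using assms
proof (induction ts)
  case (Cons s ts)
  obtain i t where s: "s = (i, t)" by (cases s)
  let ?r = "map (\<lambda>(i, t). (i, prodl i t)) ts"
  have IH: "foldr act (concat (map (\<lambda>(i, t). map (Pair i) t) ts)) [] = ?r" "reduced ?r"
    using Cons by (auto simp: successively_Cons)
  have it: "i \<in> I" "t \<in> lists (carrier (G i))" "prodl i t \<noteq> \<one>\<^bsub>G i\<^esub>" using Cons.prems(2) s by auto
  have hd: "?r \<noteq> [] \<longrightarrow> fst (hd ?r) \<noteq> i" using Cons.prems(1) s by (cases ts) (auto split: prod.splits)
  have "prodl i t \<in> carrier (G i)" using eq_W[OF eq_prodl[OF it(1,2)]] by simp
  then have "reduced ((i, prodl i t) # ?r)" using IH(2) it hd by (simp add: reduced_Cons)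
  moreover have "foldr act (map (Pair i) t) ?r = act (i, prodl i t) ?r"
    using eq_act[OF eq_prodl[OF it(1,2)] IH(2)] by simp
  moreover have "act (i, prodl i t) ?r = (i, prodl i t) # ?r"
    using hd it(3) by (cases ?r) auto
  ultimately show ?case using IH(1) s by simp
qed (simp add: reduced_Nil)

lemma normal_form_nontrivial:
  assumes "successively (\<lambda>s t. fst s \<noteq> fst t) ts"
    "\<forall>(i, t) \<in> set ts. i \<in> I \<and> t \<in> lists (carrier (G i)) \<and> prodl i t \<noteq> \<one>\<^bsub>G i\<^esub>"
    "eq (concat (map (\<lambda>(i, t). map (Pair i) t) ts)) []"
  shows "ts = []"
  using normal_form_act[OF assms(1,2)] eq_act[OF assms(3) reduced_Nil] by simp

lemma carrier_F: "carrier F = cls ` W"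
  by (simp add: free_product_def)

lemma one_F: "\<one>\<^bsub>F\<^esub> = cls []"
  by (simp add: free_product_def)

lemma mult_F:
  assumes "x \<in> W" "y \<in> W"
  shows "cls x \<otimes>\<^bsub>F\<^esub> cls y = cls (x @ y)"
proof -
  have "cls (x' @ y') = cls (x @ y)" if "x' \<in> cls x" "y' \<in> cls y" for x' y'
  proof -
    have "eq (x @ y) (x' @ y')" using that unfolding fp_class_def by (intro fp_eq.append) auto
    moreover have "x @ y \<in> W" using assms by simp
    ultimately show ?thesis using cls_eq_iff by blast
  qed
  then have "(\<Union>x'\<in>cls x. \<Union>y'\<in>cls y. cls (x' @ y')) = (\<Union>x'\<in>cls x. \<Union>y'\<in>cls y. cls (x @ y))"
    by (intro SUP_cong HOL.refl)
  moreover have "x \<in> cls x" "y \<in> cls y" using assms fp_eq.refl unfolding fp_class_def by blast+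
  ultimately show ?thesis unfolding free_product_def by auto
qed

lemma inverse_word:
  assumes "x \<in> W"
  shows "\<exists>y \<in> W. eq (y @ x) []"
  using assms
proof (induction x rule: list.induct)
  case Nil
  then show ?case using fp_eq.refl[of "[]" I G] by (intro bexI[of _ "[]"]) auto
next
  case (Cons p x)
  obtain i g where p: "p = (i, g)" by (cases p)
  have ig: "i \<in> I" "g \<in> carrier (G i)" and x: "x \<in> W" using Cons.prems[unfolded p] by auto
  interpret group "G i" using grp ig(1) .
  obtain y where y: "y \<in> W" "eq (y @ x) []" using Cons.IH x by auto
  have "eq [(i, inv\<^bsub>G i\<^esub> g), (i, g)] []"
    using fp_eq.trans[OF fp_eq.mult[where G = G, OF ig(1) inv_closed[OF ig(2)] ig(2)]] fp_eq.one[OF ig(1), of G] ig(2) by simp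
  then have "eq (y @ [(i, inv\<^bsub>G i\<^esub> g), (i, g)] @ x) (y @ [] @ x)"
    using y(1) x by (intro fp_eq.append fp_eq.refl)
  then have "eq ((y @ [(i, inv\<^bsub>G i\<^esub> g)]) @ p # x) []" using fp_eq.trans y(2) p by fastforce
  moreover have "y @ [(i, inv\<^bsub>G i\<^esub> g)] \<in> W" using y(1) ig by simp
  ultimately show ?case by blast
qed

lemma group_F: "group F"
proof (rule groupI)
  show "x \<otimes>\<^bsub>F\<^esub> y \<in> carrier F" if xy: "x \<in> carrier F" "y \<in> carrier F" for x y
  proof -
    obtain a b where ab: "a \<in> W" "x = cls a" "b \<in> W" "y = cls b" using xy unfolding carrier_F by blast
    then have "a @ b \<in> W" by simp
    then show ?thesis using mult_F[OF ab(1,3)] ab(2,4) unfolding carrier_F by blast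
  qed
  show "\<one>\<^bsub>F\<^esub> \<in> carrier F" unfolding carrier_F one_F by blast
  show "x \<otimes>\<^bsub>F\<^esub> y \<otimes>\<^bsub>F\<^esub> z = x \<otimes>\<^bsub>F\<^esub> (y \<otimes>\<^bsub>F\<^esub> z)"
    if xyz: "x \<in> carrier F" "y \<in> carrier F" "z \<in> carrier F" for x y z
  proof -
    obtain a b c where a: "a \<in> W" "x = cls a" "b \<in> W" "y = cls b" "c \<in> W" "z = cls c"
      using xyz unfolding carrier_F by blast
    then have "a @ b \<in> W" "b @ c \<in> W" by simp_all
    then show ?thesis using mult_F a by (metis append_assoc)
  qed
  show "\<one>\<^bsub>F\<^esub> \<otimes>\<^bsub>F\<^esub> x = x" if x: "x \<in> carrier F" for x
  proof -
    obtain a where "a \<in> W" "x = cls a" using x unfolding carrier_F by blast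
    then show ?thesis using mult_F[of "[]" a] one_F by simp
  qed
  show "\<exists>y \<in> carrier F. y \<otimes>\<^bsub>F\<^esub> x = \<one>\<^bsub>F\<^esub>" if x: "x \<in> carrier F" for x
  proof -
    obtain a where a: "a \<in> W" "x = cls a" using x unfolding carrier_F by blast
    obtain b where b: "b \<in> W" "eq (b @ a) []" using inverse_word[OF a(1)] by blast
    have "cls b \<otimes>\<^bsub>F\<^esub> x = \<one>\<^bsub>F\<^esub>" using mult_F[OF b(1) a(1)] cls_eq_iff[of "b @ a" "[]"] a b one_F by simp
    then show ?thesis using b(1) unfolding carrier_F by blast
  qed
qed

lemma foldr_F: "w \<in> W \<Longrightarrow> foldr (\<otimes>\<^bsub>F\<^esub>) (map (\<lambda>p. cls [p]) w) \<one>\<^bsub>F\<^esub> = cls w"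
proof (induction w rule: list.induct)
  case (Cons p w)
  then show ?case using mult_F[of "[p]" w] by simp
qed (simp add: one_F)

lemma inv_F:
  assumes "i \<in> I" "g \<in> carrier (G i)"
  shows "inv\<^bsub>F\<^esub> (cls [(i, g)]) = cls [(i, inv\<^bsub>G i\<^esub> g)]"
proof -
  interpret Gi: group "G i" using grp assms(1) .
  interpret group F by (rule group_F)
  have W: "[(i, g)] \<in> W" "[(i, inv\<^bsub>G i\<^esub> g)] \<in> W" using assms by auto
  have "eq ([(i, inv\<^bsub>G i\<^esub> g)] @ [(i, g)]) []"
    using fp_eq.trans[OF fp_eq.mult[where G = G, OF assms(1) Gi.inv_closed[OF assms(2)] assms(2)]] fp_eq.one[OF assms(1), of G] assms(2)
    by simp
  then have "cls [(i, inv\<^bsub>G i\<^esub> g)] \<otimes>\<^bsub>F\<^esub> cls [(i, g)] = \<one>\<^bsub>F\<^esub>"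
    using mult_F[OF W(2,1)] cls_eq_iff[of "[(i, inv\<^bsub>G i\<^esub> g)] @ [(i, g)]" "[]"] W one_F by simp
  then show ?thesis using W unfolding carrier_F by (intro inv_equality) (auto simp: carrier_F)
qed

lemma cls_singleton_inj:
  assumes "i \<in> I" "g \<in> carrier (G i)" "g \<noteq> \<one>\<^bsub>G i\<^esub>" "k \<in> I" "h \<in> carrier (G k)" "h \<noteq> \<one>\<^bsub>G k\<^esub>"
    "cls [(i, g)] = cls [(k, h)]"
  shows "(i, g) = (k, h)"
proof -
  have "eq [(i, g)] [(k, h)]" using cls_eq_iff[of "[(i, g)]" "[(k, h)]"] assms by simp
  from eq_act[OF this reduced_Nil] show ?thesis using assms by simp
qed

lemma cls_singleton_one: "i \<in> I \<Longrightarrow> cls [(i, \<one>\<^bsub>G i\<^esub>)] = \<one>\<^bsub>F\<^esub>"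
  using cls_eq_iff[of "[(i, \<one>\<^bsub>G i\<^esub>)]" "[]"] eq_W[OF fp_eq.one] fp_eq.one[of i I G] one_F by metis

text \<open>The identities of all factors give the same element of the free product. Leaving them
  out makes \<open>cls [p]\<close> injective on the generators, so that a letter determines its
  factor, and the remaining letters still generate.\<close>

definition fgens :: "('i \<Rightarrow> 'a set) \<Rightarrow> ('i \<times> 'a) set" where
  "fgens A = (SIGMA i:I. A i - {\<one>\<^bsub>G i\<^esub>})"

lemma inverse_closed_gen_set_F:
  assumes "finite I" "\<And>i. i \<in> I \<Longrightarrow> inverse_closed_gen_set (G i) (A i)"
  shows "inverse_closed_gen_set F ((\<lambda>p. cls [p]) ` fgens A)"
proof -
  let ?S = "(\<lambda>p. cls [p]) ` fgens A"
  have A: "finite (A i)" "A i \<subseteq> carrier (G i)" "\<And>a. a \<in> A i \<Longrightarrow> inv\<^bsub>G i\<^esub> a \<in> A i"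
    "generate (G i) (A i) = carrier (G i)" if "i \<in> I" for i
    using assms(2)[OF that] unfolding inverse_closed_gen_set_def by auto
  interpret group F by (rule group_F)
  have fin: "finite ?S" unfolding fgens_def using assms(1) A(1) by (intro finite_imageI finite_SigmaI) auto
  have "[p] \<in> W" if "p \<in> fgens A" for p using that A(2) unfolding fgens_def by auto
  then have sub: "?S \<subseteq> carrier F" unfolding carrier_F by blast
  have inv: "inv\<^bsub>F\<^esub> s \<in> ?S" if "s \<in> ?S" for s
  proof -
    from that obtain i a where i: "i \<in> I" "a \<in> A i" "a \<noteq> \<one>\<^bsub>G i\<^esub>" "s = cls [(i, a)]" unfolding fgens_def by auto
    interpret Gi: group "G i" using grp i(1) .
    have a: "a \<in> carrier (G i)" using A(2) i by auto
    have "(i, inv\<^bsub>G i\<^esub> a) \<in> fgens A" unfolding fgens_def using i A(3) a by auto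
    then show ?thesis using inv_F[OF i(1) a] i(4) by auto
  qed
  have single: "cls [(i, g)] \<in> generate F ?S" if i: "i \<in> I" and "g \<in> generate (G i) (A i)" for i g
    using that(2)
  proof (induction rule: generate.induct)
    case one
    then show ?case using cls_singleton_one[OF i] generate.one by metis
  next
    case (incl h)
    show ?case
    proof (cases "h = \<one>\<^bsub>G i\<^esub>")
      case True
      then show ?thesis using cls_singleton_one[OF i] generate.one by metis
    next
      case False
      then have "(i, h) \<in> fgens A" unfolding fgens_def using incl i by auto
      then show ?thesis by (intro generate.incl) auto
    qed
  next
    case (inv h)
    then show ?case
    proof (cases "h = \<one>\<^bsub>G i\<^esub>")
      case True
      interpret Gi: group "G i" using grp i .
      show ?thesis using cls_singleton_one[OF i] generate.one True by (metis Gi.inv_one)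
    next
      case False
      then have "(i, h) \<in> fgens A" unfolding fgens_def using inv i by auto
      then have "inv\<^bsub>F\<^esub> (cls [(i, h)]) \<in> generate F ?S" by (intro generate.inv) auto
      then show ?thesis using inv_F[OF i] A(2)[OF i] inv by auto
    qed
  next
    case (eng g h)
    have gh: "g \<in> carrier (G i)" "h \<in> carrier (G i)" using eng A(4)[OF i] by auto
    have "cls [(i, g)] \<otimes>\<^bsub>F\<^esub> cls [(i, h)] = cls [(i, g), (i, h)]" using mult_F[of "[(i, g)]" "[(i, h)]"] i gh by simp
    also have "\<dots> = cls [(i, g \<otimes>\<^bsub>G i\<^esub> h)]"
      using cls_eq_iff[of "[(i, g), (i, h)]"] fp_eq.mult[where G = G, OF i gh] i gh by simp
    finally show ?case using generate.eng[OF eng.IH] by simp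
  qed
  have "cls w \<in> generate F ?S" if "w \<in> W" for w
    using that
  proof (induction w rule: list.induct)
    case Nil
    then show ?case using generate.one one_F by metis
  next
    case (Cons p w)
    obtain i g where p: "p = (i, g)" by (cases p)
    then have "cls [p] \<in> generate F ?S" using single Cons.prems A(4) by auto
    then have "cls [p] \<otimes>\<^bsub>F\<^esub> cls w \<in> generate F ?S" using Cons by (intro generate.eng) auto
    then show ?case using mult_F[of "[p]" w] Cons.prems by simp
  qed
  then have "generate F ?S = carrier F" using generate_incl[OF sub] unfolding carrier_F by blast
  then show ?thesis unfolding inverse_closed_gen_set_def using fin sub inv by blast
qed

end

text \<open>By \<open>eq_prodl\<close> a deleted word equals the single letter carrying its product,
  which is the identity of the factor.\<close>

lemma reduces_fp_eq:
  fixes I :: "nat set"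
  assumes "group_family I G" and "factor_machines.reduces J M w w'" "factor_machines J M" "J \<subseteq> I"
    "\<And>j. j \<in> J \<Longrightarrow> in_alph (M j) \<subseteq> carrier (G j)"
    "\<And>j. j \<in> J \<Longrightarrow> lang (M j) = coWP (G j) (in_alph (M j))"
    "w \<in> lists (SIGMA i:I. carrier (G i))"
  shows "fp_eq I G w w'"
proof -
  interpret group_family I G by (rule assms(1))
  interpret factor_machines J M by (rule assms(3))
  from assms(2,7) show ?thesis
  proof (induction rule: reduces.induct)
    case (delete j t x y w)
    have j: "j \<in> I" "t \<in> lists (carrier (G j))" using delete.hyps assms(4,5) by auto
    have "prodl j t = \<one>\<^bsub>G j\<^esub>"
      using delete.hyps assms(6)[OF delete.hyps(1)] unfolding coWP_def by auto
    then have "eq (map (Pair j) t) []"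
      using eq_prodl[OF j] fp_eq.one[OF j(1), of G] fp_eq.trans by metis
    then have "eq (x @ map (Pair j) t @ y) (x @ [] @ y)"
      using delete.prems by (intro fp_eq.append fp_eq.refl) auto
    then show ?case using delete.IH delete.prems fp_eq.trans by fastforce
  qed (rule fp_eq.refl)
qed

section \<open>Properties of co-word problems\<close>

context
  fixes G :: "('a, 'b) monoid_scheme" and A :: "'a set"
  assumes group: "group G" and gens: "inverse_closed_gen_set G A"
begin

interpretation group G by (rule group)

abbreviation "prod_word t \<equiv> foldr (\<otimes>\<^bsub>G\<^esub>) t \<one>\<^bsub>G\<^esub>"

lemma prod_word_append:
  assumes "t \<in> lists A" "z \<in> lists A"
  shows "prod_word t \<in> carrier G" "prod_word (t @ z) = prod_word t \<otimes>\<^bsub>G\<^esub> prod_word z"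
proof -
  have A: "A \<subseteq> carrier G" using gens unfolding inverse_closed_gen_set_def by blast
  have c: "prod_word t \<in> carrier G" if "t \<in> lists A" for t
    using that A by (induction t) auto
  show "prod_word t \<in> carrier G" using c assms by blast
  show "prod_word (t @ z) = prod_word t \<otimes>\<^bsub>G\<^esub> prod_word z"
    using assms(1)
  proof (induction t rule: list.induct)
    case (Cons a t)
    then have "a \<in> carrier G" "prod_word t \<in> carrier G" using A c by auto
    then show ?case using Cons c[OF assms(2)] by (simp add: m_assoc)
  qed (use c[OF assms(2)] in simp)
qed

lemma coWP_trivial:
  assumes "t \<in> lists A" "t \<notin> coWP G A" "z \<in> coWP G A"
  shows "t @ z \<in> coWP G A"
proof -
  have "z \<in> lists A" "prod_word z \<noteq> \<one>\<^bsub>G\<^esub>" "prod_word t = \<one>\<^bsub>G\<^esub>" using assms unfolding coWP_def by auto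
  then show ?thesis using prod_word_append assms(1) unfolding coWP_def by simp
qed

lemma coWP_inverse:
  assumes "x \<in> lists A"
  shows "\<exists>y \<in> lists A. x @ y \<notin> coWP G A"
proof -
  have A: "A \<subseteq> carrier G" "\<And>a. a \<in> A \<Longrightarrow> inv\<^bsub>G\<^esub> a \<in> A"
    using gens unfolding inverse_closed_gen_set_def by auto
  have "\<exists>y \<in> lists A. prod_word (x @ y) = \<one>\<^bsub>G\<^esub>"
    using assms
  proof (induction x rule: list.induct)
    case (Cons a x)
    then obtain y where y: "y \<in> lists A" "prod_word (x @ y) = \<one>\<^bsub>G\<^esub>" by auto
    have a: "a \<in> carrier G" "inv\<^bsub>G\<^esub> a \<in> A" and x: "x \<in> lists A" using Cons.prems A by auto
    have "prod_word ((x @ y) @ [inv\<^bsub>G\<^esub> a]) = prod_word (x @ y) \<otimes>\<^bsub>G\<^esub> prod_word [inv\<^bsub>G\<^esub> a]"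
      using x y a by (intro prod_word_append) auto
    then have "prod_word ((a # x) @ y @ [inv\<^bsub>G\<^esub> a]) = \<one>\<^bsub>G\<^esub>" using y(2) a by simp
    then show ?case using y(1) a(2) by (intro bexI[of _ "y @ [inv\<^bsub>G\<^esub> a]"]) auto
  qed (auto intro: bexI[of _ "[]"])
  then show ?thesis unfolding coWP_def by auto
qed

end

theorem special_coET0L_group_free_product:
  fixes G :: "nat \<Rightarrow> ('a, 'b) monoid_scheme"
  assumes fin: "finite I" and special: "\<And>i. i \<in> I \<Longrightarrow> special_coET0L_group (G i)"
  shows "special_coET0L_group (free_product I G)"
proof -
  interpret group_family I G
    by (rule group_family.intro) (use special in \<open>simp add: special_coET0L_group_def\<close>)
  have "\<exists>M :: (nat, 'a, ('a, nat) stack_symbol) cspda.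
      inverse_closed_gen_set (G i) (in_alph M) \<and> special_cspda M \<and> lang M = coWP (G i) (in_alph M)"
    if "i \<in> I" for i
    using special[OF that] unfolding special_coET0L_group_def by blast
  then obtain M :: "nat \<Rightarrow> (nat, 'a, ('a, nat) stack_symbol) cspda"
    where M: "\<And>i. i \<in> I \<Longrightarrow> inverse_closed_gen_set (G i) (in_alph (M i)) \<and> special_cspda (M i) \<and>
      lang (M i) = coWP (G i) (in_alph (M i))" by metis
  define S where "S = fgens (\<lambda>i. in_alph (M i))"
  \<comment> \<open>Only factors with a non-identity generator take part. A trivial factor has an
    empty language and hence no good block, whereas completeness needs blocks for every factor in
    \<open>J\<close>.\<close>
  define J where "J = fst ` S"
  define cl where "cl = (\<lambda>p. cls [p])"
  define A where "A = cl ` S"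
  define pr where "pr = inv_into S cl"
  have JI: "J \<subseteq> I" unfolding J_def S_def fgens_def by auto
  have carr: "in_alph (M i) \<subseteq> carrier (G i)" if "i \<in> I" for i
    using M[OF that] unfolding inverse_closed_gen_set_def by blast
  have S: "i \<in> J" "i \<in> I" "a \<in> in_alph (M i)" "a \<in> carrier (G i)" "a \<noteq> \<one>\<^bsub>G i\<^esub>" if "(i, a) \<in> S" for i a
    using that carr unfolding J_def S_def fgens_def by force+
  have gens: "inverse_closed_gen_set F A"
    unfolding A_def S_def cl_def by (rule inverse_closed_gen_set_F[OF fin]) (use M in blast)
  have inj: "inj_on cl S"
    unfolding cl_def using cls_singleton_inj S by (intro inj_onI) (metis prod.collapse)
  have pr: "pr l \<in> S" "cl (pr l) = l" if "l \<in> A" for l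
    using that inv_into_into[of l cl S] f_inv_into_f[of l cl S] unfolding A_def pr_def by blast+
  interpret product_groups J M A pr
  proof
    show "special_cspda (M j)" if "j \<in> J" for j using M that JI by blast
    show "finite J" using fin JI finite_subset by blast
    show "finite A" using gens unfolding inverse_closed_gen_set_def by blast
    show "pr l \<in> factor_machines.letters J M" if "l \<in> A" for l
    proof -
      have "factor_machines J M" by unfold_locales (use M JI in blast)
      then show ?thesis using S[of "fst (pr l)" "snd (pr l)"] pr(1)[OF that]
        by (simp add: factor_machines.letters_def mem_Sigma_iff[of "fst (pr l)" "snd (pr l)", simplified])
    qed
    show "[] \<notin> lang (M j)" if "j \<in> J" for j using M that JI unfolding coWP_def by auto
    show "lang (M j) \<noteq> {}" if j: "j \<in> J" for j
    proof -
      obtain a where a: "(j, a) \<in> S" using j unfolding J_def by auto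
      interpret group "G j" using grp JI j by blast
      have "[a] \<in> coWP (G j) (in_alph (M j))" unfolding coWP_def using S[OF a] by simp
      then show ?thesis using M j JI by blast
    qed
    show "\<exists>y \<in> lists (in_alph (M j)). x @ y \<notin> lang (M j)" if "j \<in> J" "x \<in> lists (in_alph (M j))" for j x
      using coWP_inverse[OF grp, of j "in_alph (M j)" x] M[of j] that JI by auto
    show "t @ z \<in> lang (M j)"
      if "j \<in> J" "t \<in> lists (in_alph (M j))" "t \<notin> lang (M j)" "z \<in> lang (M j)" for j t z
      using coWP_trivial[OF grp, of j "in_alph (M j)" t z] M[of j] that JI by auto
  qed
  \<comment> \<open>Deletion of trivial factor words decides triviality: what remains can be brought
    into normal form, and van der Waerden's action shows that a non-empty normal form is not
    trivial.\<close>
  have reduces_iff: "reduces w [] \<longleftrightarrow> eq w []" if w: "w \<in> lists letters" for w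
  proof
    have carrJ: "in_alph (M j) \<subseteq> carrier (G j)" "lang (M j) = coWP (G j) (in_alph (M j))" if "j \<in> J" for j
      using carr M that JI by auto
    have "letters \<subseteq> (SIGMA i:I. carrier (G i))" unfolding letters_def using carrJ(1) JI by blast
    then have wW: "w \<in> W" using w lists_mono by blast
    have red: "eq w w'" if "reduces w w'" for w'
      by (rule reduces_fp_eq[OF group_family_axioms that factor_machines_axioms JI carrJ wW])
    then show "reduces w [] \<Longrightarrow> eq w []" by blast
    assume e: "eq w []"
    obtain ts where ts: "successively (\<lambda>s t. fst s \<noteq> fst t) ts" "\<forall>(j, t) \<in> set ts. j \<in> J \<and> t \<in> lang (M j)"
      "reduces w (concat (map (\<lambda>(j, t). map (Pair j) t) ts))" using ex_normal_form[OF w] by blast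
    have "\<forall>(j, t) \<in> set ts. j \<in> I \<and> t \<in> lists (carrier (G j)) \<and> prodl j t \<noteq> \<one>\<^bsub>G j\<^esub>"
    proof clarify
      fix j t assume jt: "(j, t) \<in> set ts"
      then have "j \<in> J" "t \<in> coWP (G j) (in_alph (M j))" using ts(2) carrJ(2) by auto
      then show "j \<in> I \<and> t \<in> lists (carrier (G j)) \<and> prodl j t \<noteq> \<one>\<^bsub>G j\<^esub>"
        using carrJ(1) JI unfolding coWP_def by auto
    qed
    moreover have "eq (concat (map (\<lambda>(j, t). map (Pair j) t) ts)) []"
      using red[OF ts(3)] e fp_eq.sym fp_eq.trans by metis
    ultimately have "ts = []" using normal_form_nontrivial[OF ts(1)] by blast
    then show "reduces w []" using ts(3) by simp
  qed
  have "lang N = coWP F A"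
  proof -
    have "reduces (map pr w) [] \<longleftrightarrow> foldr (\<otimes>\<^bsub>F\<^esub>) w \<one>\<^bsub>F\<^esub> = \<one>\<^bsub>F\<^esub>" if w: "w \<in> lists A" for w
    proof -
      have "map (\<lambda>p. cls [p]) (map pr w) = w"
        using w pr(2) unfolding cl_def map_map by (intro map_idI) auto
      moreover have "S \<subseteq> (SIGMA i:I. carrier (G i))" using S by auto
      then have "map pr w \<in> W" using w pr(1) by (auto simp: in_lists_conv_set)
      ultimately have "foldr (\<otimes>\<^bsub>F\<^esub>) w \<one>\<^bsub>F\<^esub> = cls (map pr w)" using foldr_F by metis
      moreover have "map pr w \<in> lists letters" using w pr_letters by auto
      ultimately show ?thesis using reduces_iff cls_eq_iff[OF \<open>map pr w \<in> W\<close>, of "[]"] one_F by simp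
    qed
    then show ?thesis unfolding lang_N coWP_def by blast
  qed
  moreover have "Letter ` A \<subseteq> check_alph N" "Letter ` A \<subseteq> push_alph N"
    by (auto simp: calph_def palph_def)
  ultimately show ?thesis
    unfolding special_coET0L_group_def using group_F gens special_N N_sel(3) by blast
qed

theorem theorem6p3:
  fixes G :: "nat \<Rightarrow> ('a, 'b) monoid_scheme" and m :: nat
  assumes "m \<ge> 1"
    and "\<And>i. i \<in> {1..m} \<Longrightarrow> special_coET0L_group (G i)"
  shows "special_coET0L_group (free_product {1..m} G)"
  using special_coET0L_group_free_product[OF finite_atLeastAtMost assms(2)] .

end
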